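(* Let $\gamma:J\to M$ be a $C^1$ path. A map $\mathcal{D}^\gamma$ of the restriction of the tensor algebra over $M$ on $\gamma(J)$ into itself is a derivation if and only if there exists an $S$-transport $S^\gamma$ along $\gamma$ (of class $C^1$), which is unique and which generates $\mathcal{D}^\gamma$ by means of $$(\mathcal{D}^\gamma T)(\gamma(s))=\lim_{\varepsilon\to0}\frac1\varepsilon\Bigl[S^\gamma_{s+\varepsilon\to s}T(\gamma(s+\varepsilon))-T(\gamma(s))\Bigr],\qquad s,s+\varepsilon\in J,$$ for $C^1$ tensor fields $T$ on $\gamma(J)$.
   Context: $M$ is a real differentiable manifold of class $C^1$ and dimension $n$; $J$ is a real interval. $T^{p,q}_x(M)$ is the space of tensors of type $(p,q)$ at $x\in M$, with $T^{0,0}_x(M)=\mathbb{R}$. A tensor field on $\gamma(J)$ assigns to each point $x\in\gamma(J)$ a tensor at $x$. A derivation of the restriction of the tensor algebra over $M$ on $\gamma(J)$ is a type-preserving map $\mathcal{D}^\gamma$, taking $C^1$ tensor fields on $\gamma(J)$ into tensor fields on $\gamma(J)$, such that $\mathcal{D}^\gamma(\lambda A+\mu A')=\lambda\mathcal{D}^\gamma A+\mu\mathcal{D}^\gamma A'$ for $\lambda,\mu\in\mathbb{R}$; $\mathcal{D}^\gamma\circ C=C\circ\mathcal{D}^\gamma$ for a contraction operator $C$; and $\mathcal{D}^\gamma(A\otimes B)=(\mathcal{D}^\gamma A)\otimes B+A\otimes(\mathcal{D}^\gamma B)$, where $A,A',B$ are $C^1$ tensor fields on $\gamma(J)$, the types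 of $A$ and $A'$ being the same. An $S$-transport along $\gamma:J\to M$ is a map $S^\gamma:(s,t)\mapsto S^\gamma_{s\to t}$, $(s,t)\in J\times J$, where $S^\gamma_{s\to t}$ maps the tensor algebra at $\gamma(s)$ into the tensor algebra at $\gamma(t)$ and satisfies: (1) $S^\gamma_{s\to t}(T^{p,q}_{\gamma(s)}(M))\subseteq T^{p,q}_{\gamma(t)}(M)$; (2) $S^\gamma_{s\to t}$ is $\mathbb{R}$-linear on each $T^{p,q}_{\gamma(s)}(M)$; (3) $S^\gamma_{s\to t}(A_1\otimes A_2)=(S^\gamma_{s\to t}A_1)\otimes(S^\gamma_{s\to t}A_2)$; (4) $S^\gamma_{s\to t}\circ C=C\circ S^\gamma_{s\to t}$ for any contraction operator $C$; (5) $S^\gamma_{t\to r}\circ S^\gamma_{s\to t}=S^\gamma_{s\to r}$ for $r,s,t\in J$; (6) $S^\gamma_{s\to s}=\mathrm{id}$. If $\{E_i|_{\gamma(s)}\}$ is a basis in the tangent space at $\gamma(s)$, $s\in J$, the matrix $H(t,s;\gamma)=[H^i_{\ j}(t,s;\gamma)]$ of $S^\gamma$ is defined by $S^\gamma_{s\to t}(E_j|_{\gamma(s)})=H^i_{\ j}(t,s;\gamma)E_i|_{\gamma(t)}$ (summation over repeated indices from $1$ to $n$). $S^\gamma$ is of class $C^1$ if $H(t,s;\gamma)$ is of class $C^1$ with respect to $t$ (or, equivalently, to $s$).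
   Formalization: On the derivation side two conditions, which every generated map has, are added: D^γ f = d(f∘γ)/ds on functions, and D^γ maps C^1 fields to continuous ones. Jacobians of coordinate changes are assumed C^1 along γ, so that C^1 tensor fields are well defined; J is not a single point. *)

theory Defs
  imports "HOL-Analysis.Analysis"
begin

text \<open>
  The manifold is the whole of a Hausdorff type \<open>'a\<close>, with a given (not necessarily maximal)
  atlas of charts \<open>(U, \<phi>)\<close>; its dimension is the cardinality of the finite index type \<open>'n\<close>.
\<close>

type_synonym ('a, 'n) chart = "'a set \<times> ('a \<Rightarrow> (real, 'n) vec)"

text \<open>One-sided derivatives are taken at those end points of \<open>I\<close> that belong to \<open>I\<close>.\<close>

definition C1_on :: "real set \<Rightarrow> (real \<Rightarrow> 'b::real_normed_vector) \<Rightarrow> bool" where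
  "C1_on I f \<longleftrightarrow>
     (\<exists>f'. (\<forall>s\<in>I. (f has_vector_derivative f' s) (at s within I)) \<and> continuous_on I f')"

definition transition ::
    "('a, 'n) chart \<Rightarrow> ('a, 'n) chart \<Rightarrow> real^'n::finite \<Rightarrow> real^'n" where
  "transition c d = snd d \<circ> the_inv_into (fst c) (snd c)"

text \<open>Row index: coordinate of \<open>d\<close>; column index: coordinate of \<open>c\<close>.\<close>

definition chart_jac ::
    "('a, 'n) chart \<Rightarrow> ('a, 'n) chart \<Rightarrow> 'a \<Rightarrow> real^'n::finite^'n" where
  "chart_jac c d x = jacobian (transition c d) (at (snd c x))"

definition C1_atlas :: "('a::t2_space, 'n::finite) chart set \<Rightarrow> bool" where
  "C1_atlas \<A> \<longleftrightarrow>
     (\<Union>c\<in>\<A>. fst c) = UNIV \<and>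
     (\<forall>(U, \<phi>)\<in>\<A>. open U \<and> open (\<phi> ` U) \<and> homeomorphism U (\<phi> ` U) \<phi> (the_inv_into U \<phi>)) \<and>
     (\<forall>c\<in>\<A>. \<forall>d\<in>\<A>.
        transition c d differentiable_on (snd c ` (fst c \<inter> fst d)) \<and>
        continuous_on (snd c ` (fst c \<inter> fst d)) (\<lambda>y. jacobian (transition c d) (at y)))"

definition C1_path ::
    "('a::t2_space, 'n::finite) chart set \<Rightarrow> real set \<Rightarrow> (real \<Rightarrow> 'a) \<Rightarrow> bool" where
  "C1_path \<A> J \<gamma> \<longleftrightarrow>
     continuous_on J \<gamma> \<and> (\<forall>c\<in>\<A>. C1_on {s\<in>J. \<gamma> s \<in> fst c} (snd c \<circ> \<gamma>))"

text \<open>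
  On a manifold that is only of class C1 the Jacobians of the coordinate changes are merely
  continuous, so that ``the components are C1 functions of the parameter'' depends on the chart.
  The next condition says exactly that, along \<open>\<gamma>\<close>, it does not depend on the chart of the given
  atlas.  It is automatic for atlases of class C2, and every paracompact C1 manifold has a
  compatible atlas of that kind.
\<close>

definition C1_jacobians_along ::
    "('a::t2_space, 'n::finite) chart set \<Rightarrow> real set \<Rightarrow> (real \<Rightarrow> 'a) \<Rightarrow> bool" where
  "C1_jacobians_along \<A> J \<gamma> \<longleftrightarrow>
     (\<forall>c\<in>\<A>. \<forall>d\<in>\<A>. C1_on {s\<in>J. \<gamma> s \<in> fst c \<inter> fst d} (\<lambda>s. chart_jac c d (\<gamma> s)))"

text \<open>
  A tensor is the family of its component arrays in the charts around the point, subject to the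
  transformation law.  The first list holds the upper (contravariant) indices, the second list the
  lower (covariant) ones.  Components outside the meaningful range are \<open>0\<close>, so that equality of
  tensors is equality of functions; the zero tensors of all types are thereby the same object.
\<close>

type_synonym ('a, 'n) tensor = "('a, 'n) chart \<Rightarrow> 'n list \<Rightarrow> 'n list \<Rightarrow> real"

definition tensor_space ::
    "('a::t2_space, 'n::finite) chart set \<Rightarrow> nat \<Rightarrow> nat \<Rightarrow> 'a \<Rightarrow> ('a, 'n) tensor set" where
  "tensor_space \<A> p q x = {A.
     (\<forall>c us ls. A c us ls \<noteq> 0 \<longrightarrow> c \<in> \<A> \<and> x \<in> fst c \<and> length us = p \<and> length ls = q) \<and>
     (\<forall>c\<in>\<A>. \<forall>d\<in>\<A>. x \<in> fst c \<inter> fst d \<longrightarrow>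
        (\<forall>us ls. length us = p \<longrightarrow> length ls = q \<longrightarrow>
           A d us ls =
             (\<Sum>ks | length ks = p. \<Sum>ms | length ms = q.
                (\<Prod>a<p. chart_jac c d x $ (us ! a) $ (ks ! a)) *
                (\<Prod>b<q. chart_jac d c x $ (ms ! b) $ (ls ! b)) * A c ks ms)))}"

definition tensor_lin ::
    "real \<Rightarrow> ('a, 'n) tensor \<Rightarrow> real \<Rightarrow> ('a, 'n) tensor \<Rightarrow> ('a, 'n) tensor" where
  "tensor_lin a A b B = (\<lambda>c us ls. a * A c us ls + b * B c us ls)"

text \<open>The arguments \<open>p\<close>, \<open>q\<close> are the type of the left factor.\<close>

definition tensor_prod ::
    "nat \<Rightarrow> nat \<Rightarrow> ('a, 'n) tensor \<Rightarrow> ('a, 'n) tensor \<Rightarrow> ('a, 'n) tensor" where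
  "tensor_prod p q A B =
     (\<lambda>c us ls. A c (take p us) (take q ls) * B c (drop p us) (drop q ls))"

text \<open>
  Contraction of the upper index in position \<open>k\<close> with the lower index in position \<open>l\<close>
  (positions are counted from \<open>0\<close>).
\<close>

definition contraction :: "nat \<Rightarrow> nat \<Rightarrow> ('a, 'n::finite) tensor \<Rightarrow> ('a, 'n) tensor" where
  "contraction k l A =
     (\<lambda>c us ls. \<Sum>i\<in>UNIV. A c (take k us @ i # drop k us) (take l ls @ i # drop l ls))"

text \<open>The identification of the real numbers with the tensors of type (0,0) at \<open>x\<close>.\<close>

definition scalar_tensor :: "('a, 'n) chart set \<Rightarrow> 'a \<Rightarrow> real \<Rightarrow> ('a, 'n) tensor" where
  "scalar_tensor \<A> x r =
     (\<lambda>c us ls. if c \<in> \<A> \<and> x \<in> fst c \<and> us = [] \<and> ls = [] then r else 0)"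

text \<open>
  A field on \<open>P\<close> is a function of the points of \<open>P\<close> alone; it is extended by \<open>0\<close> outside \<open>P\<close>.
\<close>

definition tensor_fields ::
    "('a::t2_space, 'n::finite) chart set \<Rightarrow> 'a set \<Rightarrow> nat \<Rightarrow> nat \<Rightarrow> ('a \<Rightarrow> ('a, 'n) tensor) set" where
  "tensor_fields \<A> P p q =
     {T. (\<forall>x\<in>P. T x \<in> tensor_space \<A> p q x) \<and> (\<forall>x. x \<notin> P \<longrightarrow> T x = (\<lambda>c us ls. 0))}"

definition C0_tensor_fields ::
    "('a::t2_space, 'n::finite) chart set \<Rightarrow> real set \<Rightarrow> (real \<Rightarrow> 'a) \<Rightarrow> nat \<Rightarrow> nat \<Rightarrow>
      ('a \<Rightarrow> ('a, 'n) tensor) set" where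
  "C0_tensor_fields \<A> J \<gamma> p q =
     {T \<in> tensor_fields \<A> (\<gamma> ` J) p q.
        \<forall>c\<in>\<A>. \<forall>us ls. continuous_on {s\<in>J. \<gamma> s \<in> fst c} (\<lambda>s. T (\<gamma> s) c us ls)}"

definition C1_tensor_fields ::
    "('a::t2_space, 'n::finite) chart set \<Rightarrow> real set \<Rightarrow> (real \<Rightarrow> 'a) \<Rightarrow> nat \<Rightarrow> nat \<Rightarrow>
      ('a \<Rightarrow> ('a, 'n) tensor) set" where
  "C1_tensor_fields \<A> J \<gamma> p q =
     {T \<in> tensor_fields \<A> (\<gamma> ` J) p q.
        \<forall>c\<in>\<A>. \<forall>us ls. C1_on {s\<in>J. \<gamma> s \<in> fst c} (\<lambda>s. T (\<gamma> s) c us ls)}"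

definition scalar_field ::
    "('a, 'n) chart set \<Rightarrow> 'a set \<Rightarrow> ('a \<Rightarrow> real) \<Rightarrow> 'a \<Rightarrow> ('a, 'n) tensor" where
  "scalar_field \<A> P f = (\<lambda>x. if x \<in> P then scalar_tensor \<A> x (f x) else (\<lambda>c us ls. 0))"

definition derivation_along ::
    "('a::t2_space, 'n::finite) chart set \<Rightarrow> real set \<Rightarrow> (real \<Rightarrow> 'a) \<Rightarrow>
      (('a \<Rightarrow> ('a, 'n) tensor) \<Rightarrow> ('a \<Rightarrow> ('a, 'n) tensor)) \<Rightarrow> bool" where
  "derivation_along \<A> J \<gamma> D \<longleftrightarrow>
     (\<forall>p q. \<forall>T \<in> C1_tensor_fields \<A> J \<gamma> p q. D T \<in> tensor_fields \<A> (\<gamma> ` J) p q) \<and>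
     (\<forall>p q a b. \<forall>A \<in> C1_tensor_fields \<A> J \<gamma> p q. \<forall>A' \<in> C1_tensor_fields \<A> J \<gamma> p q.
        D (\<lambda>x. tensor_lin a (A x) b (A' x)) = (\<lambda>x. tensor_lin a (D A x) b (D A' x))) \<and>
     (\<forall>p q. \<forall>k\<le>p. \<forall>l\<le>q. \<forall>A \<in> C1_tensor_fields \<A> J \<gamma> (Suc p) (Suc q).
        D (\<lambda>x. contraction k l (A x)) = (\<lambda>x. contraction k l (D A x))) \<and>
     (\<forall>p q p' q'. \<forall>A \<in> C1_tensor_fields \<A> J \<gamma> p q. \<forall>B \<in> C1_tensor_fields \<A> J \<gamma> p' q'.
        D (\<lambda>x. tensor_prod p q (A x) (B x)) =
          (\<lambda>x. tensor_lin 1 (tensor_prod p q (D A x) (B x)) 1 (tensor_prod p q (A x) (D B x))))"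

text \<open>
  The two conditions below do not follow from \<open>derivation_along\<close>: the zero map is a derivation in
  that sense (for any \<open>\<gamma>\<close>), and on the real line \<open>T \<mapsto> T' + (p - q) g T\<close> (for \<open>T\<close> of type (p,q)) is one for every
  function \<open>g\<close>, however discontinuous.  Both conditions hold for every map generated by an
  S-transport of class C1.
\<close>

definition differentiates_functions_along ::
    "('a::t2_space, 'n::finite) chart set \<Rightarrow> real set \<Rightarrow> (real \<Rightarrow> 'a) \<Rightarrow>
      (('a \<Rightarrow> ('a, 'n) tensor) \<Rightarrow> ('a \<Rightarrow> ('a, 'n) tensor)) \<Rightarrow> bool" where
  "differentiates_functions_along \<A> J \<gamma> D \<longleftrightarrow>
     (\<forall>f r. \<forall>s\<in>J. C1_on J (f \<circ> \<gamma>) \<longrightarrow> ((f \<circ> \<gamma>) has_real_derivative r) (at s within J) \<longrightarrow>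
        D (scalar_field \<A> (\<gamma> ` J) f) (\<gamma> s) = scalar_tensor \<A> (\<gamma> s) r)"

definition maps_C1_to_C0_along ::
    "('a::t2_space, 'n::finite) chart set \<Rightarrow> real set \<Rightarrow> (real \<Rightarrow> 'a) \<Rightarrow>
      (('a \<Rightarrow> ('a, 'n) tensor) \<Rightarrow> ('a \<Rightarrow> ('a, 'n) tensor)) \<Rightarrow> bool" where
  "maps_C1_to_C0_along \<A> J \<gamma> D \<longleftrightarrow>
     (\<forall>p q. \<forall>T \<in> C1_tensor_fields \<A> J \<gamma> p q. D T \<in> C0_tensor_fields \<A> J \<gamma> p q)"

text \<open>
  Only the values of \<open>S s t\<close> for \<open>s\<close>, \<open>t\<close> in \<open>J\<close> on homogeneous tensors at \<open>\<gamma> s\<close> are relevant.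
\<close>

definition S_transport ::
    "('a::t2_space, 'n::finite) chart set \<Rightarrow> real set \<Rightarrow> (real \<Rightarrow> 'a) \<Rightarrow>
      (real \<Rightarrow> real \<Rightarrow> ('a, 'n) tensor \<Rightarrow> ('a, 'n) tensor) \<Rightarrow> bool" where
  "S_transport \<A> J \<gamma> S \<longleftrightarrow>
     (\<forall>s\<in>J. \<forall>t\<in>J. \<forall>p q. S s t ` tensor_space \<A> p q (\<gamma> s) \<subseteq> tensor_space \<A> p q (\<gamma> t)) \<and>
     (\<forall>s\<in>J. \<forall>t\<in>J. \<forall>p q a b. \<forall>A \<in> tensor_space \<A> p q (\<gamma> s). \<forall>B \<in> tensor_space \<A> p q (\<gamma> s).
        S s t (tensor_lin a A b B) = tensor_lin a (S s t A) b (S s t B)) \<and>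
     (\<forall>s\<in>J. \<forall>t\<in>J. \<forall>p q p' q'. \<forall>A \<in> tensor_space \<A> p q (\<gamma> s). \<forall>B \<in> tensor_space \<A> p' q' (\<gamma> s).
        S s t (tensor_prod p q A B) = tensor_prod p q (S s t A) (S s t B)) \<and>
     (\<forall>s\<in>J. \<forall>t\<in>J. \<forall>p q. \<forall>k\<le>p. \<forall>l\<le>q. \<forall>A \<in> tensor_space \<A> (Suc p) (Suc q) (\<gamma> s).
        S s t (contraction k l A) = contraction k l (S s t A)) \<and>
     (\<forall>r\<in>J. \<forall>s\<in>J. \<forall>t\<in>J. \<forall>p q. \<forall>A \<in> tensor_space \<A> p q (\<gamma> s). S t r (S s t A) = S s r A) \<and>
     (\<forall>s\<in>J. \<forall>p q. \<forall>A \<in> tensor_space \<A> p q (\<gamma> s). S s s A = A)"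

text \<open>Tangent vectors are the tensors of type (1,0).  The basis may depend on the parameter \<open>s\<close>, not
  only on the point \<open>\<gamma> s\<close>.\<close>

definition C1_basis_along ::
    "('a::t2_space, 'n::finite) chart set \<Rightarrow> real set \<Rightarrow> (real \<Rightarrow> 'a) \<Rightarrow>
      (real \<Rightarrow> 'n \<Rightarrow> ('a, 'n) tensor) \<Rightarrow> bool" where
  "C1_basis_along \<A> J \<gamma> E \<longleftrightarrow>
     (\<forall>s\<in>J. (\<forall>i. E s i \<in> tensor_space \<A> 1 0 (\<gamma> s)) \<and>
        (\<forall>A \<in> tensor_space \<A> 1 0 (\<gamma> s).
           \<exists>!a::real^'n. A = (\<lambda>c us ls. \<Sum>i\<in>UNIV. a $ i * E s i c us ls))) \<and>
     (\<forall>c\<in>\<A>. \<forall>i us ls. C1_on {s\<in>J. \<gamma> s \<in> fst c} (\<lambda>s. E s i c us ls))"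

definition is_transport_matrix ::
    "real set \<Rightarrow> (real \<Rightarrow> 'n \<Rightarrow> ('a, 'n::finite) tensor) \<Rightarrow>
      (real \<Rightarrow> real \<Rightarrow> ('a, 'n) tensor \<Rightarrow> ('a, 'n) tensor) \<Rightarrow>
      (real \<Rightarrow> real \<Rightarrow> real^'n^'n) \<Rightarrow> bool" where
  "is_transport_matrix J E S H \<longleftrightarrow>
     (\<forall>s\<in>J. \<forall>t\<in>J. \<forall>j. S s t (E s j) = (\<lambda>c us ls. \<Sum>i\<in>UNIV. H t s $ i $ j * E t i c us ls))"

text \<open>
  Two C1 fields of bases along \<open>\<gamma>\<close> differ by a C1 matrix function, so the choice of \<open>E\<close> is
  immaterial.
\<close>

definition C1_transport ::
    "('a::t2_space, 'n::finite) chart set \<Rightarrow> real set \<Rightarrow> (real \<Rightarrow> 'a) \<Rightarrow>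
      (real \<Rightarrow> real \<Rightarrow> ('a, 'n) tensor \<Rightarrow> ('a, 'n) tensor) \<Rightarrow> bool" where
  "C1_transport \<A> J \<gamma> S \<longleftrightarrow>
     (\<exists>E H. C1_basis_along \<A> J \<gamma> E \<and> is_transport_matrix J E S H \<and>
        (\<forall>s\<in>J. C1_on J (\<lambda>t. H t s)))"

text \<open>
  The limit is the one in the finite-dimensional space of tensors of the given type at \<open>\<gamma> s\<close>,
  i.e. the limit of all components.
\<close>

definition generates ::
    "('a::t2_space, 'n::finite) chart set \<Rightarrow> real set \<Rightarrow> (real \<Rightarrow> 'a) \<Rightarrow>
      (real \<Rightarrow> real \<Rightarrow> ('a, 'n) tensor \<Rightarrow> ('a, 'n) tensor) \<Rightarrow>
      (('a \<Rightarrow> ('a, 'n) tensor) \<Rightarrow> ('a \<Rightarrow> ('a, 'n) tensor)) \<Rightarrow> bool" where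
  "generates \<A> J \<gamma> S D \<longleftrightarrow>
     (\<forall>p q. \<forall>T \<in> C1_tensor_fields \<A> J \<gamma> p q. \<forall>s\<in>J. \<forall>c\<in>\<A>. \<gamma> s \<in> fst c \<longrightarrow>
        (\<forall>us ls.
           ((\<lambda>\<epsilon>. 1 / \<epsilon> * (S (s + \<epsilon>) s (T (\<gamma> (s + \<epsilon>))) c us ls - T (\<gamma> s) c us ls))
              \<longlongrightarrow> D T (\<gamma> s) c us ls) (at 0 within {\<epsilon>. s + \<epsilon> \<in> J})))"

end

theory Submission
  imports Defs
begin

text \<open>
  An S-transport of class C1 is the same thing as a moving coframe along the path, up to a constant
  matrix.  A coframe is an invertible matrix function \<open>\<Psi>\<close> of the parameter; it turns a tensor at
  \<open>\<gamma> s\<close> into an array of numbers, its frame components, and the transport that belongs to \<open>\<Psi>\<close>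
  keeps the frame components.  Conversely, after one parameter \<open>s0\<close> is fixed, ``transport to \<open>s0\<close>'' is a
  coframe from which a given S-transport is recovered (\<open>S_transport_coframe\<close>).

  In frame components the generating limit is an ordinary derivative.  The map generated by the
  transport of \<open>\<Psi>\<close> is therefore the covariant derivative \<open>nabla \<Psi>\<close>: pass to frame components,
  differentiate, go back (\<open>generates_iff\<close>).  Linearity, the Leibniz rule and compatibility with
  contractions are inherited from the derivative of real functions, and this is the implication from
  transports to derivations (\<open>derivation_if_generated\<close>).

  For the other implication, let \<open>D\<close> be a derivation that differentiates functions along the path and
  maps C1 fields to continuous ones.  On vector fields the equation \<open>D = nabla \<Psi>\<close> reads
  \<open>(\<Psi> V)' = \<Psi> (D V)\<close>.  In a chart, \<open>D V = V' + \<Gamma> V\<close>, where the columns of \<open>\<Gamma>\<close> are the values of \<open>D\<close>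
  on the coordinate vector fields (\<open>connection_exists\<close>), so that the equation becomes the linear
  differential equation \<open>\<Psi>' = \<Psi> \<Gamma>\<close>.  Its solutions, the parallel coframes, exist near every parameter and
  are unique up to a constant matrix on the left; hence they can be continued over all of \<open>J\<close>
  (\<open>parallel_exists\<close>).  The constant matrix does not affect the transport, which gives its
  uniqueness (\<open>parallel_unique\<close>, \<open>transport_unique\<close>).

  Tensors of all other types follow from vectors by one device, used both for transports and for
  derivations.  A tensor of type \<open>(p, q + 1)\<close> is determined by the contractions of its products with
  vectors, which have type \<open>(p, q)\<close>, and a tensor of type \<open>(p + 1, q)\<close> by those of its products with
  covectors (\<open>arr_eq_by_vectors\<close>, \<open>arr_eq_by_covectors\<close>).  Maps that are compatible with products and
  contractions and agree on scalars and vectors therefore agree on covectors, and then on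
  everything (\<open>S_transport_coframe\<close>, \<open>derivation_eq_nabla\<close>).

  The path may meet itself.  A field, and hence \<open>D T\<close>, is a function of the point, whereas \<open>nabla \<Psi> T\<close>
  is a function of the parameter; so all comparisons are made at a parameter.  The fields needed to test
  \<open>D\<close> there are coordinate fields multiplied by bump functions (\<open>local_fields\<close>): they are
  restrictions of fields on the manifold, so that self-intersections do no harm.
\<close>

section \<open>Change of basis for component arrays\<close>

text \<open>
  A change of basis acts on each index of a component array.  Recursion over the list of indices
  replaces the sum over index lists in the transformation law (recovered in \<open>act_list_eq_sum\<close>), which
  makes functoriality and compatibility with concatenation plain inductions.
\<close>

fun act_list :: "real^'n^'n \<Rightarrow> ('n list \<Rightarrow> real) \<Rightarrow> 'n list \<Rightarrow> real" where
  "act_list G f [] = f []"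
| "act_list G f (u # us) = (\<Sum>k\<in>UNIV. G $ u $ k * act_list G (\<lambda>ks. f (k # ks)) us)"

lemma sum_lists_Suc:
  fixes f :: "'n::finite list \<Rightarrow> real"
  shows "(\<Sum>ks | length ks = Suc n. f ks) = (\<Sum>k\<in>UNIV. \<Sum>ks | length ks = n. f (k # ks))"
proof -
  have "(\<Sum>k\<in>UNIV. \<Sum>ks | length ks = n. f (k # ks)) = (\<Sum>(k,ks)\<in>UNIV \<times> {ks. length ks = n}. f (k # ks))"
    using finite_lists_length_eq[of "UNIV :: 'n set" n] by (simp add: sum.cartesian_product)
  also have "\<dots> = (\<Sum>ks | length ks = Suc n. f ks)"
    by (rule sum.reindex_bij_witness[where i = "\<lambda>ks. (hd ks, tl ks)" and j = "\<lambda>(k,ks). k # ks"])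
       (auto simp: length_Suc_conv)
  finally show ?thesis by simp
qed

lemma act_list_eq_sum:
  "act_list G f us = (\<Sum>ks | length ks = length us. (\<Prod>a<length us. G $ (us ! a) $ (ks ! a)) * f ks)"
proof (induction us arbitrary: f)
  case (Cons u us)
  have "(\<Prod>a<Suc (length us). G $ ((u # us) ! a) $ ((k # ks) ! a)) =
      G $ u $ k * (\<Prod>a<length us. G $ (us ! a) $ (ks ! a))" for k ks
    by (subst prod.lessThan_Suc_shift) simp
  then show ?case
    unfolding act_list.simps Cons.IH list.size(4) add_Suc_right add_0_right One_nat_def sum_lists_Suc sum_distrib_left
    by (simp only: mult.assoc)
qed simp

lemma act_list_cong:
  "(\<And>ks. length ks = length us \<Longrightarrow> f ks = g ks) \<Longrightarrow> act_list G f us = act_list G g us"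
proof (induction us arbitrary: f g)
  case (Cons u us)
  have "act_list G (\<lambda>ks. f (k # ks)) us = act_list G (\<lambda>ks. g (k # ks)) us" for k
    by (rule Cons.IH) (simp add: Cons.prems)
  then show ?case by simp
qed simp

lemma act_list_lin: "act_list G (\<lambda>ks. a * f ks + b * g ks) us = a * act_list G f us + b * act_list G g us"
  by (induction us arbitrary: f g) (auto simp: sum_distrib_left sum.distrib algebra_simps)

lemma act_list_cmult: "act_list G (\<lambda>ks. a * f ks) us = a * act_list G f us"
  using act_list_lin[of G a f 0 f] by simp

lemma act_list_multc: "act_list G (\<lambda>ks. f ks * a) us = act_list G f us * a"
  using act_list_cmult[of G a f] by (simp add: mult.commute)

lemma act_list_zero [simp]: "act_list G (\<lambda>ks. 0) us = 0"
  using act_list_cmult[of G 0 "\<lambda>_. 0"] by simp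

lemma act_list_sum: "act_list G (\<lambda>ks. \<Sum>i\<in>I. f i ks) us = (\<Sum>i\<in>I. act_list G (f i) us)"
proof (cases "finite I")
  case True
  then show ?thesis
    by induction (use act_list_lin[of G 1 _ 1] in auto)
qed simp

lemma act_list_act_list: "act_list G (act_list G' f) us = act_list (G ** G') f us"
proof (induction us arbitrary: f)
  case (Cons u us)
  show ?case
    by (simp add: act_list_sum act_list_cmult Cons.IH matrix_matrix_mult_def sum_distrib_left sum_distrib_right mult.assoc)
       (rule sum.swap)
qed simp

lemma act_list_id [simp]: "act_list (mat 1) f us = f us"
  by (induction us arbitrary: f) (auto simp: mat_def if_distrib[of "\<lambda>x. x * _"] cong: if_cong)

lemma act_list_swap: "act_list G (\<lambda>ks. act_list H (\<lambda>ms. A ks ms) ls) us = act_list H (\<lambda>ms. act_list G (\<lambda>ks. A ks ms) us) ls"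
  by (induction us arbitrary: A) (auto simp: act_list_sum act_list_cmult)

lemma act_list_append: "act_list G f (us @ vs) = act_list G (\<lambda>ks. act_list G (\<lambda>ms. f (ks @ ms)) vs) us"
  by (induction us arbitrary: f) auto

lemma act_list_take_drop:
  "act_list G f us = act_list G (\<lambda>ks. act_list G (\<lambda>ms. f (ks @ ms)) (drop p us)) (take p us)"
  using act_list_append[of G f "take p us" "drop p us"] by simp

type_synonym 'n arr = "'n list \<Rightarrow> 'n list \<Rightarrow> real"

text \<open>
  \<open>G\<close> acts on the upper indices and \<open>K\<close>, which is meant to be the inverse of \<open>G\<close>, on the lower ones.
  The type \<open>(p, q)\<close> is not a parameter: it is read off from the lengths of the index lists.
\<close>

definition act :: "real^'n^'n \<Rightarrow> real^'n^'n \<Rightarrow> 'n::finite arr \<Rightarrow> 'n arr" where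
  "act G K A = (\<lambda>us ls. act_list G (\<lambda>ks. act_list (transpose K) (\<lambda>ms. A ks ms) ls) us)"

definition has_type :: "nat \<Rightarrow> nat \<Rightarrow> 'n arr \<Rightarrow> bool" where
  "has_type p q A \<longleftrightarrow> (\<forall>us ls. A us ls \<noteq> 0 \<longrightarrow> length us = p \<and> length ls = q)"

definition arr_prod :: "nat \<Rightarrow> nat \<Rightarrow> 'n arr \<Rightarrow> 'n arr \<Rightarrow> 'n arr" where
  "arr_prod p q A B = (\<lambda>us ls. A (take p us) (take q ls) * B (drop p us) (drop q ls))"

definition arr_contr :: "nat \<Rightarrow> nat \<Rightarrow> 'n::finite arr \<Rightarrow> 'n arr" where
  "arr_contr k l A = (\<lambda>us ls. \<Sum>i\<in>UNIV. A (take k us @ i # drop k us) (take l ls @ i # drop l ls))"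

lemma act_eq_sum:
  "act G K A us ls =
     (\<Sum>ks | length ks = length us. \<Sum>ms | length ms = length ls.
        (\<Prod>a<length us. G $ (us ! a) $ (ks ! a)) * (\<Prod>b<length ls. K $ (ms ! b) $ (ls ! b)) * A ks ms)"
  by (simp add: act_def act_list_eq_sum transpose_def sum_distrib_left mult.assoc)

lemma act_act: "act G K (act G' K' A) = act (G ** G') (K' ** K) A"
proof (intro ext)
  fix us ls
  have "act G K (act G' K' A) us ls =
      act_list G (\<lambda>ks. act_list (transpose K) (\<lambda>ms. act_list G' (\<lambda>ks. act_list (transpose K') (A ks) ms) ks) ls) us"
    by (simp add: act_def)
  also have "\<dots> = act_list G (\<lambda>ks. act_list G' (\<lambda>ks. act_list (transpose K) (\<lambda>ms. act_list (transpose K') (A ks) ms) ls) ks) us"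
    by (subst act_list_swap) simp
  also have "\<dots> = act (G ** G') (K' ** K) A us ls"
    by (simp add: act_list_act_list act_def matrix_transpose_mul)
  finally show "act G K (act G' K' A) us ls = act (G ** G') (K' ** K) A us ls" .
qed

lemma act_id [simp]: "act (mat 1) (mat 1) A = A"
  by (simp add: act_def transpose_mat)

lemma act_lin: "act G K (\<lambda>us ls. a * A us ls + b * B us ls) = (\<lambda>us ls. a * act G K A us ls + b * act G K B us ls)"
  by (simp add: act_def act_list_lin)

lemma act_zero [simp]: "act G K (\<lambda>us ls. 0) = (\<lambda>us ls. 0)"
  by (simp add: act_def)

lemma has_type_act: "has_type p q A \<Longrightarrow> has_type p q (act G K A)"
proof -
  assume A: "has_type p q A"
  have "act G K A us ls = 0" if "length us \<noteq> p \<or> length ls \<noteq> q" for us ls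
    unfolding act_eq_sum using A that by (intro sum.neutral ballI) (auto simp: has_type_def)
  then show ?thesis by (auto simp: has_type_def)
qed

definition act_split :: "real^'n^'n \<Rightarrow> real^'n^'n \<Rightarrow> nat \<Rightarrow> nat \<Rightarrow>
    ('n::finite list \<Rightarrow> 'n list \<Rightarrow> 'n list \<Rightarrow> 'n list \<Rightarrow> real) \<Rightarrow> 'n arr" where
  "act_split G K p q F us ls =
     act_list G (\<lambda>ks. act_list G (\<lambda>ks'.
       act_list (transpose K) (\<lambda>ms. act_list (transpose K) (\<lambda>ms'. F ks ks' ms ms') (drop q ls)) (take q ls))
       (drop p us)) (take p us)"

text \<open>
  Products and contractions are defined by cutting the index lists at given positions.  The action can be
  cut at the same positions, and then acts separately on the four pieces.
\<close>

lemma act_eq_act_split: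
  assumes F: "\<And>ks ks' ms ms'. take p (ks @ ks') = ks \<Longrightarrow> drop p (ks @ ks') = ks' \<Longrightarrow>
    take q (ms @ ms') = ms \<Longrightarrow> drop q (ms @ ms') = ms' \<Longrightarrow> A (ks @ ks') (ms @ ms') = F ks ks' ms ms'"
  shows "act G K A us ls = act_split G K p q F us ls"
proof -
  have cut: "take n (xs @ ys) = xs" "drop n (xs @ ys) = ys"
    if "length xs = length (take n zs)" "length ys = length (drop n zs)" for n and xs ys zs :: "'a list"
    using that by (cases "n \<le> length zs"; auto)+
  have "act G K A us ls = act_split G K p q (\<lambda>ks ks' ms ms'. A (ks @ ks') (ms @ ms')) us ls"
    unfolding act_def act_split_def
    by (simp only: act_list_take_drop[of G _ us p] act_list_take_drop[of "transpose K" _ ls q])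
  also have "\<dots> = act_split G K p q F us ls"
    unfolding act_split_def by (intro act_list_cong F cut; assumption)
  finally show ?thesis .
qed

lemma act_arr_prod: "act G K (arr_prod p q A B) = arr_prod p q (act G K A) (act G K B)"
proof (intro ext)
  fix us ls
  have "act G K (arr_prod p q A B) us ls = act_split G K p q (\<lambda>ks ks' ms ms'. A ks ms * B ks' ms') us ls"
    by (rule act_eq_act_split) (simp add: arr_prod_def)
  also have "\<dots> = arr_prod p q (act G K A) (act G K B) us ls"
    by (simp add: act_split_def act_list_cmult act_list_multc arr_prod_def act_def)
  finally show "act G K (arr_prod p q A B) us ls = arr_prod p q (act G K A) (act G K B) us ls" .
qed

text \<open>
  The two contracted indices contribute the factor \<open>\<Sum>\<^sub>i G\<^sub>i\<^sub>j K\<^sub>m\<^sub>i\<close>, an entry of \<open>K ** G\<close>; this is where the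
  lower indices have to transform by the inverse of the matrix for the upper ones.
\<close>

lemma act_arr_contr:
  assumes "K ** G = mat 1"
  shows "act G K (arr_contr k l A) = arr_contr k l (act G K A)"
proof (intro ext)
  fix us ls
  let ?t = "transpose K"
  define X where "X j m = act_split G K k l (\<lambda>ks ks' ms ms'. A (ks @ j # ks') (ms @ m # ms')) us ls" for j m
  have "act G K (arr_contr k l A) us ls =
      act_split G K k l (\<lambda>ks ks' ms ms'. \<Sum>i\<in>UNIV. A (ks @ i # ks') (ms @ i # ms')) us ls"
    by (rule act_eq_act_split) (simp add: arr_contr_def)
  also have "\<dots> = (\<Sum>i\<in>UNIV. X i i)"
    by (simp add: act_list_sum X_def act_split_def)
  also have "\<dots> = (\<Sum>m\<in>UNIV. \<Sum>j\<in>UNIV. (K ** G) $ m $ j * X j m)"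
    by (simp add: assms mat_def if_distrib[of "\<lambda>x. x * _"] cong: if_cong)
  also have "\<dots> = (\<Sum>m\<in>UNIV. \<Sum>j\<in>UNIV. \<Sum>i\<in>UNIV. ?t $ i $ m * (G $ i $ j * X j m))"
    by (simp add: matrix_matrix_mult_def transpose_def sum_distrib_right sum_distrib_left mult_ac)
  also have "\<dots> = (\<Sum>m\<in>UNIV. \<Sum>i\<in>UNIV. \<Sum>j\<in>UNIV. ?t $ i $ m * (G $ i $ j * X j m))"
    by (intro sum.cong refl sum.swap)
  also have "\<dots> = (\<Sum>i\<in>UNIV. \<Sum>m\<in>UNIV. \<Sum>j\<in>UNIV. ?t $ i $ m * (G $ i $ j * X j m))"
    by (rule sum.swap)
  also have "\<dots> = arr_contr k l (act G K A) us ls"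
    unfolding arr_contr_def act_def X_def act_split_def
    by (simp add: act_list_append act_list_sum act_list_cmult sum_distrib_left)
  finally show "act G K (arr_contr k l A) us ls = arr_contr k l (act G K A) us ls" .
qed

lemma has_type_arr_prod: "has_type p q A \<Longrightarrow> has_type p' q' B \<Longrightarrow> has_type (p + p') (q + q') (arr_prod p q A B)"
  unfolding has_type_def arr_prod_def
proof (intro allI impI)
  fix us ls :: "'a list"
  assume A: "\<forall>us ls. A us ls \<noteq> 0 \<longrightarrow> length us = p \<and> length ls = q"
    and B: "\<forall>us ls. B us ls \<noteq> 0 \<longrightarrow> length us = p' \<and> length ls = q'"
    and n: "A (take p us) (take q ls) * B (drop p us) (drop q ls) \<noteq> 0"
  have "length (take p us) = p" "length (take q ls) = q" "length (drop p us) = p'" "length (drop q ls) = q'"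
    using A B n by (metis mult_eq_0_iff)+
  then show "length us = p + p' \<and> length ls = q + q'" by (auto simp: min_def split: if_splits)
qed

lemma has_type_arr_contr:
  assumes A: "has_type (Suc p) (Suc q) A" and "k \<le> p" "l \<le> q"
  shows "has_type p q (arr_contr k l A)"
proof -
  have "arr_contr k l A us ls = 0" if "\<not> (length us = p \<and> length ls = q)" for us ls
    unfolding arr_contr_def
  proof (rule sum.neutral, rule ballI)
    fix i
    have len: "length (take k us @ i # drop k us) = Suc (length us)" for us :: "'a list" and k
      by (simp add: min_def)
    show "A (take k us @ i # drop k us) (take l ls @ i # drop l ls) = 0"
      using A that len[of k us] len[of l ls] unfolding has_type_def by (metis nat.inject)
  qed
  then show ?thesis by (auto simp: has_type_def)
qed

lemma has_type_lin: "has_type p q A \<Longrightarrow> has_type p q B \<Longrightarrow> has_type p q (\<lambda>us ls. a * A us ls + b * B us ls)"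
  unfolding has_type_def by (metis add.right_neutral mult_zero_right)

definition vec_arr :: "real^'n \<Rightarrow> 'n arr" where
  "vec_arr v = (\<lambda>us ls. if length us = 1 \<and> ls = [] then v $ hd us else 0)"

definition covec_arr :: "real^'n \<Rightarrow> 'n arr" where
  "covec_arr w = (\<lambda>us ls. if us = [] \<and> length ls = 1 then w $ hd ls else 0)"

definition pairing :: "'n::finite arr \<Rightarrow> 'n arr \<Rightarrow> real" where
  "pairing A B = (\<Sum>i\<in>UNIV. A [i] [] * B [] [i])"

definition arr_vec :: "'n::finite arr \<Rightarrow> real^'n" where
  "arr_vec A = (\<chi> i. A [i] [])"

lemma has_type_vec_arr: "has_type 1 0 (vec_arr v)" by (auto simp: has_type_def vec_arr_def)
lemma has_type_covec_arr: "has_type 0 1 (covec_arr v)" by (auto simp: has_type_def covec_arr_def)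

lemma arr_vec_vec_arr [simp]: "arr_vec (vec_arr v) = v" by (simp add: arr_vec_def vec_arr_def)

lemma vec_arr_arr_vec: "has_type 1 0 A \<Longrightarrow> vec_arr (arr_vec A) = A"
  by (rule ext, rule ext) (auto simp: arr_vec_def vec_arr_def has_type_def length_Suc_conv)

lemma arr_vec_act: "arr_vec (act G K A) = G *v arr_vec A"
  by (simp add: vec_eq_iff arr_vec_def act_def matrix_vector_mult_def)

lemma act_vec_arr: "act G K (vec_arr v) = vec_arr (G *v v)"
  using vec_arr_arr_vec[OF has_type_act[OF has_type_vec_arr]] by (metis arr_vec_act arr_vec_vec_arr)

lemma act_scalar: "has_type 0 0 A \<Longrightarrow> act G K A = A"
proof (rule ext, rule ext)
  fix us ls assume A: "has_type 0 0 A"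
  then have B: "has_type 0 0 (act G K A)" by (rule has_type_act)
  show "act G K A us ls = A us ls"
  proof (cases "us = [] \<and> ls = []")
    case True
    then show ?thesis by (simp add: act_def)
  next
    case False
    then show ?thesis using A B by (metis length_0_conv has_type_def)
  qed
qed

lemma sum_axis: "(\<Sum>i\<in>UNIV. f i * axis j (1::real) $ i) = f j" for f :: "'n::finite \<Rightarrow> real"
  by (simp add: axis_def if_distrib cong: if_cong)

lemma pairing_axis:
  "pairing A (covec_arr (axis j 1)) = A [j] []" "pairing (vec_arr (axis i 1)) B = B [] [i]"
  using sum_axis[of "\<lambda>k. A [k] []" j] sum_axis[of "\<lambda>k. B [] [k]" i]
  by (simp_all add: pairing_def vec_arr_def covec_arr_def mult.commute)

lemma arr_contr_arr_prod_vec_arr: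
  assumes "length us = p" "length ls = q"
  shows "arr_contr p q (arr_prod p (Suc q) A (vec_arr v)) us ls = (\<Sum>i\<in>UNIV. A us (ls @ [i]) * v $ i)"
  using assms by (simp add: arr_contr_def arr_prod_def vec_arr_def)

lemma arr_contr_arr_prod_covec_arr:
  assumes "length us = p" "length ls = q"
  shows "arr_contr p q (arr_prod (Suc p) q A (covec_arr v)) us ls = (\<Sum>i\<in>UNIV. A (us @ [i]) ls * v $ i)"
  using assms by (simp add: arr_contr_def arr_prod_def covec_arr_def)

text \<open>
  Contracting the last lower index with the \<open>j\<close>-th standard vector sets this index to \<open>j\<close>.  This is the
  step that carries an identity from type \<open>(p, q)\<close> to type \<open>(p, q + 1)\<close>; \<open>arr_eq_by_covectors\<close>
  does the same for upper indices.
\<close>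

lemma arr_eq_by_vectors:
  assumes A: "has_type p (Suc q) A" and B: "has_type p (Suc q) B"
    and eq: "\<And>j. arr_contr p q (arr_prod p (Suc q) A (vec_arr (axis j 1))) = arr_contr p q (arr_prod p (Suc q) B (vec_arr (axis j 1)))"
  shows "A = B"
proof (rule ext, rule ext)
  fix us ls
  show "A us ls = B us ls"
  proof (cases "length us = p \<and> length ls = Suc q")
    case True
    then obtain ms j where ls: "ls = ms @ [j]" "length ms = q" by (metis length_Suc_conv_rev)
    show ?thesis
      using fun_cong[OF fun_cong[OF eq[of j], of us], of ms] True ls
      by (simp add: arr_contr_arr_prod_vec_arr sum_axis)
  next
    case False
    then show ?thesis using A B by (metis has_type_def)
  qed
qed

lemma arr_eq_by_covectors:
  assumes A: "has_type (Suc p) q A" and B: "has_type (Suc p) q B"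
    and eq: "\<And>j. arr_contr p q (arr_prod (Suc p) q A (covec_arr (axis j 1))) = arr_contr p q (arr_prod (Suc p) q B (covec_arr (axis j 1)))"
  shows "A = B"
proof (rule ext, rule ext)
  fix us ls
  show "A us ls = B us ls"
  proof (cases "length us = Suc p \<and> length ls = q")
    case True
    then obtain ms j where ls: "us = ms @ [j]" "length ms = p" by (metis length_Suc_conv_rev)
    show ?thesis
      using fun_cong[OF fun_cong[OF eq[of j], of ms], of ls] True ls
      by (simp add: arr_contr_arr_prod_covec_arr sum_axis)
  next
    case False
    then show ?thesis using A B by (metis has_type_def)
  qed
qed

lemma act_sum:
  "act G K (\<lambda>us ls. \<Sum>i\<in>I. a i * B i us ls) = (\<lambda>us ls. \<Sum>i\<in>I. a i * act G K (B i) us ls)"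
  by (simp add: act_def act_list_sum act_list_cmult)

lemma vec_arr_sum_axis: "vec_arr a = (\<lambda>us ls. \<Sum>i\<in>UNIV. a $ i * vec_arr (axis i 1) us ls)"
proof (intro ext)
  fix us ls
  have "(\<Sum>i\<in>UNIV. a $ i * axis i 1 $ hd us) = a $ hd us"
    by (simp add: axis_def if_distrib[of "\<lambda>x. _ * x"] cong: if_cong)
  then show "vec_arr a us ls = (\<Sum>i\<in>UNIV. a $ i * vec_arr (axis i 1) us ls)"
    by (cases "length us = 1 \<and> ls = []") (auto simp: vec_arr_def)
qed

lemma matrix_eq_columns:
  fixes A B :: "real^'n^'n"
  assumes "\<And>j. A *v axis j 1 = B *v axis j 1"
  shows "A = B"
proof -
  have "A $ i $ j = B $ i $ j" for i j
    using assms[of j] by (simp add: vec_eq_iff matrix_vector_mult_def sum_axis)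
  then show ?thesis by (simp add: vec_eq_iff)
qed

definition scalar_arr :: "real \<Rightarrow> 'n arr" where
  "scalar_arr r = (\<lambda>us ls. if us = [] \<and> ls = [] then r else 0)"

lemma has_type_scalar_arr: "has_type 0 0 (scalar_arr r)" by (auto simp: has_type_def scalar_arr_def)

lemma scalar_arr_eq: "has_type 0 0 A \<Longrightarrow> scalar_arr (A [] []) = A"
  by (intro ext) (auto simp: has_type_def scalar_arr_def)

section \<open>Differentiable curves of vectors and matrices\<close>

lemma vec_eq_sum_axis: "v = (\<Sum>i\<in>UNIV. axis i (v $ i))"
  by (simp add: vec_eq_iff axis_def if_distrib cong: if_cong)

lemma bounded_linear_axis: "bounded_linear (axis i :: 'b::euclidean_space \<Rightarrow> 'b^'n)"
  by (subst linear_conv_bounded_linear[symmetric]) (auto simp: linear_iff vec_eq_iff axis_def)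

lemma has_vector_derivative_vecI:
  fixes f :: "real \<Rightarrow> 'b::euclidean_space^'n"
  assumes "\<And>i. ((\<lambda>s. f s $ i) has_vector_derivative f' $ i) F"
  shows "(f has_vector_derivative f') F"
proof -
  have "((\<lambda>s. \<Sum>i\<in>UNIV. axis i (f s $ i)) has_vector_derivative (\<Sum>i\<in>UNIV. axis i (f' $ i))) F"
    by (intro has_vector_derivative_sum bounded_linear.has_vector_derivative[OF bounded_linear_axis] assms)
  then show ?thesis by (simp flip: vec_eq_sum_axis)
qed

lemma has_vector_derivative_columnsI:
  fixes M :: "real \<Rightarrow> real^'n^'n"
  assumes "\<And>j. ((\<lambda>t. M t *v axis j 1) has_vector_derivative M' *v axis j 1) F"
  shows "(M has_vector_derivative M') F"
proof (intro has_vector_derivative_vecI)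
  fix i j
  have "((\<lambda>t. (M t *v axis j 1) $ i) has_vector_derivative (M' *v axis j 1) $ i) F"
    by (rule bounded_linear.has_vector_derivative[OF bounded_linear_vec_nth assms])
  then show "((\<lambda>t. M t $ i $ j) has_vector_derivative M' $ i $ j) F"
    by (simp add: matrix_vector_mult_def sum_axis)
qed

lemma bounded_bilinear_matrix_mult: "bounded_bilinear ((**) :: real^'n^'m \<Rightarrow> real^'p^'n \<Rightarrow> _)"
  by (subst bilinear_conv_bounded_bilinear[symmetric])
     (auto simp: bilinear_def linear_iff vec_eq_iff matrix_matrix_mult_def algebra_simps sum.distrib sum_distrib_left)

lemma bounded_bilinear_matrix_vector_mult: "bounded_bilinear ((*v) :: real^'n^'m \<Rightarrow> real^'n \<Rightarrow> _)"
  by (subst bilinear_conv_bounded_bilinear[symmetric])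
     (auto simp: bilinear_def linear_iff vec_eq_iff matrix_vector_mult_def algebra_simps sum.distrib sum_distrib_left)

lemma matrix_inv_works:
  fixes A :: "real^'n^'n"
  assumes "invertible A"
  shows "A ** matrix_inv A = mat 1" "matrix_inv A ** A = mat 1"
  using someI_ex[OF assms[unfolded invertible_def]] by (auto simp: matrix_inv_def)

lemma matrix_inv_unique:
  fixes A :: "real^'n^'n"
  assumes "A ** B = mat 1"
  shows "invertible A" "matrix_inv A = B"
proof -
  have BA: "B ** A = mat 1" using assms matrix_left_right_inverse by blast
  then show i: "invertible A" using assms by (auto simp: invertible_def)
  show "matrix_inv A = B"
    by (metis BA matrix_inv_works(1)[OF i] matrix_mul_assoc matrix_mul_lid matrix_mul_rid)
qed

lemma invertible_matrix_inv: "invertible A \<Longrightarrow> invertible (matrix_inv A)" for A :: "real^'n^'n"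
  using matrix_inv_unique(1) matrix_inv_works(2) by blast

lemma matrix_inv_mult:
  fixes A B :: "real^'n^'n"
  assumes "invertible A" "invertible B"
  shows "matrix_inv (A ** B) = matrix_inv B ** matrix_inv A"
proof (rule matrix_inv_unique)
  have "A ** B ** (matrix_inv B ** matrix_inv A) = A ** (B ** matrix_inv B) ** matrix_inv A"
    by (simp add: matrix_mul_assoc)
  then show "A ** B ** (matrix_inv B ** matrix_inv A) = mat 1"
    using assms by (simp add: matrix_inv_works)
qed

lemma matrix_inv_cramer:
  fixes A :: "real^'n^'n"
  assumes "invertible A"
  shows "matrix_inv A $ k $ j = det (\<chi> i l. if l = k then axis j 1 $ i else A $ i $ l) / det A"
proof -
  have "A *v (matrix_inv A *v axis j 1) = axis j 1"
    using assms by (simp add: matrix_vector_mul_assoc matrix_inv_works)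
  then have "matrix_inv A *v axis j 1 = (\<chi> k. det (\<chi> i l. if l = k then axis j 1 $ i else A $ i $ l) / det A)"
    using cramer[of A] assms by (simp add: invertible_det_nz)
  moreover have "(matrix_inv A *v axis j 1) $ k = matrix_inv A $ k $ j"
    by (simp add: matrix_vector_mult_def sum_axis)
  ultimately show ?thesis by simp
qed

lemma differentiable_prod:
  fixes f :: "'i \<Rightarrow> real \<Rightarrow> real"
  assumes "\<And>i. i \<in> I \<Longrightarrow> f i differentiable (at s within S)"
  shows "(\<lambda>t. \<Prod>i\<in>I. f i t) differentiable (at s within S)"
  using assms by (induction I rule: infinite_finite_induct) (auto intro: derivative_intros)

text \<open>
  Cramer's rule writes the entries of the inverse matrix as quotients of determinants, that is, of
  polynomials in the entries.  This gives differentiability of the inverse; the value of its derivative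
  then follows by differentiating \<open>M M\<^sup>-\<^sup>1 = 1\<close>.
\<close>

lemma differentiable_det:
  fixes M :: "real \<Rightarrow> real^'n^'n"
  assumes "\<And>i j. (\<lambda>t. M t $ i $ j) differentiable (at s within S)"
  shows "(\<lambda>t. det (M t)) differentiable (at s within S)"
  unfolding det_def
  by (intro differentiable_sum ballI differentiable_mult differentiable_const differentiable_prod assms)
     (simp add: finite_permutations)

lemma has_vector_derivative_entry:
  fixes M :: "real \<Rightarrow> real^'n^'m"
  assumes "(M has_vector_derivative M') F"
  shows "((\<lambda>t. M t $ i $ j) has_vector_derivative M' $ i $ j) F"
  by (intro bounded_linear.has_vector_derivative[OF bounded_linear_vec_nth] assms)

lemma has_vector_derivative_imp_differentiable:
  "(f has_vector_derivative f') F \<Longrightarrow> f differentiable F"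
  by (auto simp: has_vector_derivative_def differentiable_def)

lemma has_vector_derivative_matrix_inv:
  fixes M :: "real \<Rightarrow> real^'n^'n"
  assumes M: "(M has_vector_derivative M') (at s within S)" and s: "s \<in> S"
    and inv: "\<And>t. t \<in> S \<Longrightarrow> invertible (M t)"
  shows "((\<lambda>t. matrix_inv (M t)) has_vector_derivative - (matrix_inv (M s) ** M' ** matrix_inv (M s))) (at s within S)"
proof (cases "at s within S = bot")
  case True
  then show ?thesis
    unfolding has_vector_derivative_def has_derivative_def by (intro conjI bounded_linear_scaleR_left) simp
next
  case False
  have ent: "(\<lambda>t. M t $ i $ j) differentiable (at s within S)" for i j
    using has_vector_derivative_imp_differentiable[OF has_vector_derivative_entry[OF M]] .
  have "(\<lambda>t. matrix_inv (M t) $ k $ j) differentiable (at s within S)" for k j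
  proof -
    have "(\<lambda>t. det (\<chi> i l. if l = k then axis j 1 $ i else M t $ i $ l) / det (M t)) differentiable (at s within S)"
    proof (intro differentiable_divide differentiable_det ent)
      fix i l
      show "(\<lambda>t. (\<chi> i l. if l = k then axis j 1 $ i else M t $ i $ l) $ i $ l) differentiable (at s within S)"
        using ent by (cases "l = k") auto
      show "det (M s) \<noteq> 0" using inv[OF s] by (simp add: invertible_det_nz)
    qed
    then show ?thesis
      by (rule differentiable_transform_within[where d = 1]) (use s in \<open>simp_all add: matrix_inv_cramer inv\<close>)
  qed
  then have "\<exists>d. ((\<lambda>t. matrix_inv (M t) $ k $ j) has_vector_derivative d) (at s within S)" for k j
    using vector_derivative_works by blast
  then obtain d where d: "((\<lambda>t. matrix_inv (M t) $ k $ j) has_vector_derivative d k j) (at s within S)" for k j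
    by metis
  define N' where "N' = (\<chi> k j. d k j)"
  have N: "((\<lambda>t. matrix_inv (M t)) has_vector_derivative N') (at s within S)"
    by (intro has_vector_derivative_vecI) (simp add: N'_def d)
  let ?N = "matrix_inv (M s)"
  have "((\<lambda>t. M t ** matrix_inv (M t)) has_vector_derivative M s ** N' + M' ** ?N) (at s within S)"
    by (rule bounded_bilinear.has_vector_derivative[OF bounded_bilinear_matrix_mult M N])
  moreover have "((\<lambda>t. M t ** matrix_inv (M t)) has_vector_derivative 0) (at s within S)"
    by (rule has_vector_derivative_transform[OF s _ has_vector_derivative_const[of "mat 1"]])
       (use inv matrix_inv_works in auto)
  ultimately have "M s ** N' + M' ** ?N = 0"
    using vector_derivative_unique_within[OF False] by blast
  then have "M s ** N' = - (M' ** ?N)"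
    by (simp add: eq_neg_iff_add_eq_0)
  then have "?N ** (M s ** N') = ?N ** (- (M' ** ?N))"
    by simp
  moreover have "?N ** (M s ** N') = N'"
    by (simp add: matrix_mul_assoc matrix_inv_works inv s)
  moreover have "?N ** (- (M' ** ?N)) = - (?N ** M' ** ?N)"
    by (simp add: matrix_mul_assoc bounded_bilinear.minus_right[OF bounded_bilinear_matrix_mult])
  ultimately show ?thesis using N by simp
qed

subsection \<open>Curves of class C1\<close>

lemma C1_onI:
  "(\<And>s. s \<in> I \<Longrightarrow> (f has_vector_derivative f' s) (at s within I)) \<Longrightarrow> continuous_on I f' \<Longrightarrow> C1_on I f"
  unfolding C1_on_def by blast

lemma C1_on_const [simp]: "C1_on I (\<lambda>s. c)"
  unfolding C1_on_def by (rule exI[of _ "\<lambda>s. 0"]) auto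

lemma C1_on_imp_continuous: "C1_on I f \<Longrightarrow> continuous_on I f"
  unfolding C1_on_def
  by (metis continuous_on_eq_continuous_within has_vector_derivative_continuous)

lemma C1_on_linear:
  assumes "bounded_linear h" "C1_on I f"
  shows "C1_on I (\<lambda>s. h (f s))"
proof -
  obtain f' where f: "\<And>s. s \<in> I \<Longrightarrow> (f has_vector_derivative f' s) (at s within I)" "continuous_on I f'"
    using assms(2) by (auto simp: C1_on_def)
  show ?thesis
    unfolding C1_on_def
    by (rule exI[of _ "\<lambda>s. h (f' s)"])
       (auto intro: bounded_linear.has_vector_derivative[OF assms(1)] f bounded_linear.continuous_on[OF assms(1)])
qed

lemma C1_on_bilinear:
  assumes "bounded_bilinear h" "C1_on I f" "C1_on I g"
  shows "C1_on I (\<lambda>s. h (f s) (g s))"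
proof -
  obtain f' where f: "\<And>s. s \<in> I \<Longrightarrow> (f has_vector_derivative f' s) (at s within I)" "continuous_on I f'"
    using assms(2) by (auto simp: C1_on_def)
  obtain g' where g: "\<And>s. s \<in> I \<Longrightarrow> (g has_vector_derivative g' s) (at s within I)" "continuous_on I g'"
    using assms(3) by (auto simp: C1_on_def)
  have c: "continuous_on I f" "continuous_on I g"
    using assms(2,3) by (auto intro: C1_on_imp_continuous)
  show ?thesis
    by (rule C1_onI[of _ _ "\<lambda>s. h (f s) (g' s) + h (f' s) (g s)"])
       (intro bounded_bilinear.has_vector_derivative[OF assms(1)] f g c continuous_on_add
          bounded_bilinear.continuous_on[OF assms(1)] | assumption)+
qed

lemmas C1_on_mult = C1_on_bilinear[OF bounded_bilinear_mult]
lemmas C1_on_matrix_mult = C1_on_bilinear[OF bounded_bilinear_matrix_mult]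

lemma C1_on_add:
  assumes "C1_on I f" "C1_on I g"
  shows "C1_on I (\<lambda>s. f s + g s)"
proof -
  obtain f' where f: "\<And>s. s \<in> I \<Longrightarrow> (f has_vector_derivative f' s) (at s within I)" "continuous_on I f'"
    using assms(1) by (auto simp: C1_on_def)
  obtain g' where g: "\<And>s. s \<in> I \<Longrightarrow> (g has_vector_derivative g' s) (at s within I)" "continuous_on I g'"
    using assms(2) by (auto simp: C1_on_def)
  show ?thesis
    unfolding C1_on_def
    by (rule exI[of _ "\<lambda>s. f' s + g' s"]) (auto intro!: derivative_intros f g continuous_intros)
qed

lemma C1_on_sum: "(\<And>i. i \<in> A \<Longrightarrow> C1_on I (f i)) \<Longrightarrow> C1_on I (\<lambda>s. \<Sum>i\<in>A. f i s)"
  by (induction A rule: infinite_finite_induct) (auto intro: C1_on_add)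

lemma C1_on_cong:
  assumes "\<And>s. s \<in> I \<Longrightarrow> f s = g s"
  shows "C1_on I f \<longleftrightarrow> C1_on I g"
proof -
  have "(f has_vector_derivative d) (at s within I) \<longleftrightarrow> (g has_vector_derivative d) (at s within I)"
    if "s \<in> I" for s d
    by (rule iffI; rule has_vector_derivative_transform[OF that]) (use assms in auto)
  then show ?thesis unfolding C1_on_def by simp
qed

lemma C1_on_subset: "C1_on I f \<Longrightarrow> K \<subseteq> I \<Longrightarrow> C1_on K f"
  unfolding C1_on_def
  by (meson continuous_on_subset has_vector_derivative_within_subset subsetD)

lemma C1_on_vecI:
  fixes f :: "real \<Rightarrow> 'b::euclidean_space^'n"
  assumes "\<And>i. C1_on I (\<lambda>s. f s $ i)"
  shows "C1_on I f"
proof -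
  have "C1_on I (\<lambda>s. \<Sum>i\<in>UNIV. axis i (f s $ i))"
    by (intro C1_on_sum C1_on_linear[OF bounded_linear_axis] assms)
  then show ?thesis by (simp flip: vec_eq_sum_axis)
qed

lemma C1_on_nth: "C1_on I f \<Longrightarrow> C1_on I (\<lambda>s. f s $ i)"
  by (rule C1_on_linear[OF bounded_linear_vec_nth])

lemma C1_on_matrix_inv:
  fixes M :: "real \<Rightarrow> real^'n^'n"
  assumes "C1_on I M" "\<And>s. s \<in> I \<Longrightarrow> invertible (M s)"
  shows "C1_on I (\<lambda>s. matrix_inv (M s))"
proof -
  obtain M' where M: "\<And>s. s \<in> I \<Longrightarrow> (M has_vector_derivative M' s) (at s within I)" "continuous_on I M'"
    using assms(1) by (auto simp: C1_on_def)
  have d: "((\<lambda>t. matrix_inv (M t)) has_vector_derivative - (matrix_inv (M s) ** M' s ** matrix_inv (M s))) (at s within I)"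
    if "s \<in> I" for s
    by (rule has_vector_derivative_matrix_inv) (use M that assms in auto)
  then have "continuous_on I (\<lambda>s. matrix_inv (M s))"
    by (metis continuous_on_eq_continuous_within has_vector_derivative_continuous)
  then have "continuous_on I (\<lambda>s. - (matrix_inv (M s) ** M' s ** matrix_inv (M s)))"
    by (intro continuous_on_minus bounded_bilinear.continuous_on[OF bounded_bilinear_matrix_mult] M)
  from C1_onI[OF d this] show ?thesis .
qed

lemma C1_on_chain:
  fixes f :: "real \<Rightarrow> real"
  assumes "C1_on I f" "C1_on UNIV g"
  shows "C1_on I (\<lambda>s. g (f s))"
proof -
  obtain f' where f: "\<And>s. s \<in> I \<Longrightarrow> (f has_vector_derivative f' s) (at s within I)" "continuous_on I f'"
    using assms(1) by (auto simp: C1_on_def)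
  obtain g' where g: "\<And>s. (g has_vector_derivative g' s) (at s)" "continuous_on UNIV g'"
    using assms(2) by (auto simp: C1_on_def)
  have "continuous_on I (\<lambda>s. f' s *\<^sub>R g' (f s))"
    by (intro continuous_intros f continuous_on_compose2[OF g(2)] C1_on_imp_continuous[OF assms(1)]) auto
  moreover have "((\<lambda>s. g (f s)) has_vector_derivative f' s *\<^sub>R g' (f s)) (at s within I)" if "s \<in> I" for s
    using vector_diff_chain_within[OF f(1)[OF that] has_vector_derivative_at_within[OF g(1)]]
    by (simp add: o_def)
  ultimately show ?thesis by (intro C1_onI)
qed

lemma at_within_Int_open:
  "open N \<Longrightarrow> s \<in> N \<Longrightarrow> at s within (I \<inter> N) = at s within I"
  by (rule at_within_nhd[of _ N]) auto

text \<open>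
  A curve that is C1 near each parameter is C1.  Derivatives within a set are unique only at its limit
  points; without the first assumption the derivatives on overlapping pieces need not fit together.
\<close>

lemma C1_on_local:
  fixes f :: "real \<Rightarrow> 'b::real_normed_vector"
  assumes perf: "\<And>s. s \<in> I \<Longrightarrow> s islimpt I"
    and loc: "\<And>s. s \<in> I \<Longrightarrow> \<exists>N. open N \<and> s \<in> N \<and> C1_on (I \<inter> N) f"
  shows "C1_on I f"
proof -
  let ?f' = "\<lambda>s. vector_derivative f (at s within I)"
  have *: "(f has_vector_derivative ?f' s) (at s within I) \<and> continuous (at s within I) ?f'" if s: "s \<in> I" for s
  proof -
    obtain N g where N: "open N" "s \<in> N"
      and g: "\<And>s. s \<in> I \<inter> N \<Longrightarrow> (f has_vector_derivative g s) (at s within I \<inter> N)" "continuous_on (I \<inter> N) g"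
      using loc[OF s] by (auto simp: C1_on_def)
    have d: "(f has_vector_derivative g t) (at t within I)" if "t \<in> I \<inter> N" for t
      using g(1)[OF that] at_within_Int_open[OF N(1), of t I] that by simp
    have eq: "?f' t = g t" if "t \<in> I \<inter> N" for t
      using vector_derivative_within[OF _ d[OF that]] perf[of t] that by (simp add: trivial_limit_within)
    have "continuous_on (I \<inter> N) ?f'"
      using g(2) eq continuous_on_cong by (metis (no_types, lifting))
    then have "continuous (at s within I) ?f'"
      using at_within_Int_open[OF N] s N by (metis IntI continuous_on_eq_continuous_within)
    then show ?thesis using d[of s] eq[of s] s N by auto
  qed
  then show ?thesis
    unfolding C1_on_def by (intro exI[of _ ?f']) (auto simp: continuous_on_eq_continuous_within)
qed

lemma C1_on_act_list:
  assumes "C1_on I G" "\<And>ks. C1_on I (\<lambda>s. f s ks)"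
  shows "C1_on I (\<lambda>s. act_list (G s) (f s) us)"
  using assms(2)
proof (induction us arbitrary: f)
  case (Cons u us)
  show ?case
    unfolding act_list.simps by (intro C1_on_sum C1_on_mult C1_on_nth assms(1) Cons.IH Cons.prems)
qed simp

lemma C1_on_transpose:
  fixes K :: "real \<Rightarrow> real^'n^'m"
  assumes "C1_on I K"
  shows "C1_on I (\<lambda>s. transpose (K s))"
  by (intro C1_on_vecI) (simp add: transpose_def, intro C1_on_nth assms)

lemma C1_on_act:
  assumes "C1_on I G" "C1_on I K" "\<And>us ls. C1_on I (\<lambda>s. A s us ls)"
  shows "C1_on I (\<lambda>s. act (G s) (K s) (A s) us ls)"
  unfolding act_def by (intro C1_on_act_list C1_on_transpose assms)

lemma continuous_on_act_list:
  fixes G :: "'t::topological_space \<Rightarrow> real^'n^'n"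
  assumes "continuous_on I G" "\<And>ks. continuous_on I (\<lambda>s. f s ks)"
  shows "continuous_on I (\<lambda>s. act_list (G s) (f s) us)"
  using assms(2)
proof (induction us arbitrary: f)
  case (Cons u us)
  show ?case
    unfolding act_list.simps by (intro continuous_intros assms(1) Cons.IH Cons.prems)
qed simp

lemma continuous_on_act:
  fixes G K :: "'t::topological_space \<Rightarrow> real^'n^'n"
  assumes "continuous_on I G" "continuous_on I K" "\<And>us ls. continuous_on I (\<lambda>s. A s us ls)"
  shows "continuous_on I (\<lambda>s. act (G s) (K s) (A s) us ls)"
proof -
  have "continuous_on I (\<lambda>s. transpose (K s))"
    unfolding transpose_def by (intro continuous_intros assms)
  then show ?thesis unfolding act_def by (intro continuous_on_act_list assms)
qed

lemma has_vector_derivative_act_list: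
  assumes "\<And>ks. ((\<lambda>s. f s ks) has_vector_derivative f' ks) F"
  shows "((\<lambda>s. act_list G (f s) us) has_vector_derivative act_list G f' us) F"
  using assms
proof (induction us arbitrary: f f')
  case (Cons u us)
  show ?case
    unfolding act_list.simps
    by (intro has_vector_derivative_sum has_vector_derivative_mult_right Cons.IH Cons.prems)
qed simp

lemma has_vector_derivative_act:
  assumes "\<And>us ls. ((\<lambda>s. A s us ls) has_vector_derivative A' us ls) F"
  shows "((\<lambda>s. act G K (A s) us ls) has_vector_derivative act G K A' us ls) F"
  unfolding act_def by (intro has_vector_derivative_act_list assms)

text \<open>
  The simplest nonconstant C1 function that vanishes on a half-line, as a building block for bump
  functions.
\<close>

definition ramp :: "real \<Rightarrow> real" where "ramp t = (max 0 t)\<^sup>2"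

lemma C1_on_ramp: "C1_on UNIV ramp"
proof -
  have "(ramp has_vector_derivative 2 * max 0 t) (at t)" for t
  proof -
    have 1: "ramp = (\<lambda>t. if t \<in> {0..} then t\<^sup>2 else 0)"
      by (rule ext) (auto simp: ramp_def max_def)
    have "(ramp has_vector_derivative (if t \<in> {0..} then 2 * t else 0)) (at t within UNIV)"
      unfolding 1
      by (rule has_vector_derivative_If_within_closures[where T = "{..0}"])
         (auto intro!: derivative_eq_intros simp: has_real_derivative_iff_has_vector_derivative[symmetric])
    then show ?thesis by (auto simp: max_def split: if_splits)
  qed
  moreover have "continuous_on UNIV (\<lambda>t::real. 2 * max 0 t)" by (intro continuous_intros)
  ultimately show ?thesis unfolding C1_on_def by (intro exI[of _ "\<lambda>t. 2 * max 0 t"]) auto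
qed

section \<open>Linear differential equations\<close>

text \<open>
  Picard's argument: \<open>Y\<close> solves the equation if and only if it is a fixed point of
  \<open>Y \<mapsto> 1 + \<integral>\<^sub>x\<^sup>t Y \<Gamma>\<close>, and on an interval that is short compared with the size of \<open>\<Gamma>\<close> this map is a
  contraction.
\<close>

lemma linear_ode_short_interval:
  fixes \<Gamma> :: "real \<Rightarrow> real^'n^'n"
  assumes x: "x \<in> {l..u}" and \<Gamma>: "continuous_on {l..u} \<Gamma>"
    and M: "\<And>t Y. t \<in> {l..u} \<Longrightarrow> norm (Y ** \<Gamma> t :: real^'n^'n) \<le> M * norm Y" "0 \<le> M" "M * (u - l) < 1"
  obtains Y :: "real \<Rightarrow> real^'n^'n" where "Y x = mat 1"
    "\<And>t. t \<in> {l..u} \<Longrightarrow> (Y has_vector_derivative Y t ** \<Gamma> t) (at t within {l..u})"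
proof -
  \<comment> \<open>The fixed point theorem is applied to bounded continuous functions on the whole line, so the
    integral is frozen outside the interval.\<close>
  define cl where "cl t = max l (min u t)" for t
  have cl: "cl t \<in> {l..u}" "t \<in> {l..u} \<Longrightarrow> cl t = t" for t using x by (auto simp: cl_def)
  define G where "G f t = integral {l..t} (\<lambda>r. apply_bcontfun f r ** \<Gamma> r)" for f :: "real \<Rightarrow>\<^sub>C (real^'n^'n)" and t
  have cont: "continuous_on {l..u} (\<lambda>r. apply_bcontfun f r ** \<Gamma> r)" for f :: "real \<Rightarrow>\<^sub>C (real^'n^'n)"
    by (intro bounded_bilinear.continuous_on[OF bounded_bilinear_matrix_mult] \<Gamma>
        continuous_on_subset[OF continuous_on_apply_bcontfun]) auto
  have dG: "(G f has_vector_derivative apply_bcontfun f t ** \<Gamma> t) (at t within {l..u})" if "t \<in> {l..u}" for f t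
    unfolding G_def by (rule integral_has_vector_derivative[OF cont that])
  have cG: "continuous_on {l..u} (G f)" for f
    using dG by (metis continuous_on_eq_continuous_within has_vector_derivative_continuous)
  \<comment> \<open>\<open>G\<close> integrates from \<open>l\<close>; the difference \<open>G f t - G f x\<close> is the integral from \<open>x\<close> for \<open>t\<close> on either
    side of \<open>x\<close>.\<close>
  define op where "op f t = mat 1 + (G f (cl t) - G f x)" for f t
  have op: "op f \<in> bcontfun" for f
  proof -
    have "continuous_on UNIV (\<lambda>t. G f (cl t))"
      by (rule continuous_on_compose2[OF cG]) (auto simp: cl_def intro!: continuous_intros, use x in auto)
    then have "continuous_on UNIV (op f)"
      unfolding op_def[abs_def] by (intro continuous_intros)
    moreover have "bounded (range (op f))"
    proof -
      have "bounded (G f ` {l..u})" by (intro compact_imp_bounded compact_continuous_image cG) auto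
      then obtain B where B: "\<And>t. t \<in> {l..u} \<Longrightarrow> norm (G f t) \<le> B" unfolding bounded_iff by blast
      have "norm (op f t) \<le> norm (mat 1 :: real^'n^'n) + (B + B)" for t
        unfolding op_def
        by (intro norm_triangle_le add_mono norm_triangle_le_diff order.refl B cl x)
      then show ?thesis by (auto simp: bounded_iff)
    qed
    ultimately show ?thesis by (auto simp: bcontfun_def)
  qed
  define F where "F f = Bcontfun (op f)" for f
  have F: "apply_bcontfun (F f) = op f" for f unfolding F_def using op by (simp add: Bcontfun_inverse)
  have lip: "dist (F f) (F g) \<le> (M * (u - l)) * dist f g" for f g
  proof (rule dist_bound)
    fix t
    let ?h = "\<lambda>t. G f t - G g t"
    have "norm (?h (cl t) - ?h x) \<le> (M * dist f g) * norm (cl t - x)"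
    proof (rule differentiable_bound[of "{l..u}" ?h "\<lambda>t d. d *\<^sub>R (apply_bcontfun f t ** \<Gamma> t - apply_bcontfun g t ** \<Gamma> t)"])
      fix t assume t: "t \<in> {l..u}"
      show "(?h has_derivative (\<lambda>d. d *\<^sub>R (apply_bcontfun f t ** \<Gamma> t - apply_bcontfun g t ** \<Gamma> t))) (at t within {l..u})"
        using has_vector_derivative_diff[OF dG[OF t, of f] dG[OF t, of g]] by (simp add: has_vector_derivative_def)
      have "norm (apply_bcontfun f t ** \<Gamma> t - apply_bcontfun g t ** \<Gamma> t) = norm ((apply_bcontfun f t - apply_bcontfun g t) ** \<Gamma> t)"
        by (simp add: bounded_bilinear.diff_left[OF bounded_bilinear_matrix_mult])
      also have "\<dots> \<le> M * norm (apply_bcontfun f t - apply_bcontfun g t)" by (rule M(1)[OF t])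
      also have "\<dots> \<le> M * dist f g"
        using dist_bounded[of f t g] M(2) by (intro mult_left_mono) (auto simp: dist_norm)
      finally show "onorm (\<lambda>d. d *\<^sub>R (apply_bcontfun f t ** \<Gamma> t - apply_bcontfun g t ** \<Gamma> t)) \<le> M * dist f g"
        by (intro onorm_le) (simp add: mult.commute mult_left_mono)
    qed (use cl x in auto)
    also have "\<dots> \<le> (M * dist f g) * (u - l)"
      using cl(1)[of t] x M(2) by (intro mult_left_mono) (auto simp: abs_if)
    finally show "dist (apply_bcontfun (F f) t) (apply_bcontfun (F g) t) \<le> M * (u - l) * dist f g"
      unfolding F op_def by (simp add: dist_norm algebra_simps)
  qed
  have "\<exists>!f. F f = f"
    by (rule banach_fix_type[of "M * (u - l)"]) (use M x lip in auto)
  then obtain f where f: "F f = f" by blast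
  define Y where "Y = apply_bcontfun f"
  have Y: "Y t = mat 1 + (G f (cl t) - G f x)" for t
    using F[of f] f unfolding Y_def op_def by metis
  show ?thesis
  proof
    show "Y x = mat 1" using Y[of x] cl(2)[OF x] by simp
    fix t assume t: "t \<in> {l..u}"
    have "((\<lambda>t. mat 1 + (G f t - G f x)) has_vector_derivative 0 + (Y t ** \<Gamma> t - 0)) (at t within {l..u})"
      unfolding Y_def by (intro derivative_intros dG t)
    then have d: "((\<lambda>t. mat 1 + (G f t - G f x)) has_vector_derivative Y t ** \<Gamma> t) (at t within {l..u})" by simp
    show "(Y has_vector_derivative Y t ** \<Gamma> t) (at t within {l..u})"
      by (rule has_vector_derivative_transform[OF t _ d]) (simp add: Y cl)
  qed
qed

text \<open>
  The solution that starts at the unit matrix is invertible near its starting point, because its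
  determinant is continuous there.
\<close>

lemma linear_ode_near:
  fixes \<Gamma> :: "real \<Rightarrow> real^'n^'n"
  assumes x: "x \<in> {l..u}" and \<Gamma>: "continuous_on {l..u} \<Gamma>"
  obtains \<delta> and Y :: "real \<Rightarrow> real^'n^'n" where "\<delta> > 0"
    "\<And>t. t \<in> {l..u} \<Longrightarrow> \<bar>t - x\<bar> < \<delta> \<Longrightarrow> invertible (Y t)"
    "\<And>t. t \<in> {l..u} \<Longrightarrow> \<bar>t - x\<bar> < \<delta> \<Longrightarrow> (Y has_vector_derivative Y t ** \<Gamma> t) (at t within {l..u})"
proof -
  obtain K where K: "\<And>(A :: real^'n^'n) (B :: real^'n^'n). norm (A ** B) \<le> norm A * norm B * K" "K > 0"
    using bounded_bilinear.pos_bounded[OF bounded_bilinear_matrix_mult] by metis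
  have "bounded (\<Gamma> ` {l..u})" by (intro compact_imp_bounded compact_continuous_image \<Gamma>) auto
  then obtain B where B: "B > 0" "\<And>t. t \<in> {l..u} \<Longrightarrow> norm (\<Gamma> t) \<le> B" by (auto simp: bounded_pos)
  define M where "M = B * K"
  have M: "norm (Y ** \<Gamma> t) \<le> M * norm Y" if "t \<in> {l..u}" for t and Y :: "real^'n^'n"
  proof -
    have "norm (Y ** \<Gamma> t) \<le> norm Y * norm (\<Gamma> t) * K" by (rule K)
    also have "\<dots> \<le> norm Y * B * K"
      using K(2) B(2)[OF that] by (intro mult_right_mono mult_left_mono) auto
    finally show ?thesis by (simp add: M_def mult_ac)
  qed
  have "M > 0" using B K by (simp add: M_def)
  \<comment> \<open>The interval of radius \<open>\<delta>\<close> around \<open>x\<close> has length \<open>2 * \<delta>\<close>, and \<open>M * (2 * \<delta>) = 1 / 2\<close>.\<close>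
  define \<delta> where "\<delta> = 1 / (4 * M)"
  have d: "\<delta> > 0" "M * (2 * \<delta>) < 1" using \<open>M > 0\<close> by (auto simp: \<delta>_def field_simps)
  define l' u' where "l' = max l (x - \<delta>)" and "u' = min u (x + \<delta>)"
  have lu: "{l'..u'} \<subseteq> {l..u}" "x \<in> {l'..u'}" "u' - l' \<le> 2 * \<delta>"
    using x d by (auto simp: l'_def u'_def)
  have "M * (u' - l') < 1"
    using mult_left_mono[OF lu(3), of M] d(2) \<open>M > 0\<close> by linarith
  then obtain Y :: "real \<Rightarrow> real^'n^'n" where Y: "Y x = mat 1"
    "\<And>t. t \<in> {l'..u'} \<Longrightarrow> (Y has_vector_derivative Y t ** \<Gamma> t) (at t within {l'..u'})"
    using linear_ode_short_interval[OF lu(2) continuous_on_subset[OF \<Gamma> lu(1)], of M] M \<open>M > 0\<close> lu(1)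
    by (metis less_imp_le subsetD)
  have nhd: "at t within {l'..u'} = at t within {l..u}" if "\<bar>t - x\<bar> < \<delta>" for t
    by (rule at_within_nhd[of _ "{x - \<delta><..<x + \<delta>}"]) (use that in \<open>auto simp: l'_def u'_def\<close>)
  have Y2: "(Y has_vector_derivative Y t ** \<Gamma> t) (at t within {l..u})" if "t \<in> {l..u}" "\<bar>t - x\<bar> < \<delta>" for t
    using Y(2)[of t] nhd[OF that(2)] that by (auto simp: l'_def u'_def abs_less_iff)
  have "(\<lambda>t. det (Y t)) differentiable (at x within {l..u})"
    using has_vector_derivative_imp_differentiable[OF has_vector_derivative_entry[OF Y2[OF x]]] d(1)
    by (intro differentiable_det) simp
  then have "continuous (at x within {l..u}) (\<lambda>t. det (Y t))" by (rule differentiable_imp_continuous_within)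
  then have "\<forall>\<^sub>F t in at x within {l..u}. det (Y t) \<noteq> 0"
    by (intro tendsto_imp_eventually_ne[where c = 1]) (auto simp: continuous_within Y)
  then obtain e where e: "e > 0" "\<And>t. t \<in> {l..u} \<Longrightarrow> t \<noteq> x \<Longrightarrow> \<bar>t - x\<bar> < e \<Longrightarrow> det (Y t) \<noteq> 0"
    by (auto simp: eventually_at dist_real_def)
  show ?thesis
  proof (rule that[of "min \<delta> e" Y])
    fix t assume t: "t \<in> {l..u}" "\<bar>t - x\<bar> < min \<delta> e"
    then show "(Y has_vector_derivative Y t ** \<Gamma> t) (at t within {l..u})" by (intro Y2) auto
    show "invertible (Y t)" using e(2)[of t] t Y(1) by (cases "t = x") (auto simp: invertible_det_nz)
  qed (use d e in auto)
qed

section \<open>Tensors at a point\<close>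

lemma contraction_eq: "contraction k l A c = arr_contr k l (A c)"
  by (simp add: contraction_def arr_contr_def)

lemma tensor_prod_eq: "tensor_prod p q A B c = arr_prod p q (A c) (B c)"
  by (simp add: tensor_prod_def arr_prod_def)

text \<open>
  The transformation law is demanded only for index lists of the right lengths.  For arrays of a fixed
  type it is an equality of arrays, as both sides vanish on all other index lists.
\<close>

lemma tensor_space_iff:
  "A \<in> tensor_space \<A> p q x \<longleftrightarrow>
     (\<forall>c. has_type p q (A c)) \<and> (\<forall>c. \<not> (c \<in> \<A> \<and> x \<in> fst c) \<longrightarrow> A c = (\<lambda>us ls. 0)) \<and>
     (\<forall>c\<in>\<A>. \<forall>d\<in>\<A>. x \<in> fst c \<inter> fst d \<longrightarrow> A d = act (chart_jac c d x) (chart_jac d c x) (A c))"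
  (is "?L \<longleftrightarrow> ?S \<and> ?Z \<and> ?T")
proof -
  have 1: "(\<forall>c us ls. A c us ls \<noteq> 0 \<longrightarrow> c \<in> \<A> \<and> x \<in> fst c \<and> length us = p \<and> length ls = q) \<longleftrightarrow> ?S \<and> ?Z"
    unfolding has_type_def fun_eq_iff by blast
  have 2: "(\<forall>us ls. length us = p \<longrightarrow> length ls = q \<longrightarrow>
           A d us ls =
             (\<Sum>ks | length ks = p. \<Sum>ms | length ms = q.
                (\<Prod>a<p. chart_jac c d x $ (us ! a) $ (ks ! a)) *
                (\<Prod>b<q. chart_jac d c x $ (ms ! b) $ (ls ! b)) * A c ks ms)) \<longleftrightarrow>
         A d = act (chart_jac c d x) (chart_jac d c x) (A c)" (is "?P \<longleftrightarrow> _") if ?S for c d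
  proof -
    have "?P \<longleftrightarrow> (\<forall>us ls. length us = p \<longrightarrow> length ls = q \<longrightarrow>
        A d us ls = act (chart_jac c d x) (chart_jac d c x) (A c) us ls)"
      by (simp add: act_eq_sum)
    also have "\<dots> \<longleftrightarrow> (\<forall>us ls. A d us ls = act (chart_jac c d x) (chart_jac d c x) (A c) us ls)"
      using that has_type_act[of p q "A c" "chart_jac c d x" "chart_jac d c x"] unfolding has_type_def by metis
    finally show ?thesis by (simp add: fun_eq_iff)
  qed
  show ?thesis
  proof (cases ?S)
    case True
    show ?thesis unfolding tensor_space_def mem_Collect_eq 1 2[OF True] by (simp only: conj_assoc)
  next
    case False
    then show ?thesis unfolding tensor_space_def mem_Collect_eq 1 by blast
  qed
qed

locale curve =
  fixes \<A> :: "('a::t2_space, 'n::finite) chart set" and J :: "real set" and \<gamma> :: "real \<Rightarrow> 'a"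
  assumes atlas: "C1_atlas \<A>" and interval: "is_interval J" and nondegenerate: "\<exists>a\<in>J. \<exists>b\<in>J. a < b"
    and path: "C1_path \<A> J \<gamma>" and jacobians: "C1_jacobians_along \<A> J \<gamma>"
begin

abbreviation tensors :: "nat \<Rightarrow> nat \<Rightarrow> real \<Rightarrow> ('a, 'n) tensor set" where
  "tensors p q s \<equiv> tensor_space \<A> p q (\<gamma> s)"

definition chart_at :: "'a \<Rightarrow> ('a, 'n) chart" where
  "chart_at x = (SOME c. c \<in> \<A> \<and> x \<in> fst c)"

lemma chart_at: "chart_at x \<in> \<A>" "x \<in> fst (chart_at x)"
proof -
  have "x \<in> (\<Union>c\<in>\<A>. fst c)" using atlas by (simp add: C1_atlas_def)
  then have "\<exists>c. c \<in> \<A> \<and> x \<in> fst c" by blast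
  then have "chart_at x \<in> \<A> \<and> x \<in> fst (chart_at x)" unfolding chart_at_def by (rule someI_ex)
  then show "chart_at x \<in> \<A>" "x \<in> fst (chart_at x)" by auto
qed

lemma chart_homeomorphism:
  assumes "c \<in> \<A>"
  shows "open (fst c)" "open (snd c ` fst c)"
    "homeomorphism (fst c) (snd c ` fst c) (snd c) (the_inv_into (fst c) (snd c))"
  using atlas assms unfolding C1_atlas_def by (auto simp: case_prod_unfold)

lemma chart_inverse:
  assumes "c \<in> \<A>" "x \<in> fst c"
  shows "the_inv_into (fst c) (snd c) (snd c x) = x"
  using chart_homeomorphism(3)[OF assms(1)] assms(2) by (simp add: homeomorphism_def)

lemma open_chart_image:
  assumes "c \<in> \<A>" "open N" "N \<subseteq> fst c"
  shows "open (snd c ` N)"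
proof -
  have "openin (top_of_set (snd c ` fst c)) (snd c ` N)"
    using homeomorphism_imp_open_map[OF chart_homeomorphism(3)[OF assms(1)]] assms
    by (metis inf.absorb_iff2 openin_open)
  then show ?thesis using chart_homeomorphism(2)[OF assms(1)] openin_open_trans by blast
qed

lemma transition_point:
  "c \<in> \<A> \<Longrightarrow> x \<in> fst c \<Longrightarrow> transition c d (snd c x) = snd d x"
  by (simp add: transition_def chart_inverse)

text \<open>
  The Jacobian in \<open>chart_jac\<close> is a derivative at a point rather than within the domain of the coordinate
  change; the two agree because that domain is open.
\<close>

lemma transition_derivative:
  assumes "c \<in> \<A>" "d \<in> \<A>" "x \<in> fst c" "x \<in> fst d"
  shows "(transition c d has_derivative (\<lambda>h. chart_jac c d x *v h)) (at (snd c x))"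
proof -
  have op: "open (snd c ` (fst c \<inter> fst d))"
    by (intro open_chart_image assms open_Int chart_homeomorphism) auto
  have "transition c d differentiable_on (snd c ` (fst c \<inter> fst d))"
    using atlas assms unfolding C1_atlas_def by blast
  then have "transition c d differentiable (at (snd c x))"
    using assms op unfolding differentiable_on_def by (metis IntI at_within_open imageI)
  then show ?thesis by (simp add: chart_jac_def jacobian_works)
qed

lemma jacobian_unique:
  assumes "(f has_derivative (\<lambda>h. A *v h)) (at x)" "(f has_derivative (\<lambda>h. B *v h)) (at x)"
  shows "A = (B :: real^'n^'n)"
  using has_derivative_unique[OF assms] by (metis matrix_eq)

lemma chart_jac_cocycle:
  assumes "c \<in> \<A>" "d \<in> \<A>" "e \<in> \<A>" "x \<in> fst c" "x \<in> fst d" "x \<in> fst e"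
  shows "chart_jac d e x ** chart_jac c d x = chart_jac c e x"
proof -
  let ?N = "fst c \<inter> fst d \<inter> fst e"
  have "((transition d e \<circ> transition c d) has_derivative ((\<lambda>h. chart_jac d e x *v h) \<circ> (\<lambda>h. chart_jac c d x *v h))) (at (snd c x))"
    using transition_derivative[of d e x] transition_derivative[of c d x] assms
    by (intro diff_chain_at) (auto simp: transition_point)
  then have "((transition d e \<circ> transition c d) has_derivative (\<lambda>h. (chart_jac d e x ** chart_jac c d x) *v h)) (at (snd c x))"
    by (simp add: o_def matrix_vector_mul_assoc)
  moreover have "open (snd c ` ?N)"
    using assms by (intro open_chart_image open_Int chart_homeomorphism) auto
  ultimately have "(transition c e has_derivative (\<lambda>h. (chart_jac d e x ** chart_jac c d x) *v h)) (at (snd c x))"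
    by (rule has_derivative_transform_within_open) (use assms in \<open>auto simp: transition_point\<close>)
  then show ?thesis
    using jacobian_unique transition_derivative assms by blast
qed

lemma chart_jac_self:
  assumes "c \<in> \<A>" "x \<in> fst c"
  shows "chart_jac c c x = mat 1"
proof -
  have "((\<lambda>y. y) has_derivative (\<lambda>h. mat 1 *v h)) (at (snd c x))" by simp
  then have "(transition c c has_derivative (\<lambda>h. mat 1 *v h)) (at (snd c x))"
    by (rule has_derivative_transform_within_open[OF _ chart_homeomorphism(2)[OF assms(1)]])
       (use assms in \<open>auto simp: transition_point\<close>)
  then show ?thesis
    using jacobian_unique transition_derivative assms by blast
qed

lemma chart_jac_inverse:
  assumes "c \<in> \<A>" "d \<in> \<A>" "x \<in> fst c" "x \<in> fst d"
  shows "chart_jac d c x ** chart_jac c d x = mat 1"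
  using chart_jac_cocycle[of c d c x] chart_jac_self assms by simp

lemma invertible_chart_jac:
  assumes "c \<in> \<A>" "d \<in> \<A>" "x \<in> fst c" "x \<in> fst d"
  shows "invertible (chart_jac c d x)" "matrix_inv (chart_jac c d x) = chart_jac d c x"
  using matrix_inv_unique[OF chart_jac_inverse[of d c x]] assms by auto

subsection \<open>Tensors with prescribed components\<close>

text \<open>
  The tensor at \<open>x\<close> whose components in the chart \<open>c\<close> are \<open>B\<close>.  Every tensor at \<open>x\<close> has this form for
  every chart around \<open>x\<close> (\<open>tensor_of_components\<close>), so one array is enough to describe it.
\<close>

definition tensor_of :: "('a, 'n) chart \<Rightarrow> 'a \<Rightarrow> 'n arr \<Rightarrow> ('a, 'n) tensor" where
  "tensor_of c x B = (\<lambda>d us ls. if d \<in> \<A> \<and> x \<in> fst d then act (chart_jac c d x) (chart_jac d c x) B us ls else 0)"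

lemma tensor_of_eq: "d \<in> \<A> \<Longrightarrow> x \<in> fst d \<Longrightarrow> tensor_of c x B d = act (chart_jac c d x) (chart_jac d c x) B"
  by (simp add: tensor_of_def fun_eq_iff)

lemma tensor_of_self [simp]: "c \<in> \<A> \<Longrightarrow> x \<in> fst c \<Longrightarrow> tensor_of c x B c = B"
  by (simp add: tensor_of_eq chart_jac_self)

lemma tensor_of_in_tensor_space:
  assumes "c \<in> \<A>" "x \<in> fst c" "has_type p q B"
  shows "tensor_of c x B \<in> tensor_space \<A> p q x"
  unfolding tensor_space_iff
proof (intro conjI allI ballI impI)
  fix d show "has_type p q (tensor_of c x B d)"
    using has_type_act[OF assms(3), of "chart_jac c d x" "chart_jac d c x"] by (auto simp: tensor_of_def has_type_def)
next
  fix d assume "\<not> (d \<in> \<A> \<and> x \<in> fst d)"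
  then show "tensor_of c x B d = (\<lambda>us ls. 0)" by (auto simp: tensor_of_def)
next
  fix d e assume de: "d \<in> \<A>" "e \<in> \<A>" "x \<in> fst d \<inter> fst e"
  then show "tensor_of c x B e = act (chart_jac d e x) (chart_jac e d x) (tensor_of c x B d)"
    using assms chart_jac_cocycle by (simp add: tensor_of_eq act_act)
qed

lemma tensor_has_type: "A \<in> tensor_space \<A> p q x \<Longrightarrow> has_type p q (A c)"
  unfolding tensor_space_iff by blast

lemma tensor_zero: "A \<in> tensor_space \<A> p q x \<Longrightarrow> \<not> (c \<in> \<A> \<and> x \<in> fst c) \<Longrightarrow> A c = (\<lambda>us ls. 0)"
  unfolding tensor_space_iff by blast

lemma tensor_change:
  "A \<in> tensor_space \<A> p q x \<Longrightarrow> c \<in> \<A> \<Longrightarrow> d \<in> \<A> \<Longrightarrow> x \<in> fst c \<Longrightarrow> x \<in> fst d \<Longrightarrow>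
    A d = act (chart_jac c d x) (chart_jac d c x) (A c)"
  unfolding tensor_space_iff by blast

lemma tensor_of_components:
  assumes "A \<in> tensor_space \<A> p q x" "c \<in> \<A>" "x \<in> fst c"
  shows "tensor_of c x (A c) = A"
proof
  fix d
  show "tensor_of c x (A c) d = A d"
  proof (cases "d \<in> \<A> \<and> x \<in> fst d")
    case True
    then show ?thesis
      using tensor_change[OF assms(1), of c d] assms(2,3) by (simp only: tensor_of_eq)
  next
    case False
    then show ?thesis using tensor_zero[OF assms(1)] by (auto simp: tensor_of_def)
  qed
qed

lemma tensor_eqI:
  assumes "A \<in> tensor_space \<A> p q x" "B \<in> tensor_space \<A> p' q' x" "c \<in> \<A>" "x \<in> fst c" "A c = B c"
  shows "A = B"
  using tensor_of_components assms by metis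

lemma tensor_lin_in:
  assumes "A \<in> tensor_space \<A> p q x" "B \<in> tensor_space \<A> p q x"
  shows "tensor_lin a A b B \<in> tensor_space \<A> p q x"
  unfolding tensor_space_iff tensor_lin_def
proof (intro conjI allI ballI impI)
  fix c d assume "c \<in> \<A>" "d \<in> \<A>" "x \<in> fst c \<inter> fst d"
  then have "A d = act (chart_jac c d x) (chart_jac d c x) (A c)" "B d = act (chart_jac c d x) (chart_jac d c x) (B c)"
    using tensor_change[OF assms(1)] tensor_change[OF assms(2)] by blast+
  then show "(\<lambda>us ls. a * A d us ls + b * B d us ls) =
      act (chart_jac c d x) (chart_jac d c x) (\<lambda>us ls. a * A c us ls + b * B c us ls)"
    by (simp add: act_lin)
next
  fix c show "has_type p q (\<lambda>us ls. a * A c us ls + b * B c us ls)"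
    using assms by (intro has_type_lin tensor_has_type)
next
  fix c assume "\<not> (c \<in> \<A> \<and> x \<in> fst c)"
  then have "A c = (\<lambda>us ls. 0)" "B c = (\<lambda>us ls. 0)" using tensor_zero assms by blast+
  then show "(\<lambda>us ls. a * A c us ls + b * B c us ls) = (\<lambda>us ls. 0)" by simp
qed

lemma tensor_prod_in:
  assumes "A \<in> tensor_space \<A> p q x" "B \<in> tensor_space \<A> p' q' x"
  shows "tensor_prod p q A B \<in> tensor_space \<A> (p + p') (q + q') x"
  unfolding tensor_space_iff tensor_prod_eq
proof (intro conjI allI ballI impI)
  fix c d assume "c \<in> \<A>" "d \<in> \<A>" "x \<in> fst c \<inter> fst d"
  then have "A d = act (chart_jac c d x) (chart_jac d c x) (A c)" "B d = act (chart_jac c d x) (chart_jac d c x) (B c)"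
    using tensor_change[OF assms(1)] tensor_change[OF assms(2)] by blast+
  then show "arr_prod p q (A d) (B d) = act (chart_jac c d x) (chart_jac d c x) (arr_prod p q (A c) (B c))"
    by (simp add: act_arr_prod)
next
  fix c show "has_type (p + p') (q + q') (arr_prod p q (A c) (B c))"
    using assms by (intro has_type_arr_prod tensor_has_type)
next
  fix c assume "\<not> (c \<in> \<A> \<and> x \<in> fst c)"
  then have "A c = (\<lambda>us ls. 0)" using tensor_zero assms by blast
  then show "arr_prod p q (A c) (B c) = (\<lambda>us ls. 0)" by (simp add: arr_prod_def)
qed

lemma contraction_in:
  assumes "A \<in> tensor_space \<A> (Suc p) (Suc q) x" "k \<le> p" "l \<le> q"
  shows "contraction k l A \<in> tensor_space \<A> p q x"
  unfolding tensor_space_iff contraction_eq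
proof (intro conjI allI ballI impI)
  fix c d assume cd: "c \<in> \<A>" "d \<in> \<A>" "x \<in> fst c \<inter> fst d"
  then have "A d = act (chart_jac c d x) (chart_jac d c x) (A c)"
    using tensor_change[OF assms(1)] by blast
  then show "arr_contr k l (A d) = act (chart_jac c d x) (chart_jac d c x) (arr_contr k l (A c))"
    using cd act_arr_contr[OF chart_jac_inverse[of c d x]] by auto
next
  fix c show "has_type p q (arr_contr k l (A c))"
    using assms by (intro has_type_arr_contr tensor_has_type)
next
  fix c assume "\<not> (c \<in> \<A> \<and> x \<in> fst c)"
  then have "A c = (\<lambda>us ls. 0)" using tensor_zero assms by blast
  then show "arr_contr k l (A c) = (\<lambda>us ls. 0)" by (simp add: arr_contr_def)
qed

section \<open>The parameter interval\<close>

lemma J_islimpt: "s \<in> J \<Longrightarrow> s islimpt J"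
proof -
  assume s: "s \<in> J"
  have "connected J" using interval is_interval_connected by blast
  moreover have "\<nexists>a. J = {a}" using nondegenerate by auto
  ultimately show ?thesis using s connected_imp_perfect by blast
qed

lemma at_J_nontrivial: "s \<in> J \<Longrightarrow> at s within J \<noteq> bot"
  using J_islimpt by (simp add: trivial_limit_within)

lemma open_pullback:
  assumes "open W"
  obtains N where "open N" "{s \<in> J. \<gamma> s \<in> W} = J \<inter> N"
proof -
  have "continuous_on J \<gamma>" using path by (simp add: C1_path_def)
  then have "openin (top_of_set J) (J \<inter> \<gamma> -` W)"
    using assms by (rule continuous_openin_preimage_gen)
  then obtain N where "open N" "J \<inter> \<gamma> -` W = J \<inter> N" by (metis openin_open)
  moreover have "{s \<in> J. \<gamma> s \<in> W} = J \<inter> \<gamma> -` W" by auto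
  ultimately show ?thesis using that by simp
qed

text \<open>
  This is what allows computing in a chart: derivatives at \<open>s\<close> depend only on the parameters near \<open>s\<close>,
  whose points lie in \<open>W\<close> because the path is continuous.
\<close>

lemma at_within_pullback:
  assumes "open W" "s \<in> J" "\<gamma> s \<in> W"
  shows "at s within {s \<in> J. \<gamma> s \<in> W} = at s within J"
proof -
  obtain N where N: "open N" "{s \<in> J. \<gamma> s \<in> W} = J \<inter> N" using open_pullback assms by blast
  then have "s \<in> N" using assms by blast
  then show ?thesis using at_within_Int_open[of N s J] N by simp
qed

lemma islimpt_pullback:
  assumes "open W" "s \<in> J" "\<gamma> s \<in> W"
  shows "s islimpt {s \<in> J. \<gamma> s \<in> W}"
  using at_within_pullback[OF assms] J_islimpt[OF assms(2)] by (metis trivial_limit_within)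

abbreviation params :: "('a, 'n) chart \<Rightarrow> real set" where
  "params c \<equiv> {s \<in> J. \<gamma> s \<in> fst c}"

lemma chart_jac_C1:
  assumes "c \<in> \<A>" "d \<in> \<A>"
  shows "C1_on {s \<in> J. \<gamma> s \<in> fst c \<inter> fst d} (\<lambda>s. chart_jac c d (\<gamma> s))"
  using jacobians assms by (auto simp: C1_jacobians_along_def)

section \<open>C1 tensor fields\<close>

abbreviation "fields \<equiv> C1_tensor_fields \<A> J \<gamma>"

lemma fieldD:
  assumes "T \<in> fields p q"
  shows "s \<in> J \<Longrightarrow> T (\<gamma> s) \<in> tensors p q s"
    "x \<notin> \<gamma> ` J \<Longrightarrow> T x = (\<lambda>c us ls. 0)"
    "c \<in> \<A> \<Longrightarrow> C1_on (params c) (\<lambda>s. T (\<gamma> s) c us ls)"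
  using assms by (auto simp: C1_tensor_fields_def tensor_fields_def)

lemma fieldI:
  assumes "\<And>s. s \<in> J \<Longrightarrow> T (\<gamma> s) \<in> tensors p q s"
    "\<And>x. x \<notin> \<gamma> ` J \<Longrightarrow> T x = (\<lambda>c us ls. 0)"
    "\<And>c us ls. c \<in> \<A> \<Longrightarrow> C1_on (params c) (\<lambda>s. T (\<gamma> s) c us ls)"
  shows "T \<in> fields p q"
  using assms by (auto simp: C1_tensor_fields_def tensor_fields_def)

lemma field_lin:
  assumes A: "A \<in> fields p q" and B: "B \<in> fields p q"
  shows "(\<lambda>x. tensor_lin a (A x) b (B x)) \<in> fields p q"
proof (rule fieldI)
  fix c us ls assume "c \<in> \<A>"
  then show "C1_on (params c) (\<lambda>s. tensor_lin a (A (\<gamma> s)) b (B (\<gamma> s)) c us ls)"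
    unfolding tensor_lin_def by (intro C1_on_add C1_on_mult C1_on_const fieldD[OF A] fieldD[OF B])
next
  fix s assume "s \<in> J"
  then show "tensor_lin a (A (\<gamma> s)) b (B (\<gamma> s)) \<in> tensors p q s"
    by (intro tensor_lin_in fieldD[OF A] fieldD[OF B])
qed (simp add: tensor_lin_def fieldD(2)[OF A] fieldD(2)[OF B])

lemma field_prod:
  assumes A: "A \<in> fields p q" and B: "B \<in> fields p' q'"
  shows "(\<lambda>x. tensor_prod p q (A x) (B x)) \<in> fields (p + p') (q + q')"
proof (rule fieldI)
  fix c us ls assume "c \<in> \<A>"
  then show "C1_on (params c) (\<lambda>s. tensor_prod p q (A (\<gamma> s)) (B (\<gamma> s)) c us ls)"
    unfolding tensor_prod_def by (intro C1_on_mult fieldD[OF A] fieldD[OF B])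
next
  fix s assume "s \<in> J"
  then show "tensor_prod p q (A (\<gamma> s)) (B (\<gamma> s)) \<in> tensors (p + p') (q + q') s"
    by (intro tensor_prod_in fieldD[OF A] fieldD[OF B])
qed (simp add: tensor_prod_def fieldD(2)[OF A])

lemma field_contraction:
  assumes A: "A \<in> fields (Suc p) (Suc q)" and "k \<le> p" "l \<le> q"
  shows "(\<lambda>x. contraction k l (A x)) \<in> fields p q"
proof (rule fieldI)
  fix c us ls assume "c \<in> \<A>"
  then show "C1_on (params c) (\<lambda>s. contraction k l (A (\<gamma> s)) c us ls)"
    unfolding contraction_def by (intro C1_on_sum fieldD[OF A])
next
  fix s assume "s \<in> J"
  then show "contraction k l (A (\<gamma> s)) \<in> tensors p q s"
    by (intro contraction_in fieldD[OF A] assms)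
qed (simp add: contraction_def fieldD(2)[OF A])

text \<open>
  A bump function lives in a ball of the coordinate space.  Extended by zero it is C1 along the path: as
  the manifold is Hausdorff, the preimage \<open>K\<close> of a closed ball is not only compact but closed, so that
  the function vanishes near every point outside \<open>K\<close>.
\<close>

lemma bump:
  assumes c: "c \<in> \<A>" and x: "x \<in> fst c"
  obtains \<psi> :: "'a \<Rightarrow> real" and W K where "open W" "x \<in> W" "W \<subseteq> fst c" "\<And>y. y \<in> W \<Longrightarrow> \<psi> y = 1"
    "closed K" "K \<subseteq> fst c" "\<And>y. y \<notin> K \<Longrightarrow> \<psi> y = 0" "C1_on (params c) (\<lambda>s. \<psi> (\<gamma> s))"
proof -
  let ?\<phi> = "snd c" and ?inv = "the_inv_into (fst c) (snd c)"
  define y0 where "y0 = ?\<phi> x"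
  have "y0 \<in> ?\<phi> ` fst c" using x by (simp add: y0_def)
  then obtain R where R: "R > 0" "cball y0 R \<subseteq> ?\<phi> ` fst c"
    using chart_homeomorphism(2)[OF c] open_contains_cball by blast
  define r where "r = R / 2"
  have r: "r > 0" using R by (simp add: r_def)
  \<comment> \<open>With \<open>u = |y - y0|\<^sup>2 / r\<^sup>2\<close>, the inner ramp vanishes for \<open>u \<le> 1\<close>, where \<open>\<beta>\<close> is \<open>1\<close>, and is at least
    \<open>1\<close> for \<open>u \<ge> 2\<close>, where \<open>\<beta>\<close> is \<open>0\<close>.  The radius \<open>R = 2 * r\<close> corresponds to \<open>u = 4\<close>.\<close>
  define \<beta> where "\<beta> y = ramp (1 - ramp (((y - y0) \<bullet> (y - y0)) / r\<^sup>2 - 1))" for y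
  define \<psi> where "\<psi> y = (if y \<in> fst c then \<beta> (?\<phi> y) else 0)" for y
  define K where "K = ?inv ` cball y0 R"
  define W where "W = ?inv ` ball y0 r"
  note hom = chart_homeomorphism(3)[OF c]
  have sub: "ball y0 r \<subseteq> ?\<phi> ` fst c" using R by (auto simp: r_def)
  have K: "closed K"
  proof -
    have "continuous_on (cball y0 R) ?inv"
      by (rule continuous_on_subset[OF homeomorphism_cont2[OF hom] R(2)])
    then show ?thesis unfolding K_def by (intro compact_imp_closed compact_continuous_image) auto
  qed
  have Ksub: "K \<subseteq> fst c" unfolding K_def using image_mono[OF R(2), of ?inv] homeomorphism_image2[OF hom] by simp
  have W: "open W"
  proof -
    have "openin (top_of_set (fst c)) W"
      unfolding W_def
      by (rule homeomorphism_imp_open_map[OF homeomorphism_symD[OF hom]]) (use sub in \<open>metis inf.absorb_iff2 open_ball openin_open\<close>)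
    then show ?thesis using chart_homeomorphism(1)[OF c] openin_open_trans by blast
  qed
  have Wsub: "W \<subseteq> fst c" unfolding W_def using image_mono[OF sub, of ?inv] homeomorphism_image2[OF hom] by simp
  have xW: "x \<in> W" unfolding W_def using r chart_inverse[OF c x] by (metis centre_in_ball imageI y0_def)
  have one: "\<psi> y = 1" if "y \<in> W" for y
  proof -
    have "norm (?\<phi> y - y0) < r"
      using that sub hom unfolding W_def homeomorphism_def by (auto simp: dist_norm norm_minus_commute)
    then have "(?\<phi> y - y0) \<bullet> (?\<phi> y - y0) \<le> r\<^sup>2"
      by (simp add: dot_square_norm power_mono)
    then have "((?\<phi> y - y0) \<bullet> (?\<phi> y - y0)) / r\<^sup>2 - 1 \<le> 0" using r by (simp add: field_simps)
    then show ?thesis using that Wsub by (auto simp: \<psi>_def \<beta>_def ramp_def)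
  qed
  have zero: "\<psi> y = 0" if "y \<notin> K" for y
  proof (cases "y \<in> fst c")
    case True
    then have "?\<phi> y \<notin> cball y0 R" using that chart_inverse[OF c True] unfolding K_def by (metis imageI)
    then have "2 * r \<le> norm (?\<phi> y - y0)" by (simp add: r_def dist_norm norm_minus_commute)
    then have "(2 * r)\<^sup>2 \<le> (?\<phi> y - y0) \<bullet> (?\<phi> y - y0)"
      unfolding dot_square_norm using r by (intro power_mono) auto
    then have "4 * r\<^sup>2 \<le> (?\<phi> y - y0) \<bullet> (?\<phi> y - y0)" by (simp add: power_mult_distrib)
    moreover have "0 \<le> r\<^sup>2" by simp
    ultimately have "2 * r\<^sup>2 \<le> (?\<phi> y - y0) \<bullet> (?\<phi> y - y0)" by linarith
    then have "1 \<le> ((?\<phi> y - y0) \<bullet> (?\<phi> y - y0)) / r\<^sup>2 - 1" using r by (simp add: field_simps)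
    then have "1 \<le> ramp (((?\<phi> y - y0) \<bullet> (?\<phi> y - y0)) / r\<^sup>2 - 1)" by (simp add: ramp_def)
    then show ?thesis by (simp add: \<psi>_def \<beta>_def ramp_def[of "1 - _"])
  qed (simp add: \<psi>_def)
  have "C1_on (params c) (\<lambda>s. \<beta> (?\<phi> (\<gamma> s)))"
  proof -
    have "C1_on (params c) (?\<phi> \<circ> \<gamma>)" using path c by (simp add: C1_path_def)
    then have p: "C1_on (params c) (\<lambda>s. ?\<phi> (\<gamma> s) + (- y0))"
      by (intro C1_on_add C1_on_const) (simp add: o_def)
    have "C1_on (params c) (\<lambda>s. ((?\<phi> (\<gamma> s) + (- y0)) \<bullet> (?\<phi> (\<gamma> s) + (- y0))) * inverse (r\<^sup>2) + (- 1))"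
      by (intro C1_on_add C1_on_mult C1_on_const C1_on_bilinear[OF bounded_bilinear_inner] p)
    from C1_on_chain[OF this C1_on_ramp]
    have "C1_on (params c) (\<lambda>s. 1 + (-1) * ramp (((?\<phi> (\<gamma> s) + (- y0)) \<bullet> (?\<phi> (\<gamma> s) + (- y0))) * inverse (r\<^sup>2) + (- 1)))"
      by (rule C1_on_add[OF C1_on_const C1_on_mult[OF C1_on_const]])
    from C1_on_chain[OF this C1_on_ramp] show ?thesis by (simp add: \<beta>_def divide_inverse)
  qed
  then have "C1_on (params c) (\<lambda>s. \<psi> (\<gamma> s))"
    by (subst C1_on_cong[where g = "\<lambda>s. \<beta> (?\<phi> (\<gamma> s))"]) (auto simp: \<psi>_def)
  then show ?thesis using that W xW Wsub one K Ksub zero by blast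
qed

text \<open>
  Every array of a given type is the component array of a global C1 field near \<open>x\<close>, with the same
  neighbourhood for all types and arrays.  These are the fields on which a derivation is tested.  Along the path the
  Jacobians are C1 functions of the parameter; therefore the field is C1 in every chart, not only in \<open>c\<close>.
\<close>

lemma local_fields:
  assumes c: "c \<in> \<A>" and x: "x \<in> fst c"
  obtains W where "open W" "x \<in> W" "W \<subseteq> fst c"
    "\<And>p q B. has_type p q B \<Longrightarrow> \<exists>T \<in> fields p q. \<forall>s\<in>J. \<gamma> s \<in> W \<longrightarrow> T (\<gamma> s) c = B"
proof -
  obtain \<psi> :: "'a \<Rightarrow> real" and W K where W: "open W" "x \<in> W" "W \<subseteq> fst c" "\<And>y. y \<in> W \<Longrightarrow> \<psi> y = 1"
    and K: "closed K" "K \<subseteq> fst c" "\<And>y. y \<notin> K \<Longrightarrow> \<psi> y = 0" and \<psi>: "C1_on (params c) (\<lambda>s. \<psi> (\<gamma> s))"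
    by (rule bump[OF c x], rule that)
  show ?thesis
  proof (rule that[OF W(1-3)])
    fix p q B assume B: "has_type p q (B :: 'n arr)"
    define T where "T y = (if y \<in> \<gamma> ` J \<and> y \<in> fst c then tensor_of c y (\<lambda>us ls. \<psi> y * B us ls) else (\<lambda>d us ls. 0))" for y
    have "T \<in> fields p q"
    proof (rule fieldI)
      fix s assume "s \<in> J"
      have s: "has_type p q (\<lambda>us ls. \<psi> (\<gamma> s) * B us ls)" using B by (auto simp: has_type_def)
      have "(\<lambda>d us ls. 0) \<in> tensors p q s"
        by (simp add: tensor_space_iff) (simp add: has_type_def)
      then show "T (\<gamma> s) \<in> tensors p q s"
        using tensor_of_in_tensor_space[OF c _ s, of "\<gamma> s"] by (auto simp: T_def)
    next
      fix d us ls assume d: "d \<in> \<A>"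
      show "C1_on (params d) (\<lambda>s. T (\<gamma> s) d us ls)"
      proof (rule C1_on_local)
        fix s assume s: "s \<in> params d"
        then show "s islimpt params d" using islimpt_pullback chart_homeomorphism(1)[OF d] by blast
        show "\<exists>N. open N \<and> s \<in> N \<and> C1_on (params d \<inter> N) (\<lambda>s. T (\<gamma> s) d us ls)"
        proof (cases "\<gamma> s \<in> fst c")
          case True
          obtain N where N: "open N" "params c = J \<inter> N" using open_pullback chart_homeomorphism(1)[OF c] by blast
          have sub: "params d \<inter> N \<subseteq> params c" "params d \<inter> N \<subseteq> {s \<in> J. \<gamma> s \<in> fst c \<inter> fst d}" "params d \<inter> N \<subseteq> {s \<in> J. \<gamma> s \<in> fst d \<inter> fst c}"
            using N(2) by blast+
          have "C1_on (params d \<inter> N) (\<lambda>s. act (chart_jac c d (\<gamma> s)) (chart_jac d c (\<gamma> s)) (\<lambda>us ls. \<psi> (\<gamma> s) * B us ls) us ls)"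
            by (intro C1_on_act C1_on_mult C1_on_const C1_on_subset[OF \<psi> sub(1)]
               C1_on_subset[OF chart_jac_C1[OF c d] sub(2)] C1_on_subset[OF chart_jac_C1[OF d c] sub(3)])
          then have "C1_on (params d \<inter> N) (\<lambda>s. T (\<gamma> s) d us ls)"
            by (subst C1_on_cong) (use N d in \<open>auto simp: T_def tensor_of_def\<close>)
          moreover have "s \<in> N" using True N s by blast
          ultimately show ?thesis using N(1) by blast
        next
          case False
          then have "\<gamma> s \<in> - K" using K by auto
          moreover obtain N where N: "open N" "{s \<in> J. \<gamma> s \<in> - K} = J \<inter> N"
            by (rule open_pullback[OF open_Compl[OF K(1)]])
          ultimately have "s \<in> N" using s by (metis (mono_tags, lifting) IntD2 mem_Collect_eq)
          have "C1_on (params d \<inter> N) (\<lambda>s. 0::real)" by simp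
          moreover have "T (\<gamma> t) d us ls = 0" if "t \<in> params d \<inter> N" for t
          proof -
            have "\<psi> (\<gamma> t) = 0" using K(3) that N(2) by blast
            then show ?thesis by (simp add: T_def tensor_of_def)
          qed
          ultimately have "C1_on (params d \<inter> N) (\<lambda>s. T (\<gamma> s) d us ls)" by (subst C1_on_cong)
          then show ?thesis using N(1) \<open>s \<in> N\<close> by blast
        qed
      qed
    qed (simp add: T_def)
    moreover have "T (\<gamma> s) c = B" if "s \<in> J" "\<gamma> s \<in> W" for s
      using that W(3,4) c by (auto simp: T_def)
    ultimately show "\<exists>T \<in> fields p q. \<forall>s\<in>J. \<gamma> s \<in> W \<longrightarrow> T (\<gamma> s) c = B" by blast
  qed
qed


section \<open>Coframes along the path\<close>

abbreviation \<kappa> :: "real \<Rightarrow> ('a, 'n) chart" where "\<kappa> s \<equiv> chart_at (\<gamma> s)"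

abbreviation vec_at :: "('a \<Rightarrow> ('a, 'n) tensor) \<Rightarrow> real \<Rightarrow> real^'n" where
  "vec_at V t \<equiv> arr_vec (V (\<gamma> t) (\<kappa> t))"

text \<open>
  The matrix \<open>\<Psi> s\<close> refers to the chart that \<open>chart_at\<close> selects around \<open>\<gamma> s\<close>: its rows are covectors,
  and the columns of its inverse are the dual frame.  The selected chart jumps with \<open>s\<close>, so that \<open>\<Psi>\<close>
  itself need not even be continuous.  Smoothness is a property of \<open>chart_coframe \<Psi> c\<close>, the same coframe
  expressed in a chart \<open>c\<close> that is held fixed.
\<close>

definition comps :: "(real \<Rightarrow> real^'n^'n) \<Rightarrow> real \<Rightarrow> ('a, 'n) tensor \<Rightarrow> 'n arr" where
  "comps \<Psi> s A = act (\<Psi> s) (matrix_inv (\<Psi> s)) (A (\<kappa> s))"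

definition from_frame :: "(real \<Rightarrow> real^'n^'n) \<Rightarrow> real \<Rightarrow> 'n arr \<Rightarrow> ('a, 'n) tensor" where
  "from_frame \<Psi> s B = tensor_of (\<kappa> s) (\<gamma> s) (act (matrix_inv (\<Psi> s)) (\<Psi> s) B)"

definition frame_transport :: "(real \<Rightarrow> real^'n^'n) \<Rightarrow> real \<Rightarrow> real \<Rightarrow> ('a, 'n) tensor \<Rightarrow> ('a, 'n) tensor" where
  "frame_transport \<Psi> s t A = from_frame \<Psi> t (comps \<Psi> s A)"

definition chart_coframe :: "(real \<Rightarrow> real^'n^'n) \<Rightarrow> ('a, 'n) chart \<Rightarrow> real \<Rightarrow> real^'n^'n" where
  "chart_coframe \<Psi> c s = \<Psi> s ** chart_jac c (\<kappa> s) (\<gamma> s)"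

definition C1_coframe :: "(real \<Rightarrow> real^'n^'n) \<Rightarrow> bool" where
  "C1_coframe \<Psi> \<longleftrightarrow> (\<forall>s\<in>J. invertible (\<Psi> s)) \<and> (\<forall>c\<in>\<A>. C1_on (params c) (chart_coframe \<Psi> c))"

lemma from_frame_\<kappa>: "from_frame \<Psi> s B (\<kappa> s) = act (matrix_inv (\<Psi> s)) (\<Psi> s) B"
  by (simp add: from_frame_def chart_at)

lemma comps_from_frame: "invertible (\<Psi> s) \<Longrightarrow> comps \<Psi> s (from_frame \<Psi> s B) = B"
  by (simp add: comps_def from_frame_\<kappa> act_act matrix_inv_works)

lemma from_frame_comps:
  assumes "invertible (\<Psi> s)" "A \<in> tensors p q s"
  shows "from_frame \<Psi> s (comps \<Psi> s A) = A"
  using tensor_of_components[OF assms(2) chart_at] assms(1)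
  by (simp add: comps_def from_frame_def act_act matrix_inv_works)

lemma has_type_comps: "A \<in> tensors p q s \<Longrightarrow> has_type p q (comps \<Psi> s A)"
  unfolding comps_def by (intro has_type_act tensor_has_type)

lemma from_frame_in: "has_type p q B \<Longrightarrow> from_frame \<Psi> s B \<in> tensors p q s"
  unfolding from_frame_def by (intro tensor_of_in_tensor_space has_type_act chart_at)

lemma comps_lin: "comps \<Psi> s (tensor_lin a A b B) = (\<lambda>us ls. a * comps \<Psi> s A us ls + b * comps \<Psi> s B us ls)"
  by (simp add: comps_def tensor_lin_def act_lin)

lemma comps_prod: "comps \<Psi> s (tensor_prod p q A B) = arr_prod p q (comps \<Psi> s A) (comps \<Psi> s B)"
  by (simp add: comps_def tensor_prod_eq act_arr_prod)

lemma comps_contraction: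
  "invertible (\<Psi> s) \<Longrightarrow> comps \<Psi> s (contraction k l A) = arr_contr k l (comps \<Psi> s A)"
  by (simp add: comps_def contraction_eq act_arr_contr matrix_inv_works)

lemma comps_inject:
  assumes "invertible (\<Psi> s)" "A \<in> tensors p q s" "B \<in> tensors p' q' s"
    and "comps \<Psi> s A = comps \<Psi> s B"
  shows "A = B"
  using from_frame_comps assms by metis

lemma invertible_chart_coframe:
  assumes "invertible (\<Psi> s)" "c \<in> \<A>" "\<gamma> s \<in> fst c"
  shows "invertible (chart_coframe \<Psi> c s)" "matrix_inv (chart_coframe \<Psi> c s) = chart_jac (\<kappa> s) c (\<gamma> s) ** matrix_inv (\<Psi> s)"
  using assms invertible_chart_jac[OF assms(2) chart_at(1) assms(3) chart_at(2)]
  by (simp_all add: chart_coframe_def invertible_mult matrix_inv_mult)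

text \<open>
  Frame components do not depend on the chart, so that near a given parameter they can be computed
  in a single chart.
\<close>

lemma comps_in_chart:
  assumes "invertible (\<Psi> s)" "c \<in> \<A>" "\<gamma> s \<in> fst c" "A \<in> tensors p q s"
  shows "comps \<Psi> s A = act (chart_coframe \<Psi> c s) (matrix_inv (chart_coframe \<Psi> c s)) (A c)"
proof -
  have "A (\<kappa> s) = act (chart_jac c (\<kappa> s) (\<gamma> s)) (chart_jac (\<kappa> s) c (\<gamma> s)) (A c)"
    by (rule tensor_change[OF assms(4,2) chart_at(1) assms(3) chart_at(2)])
  then show ?thesis unfolding invertible_chart_coframe(2)[of \<Psi> s, OF assms(1-3)] by (simp add: comps_def chart_coframe_def act_act)
qed

lemma from_frame_in_chart:
  assumes "invertible (\<Psi> s)" "c \<in> \<A>" "\<gamma> s \<in> fst c"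
  shows "from_frame \<Psi> s B c = act (matrix_inv (chart_coframe \<Psi> c s)) (chart_coframe \<Psi> c s) B"
  unfolding invertible_chart_coframe(2)[of \<Psi> s, OF assms] using assms
  by (simp add: from_frame_def tensor_of_eq chart_coframe_def act_act)

text \<open>
  Passing to frame components is injective on tensors and respects all the tensor operations, and the
  transport does not change frame components; so each axiom can be checked on frame components.
\<close>

lemma S_transport_frame_transport:
  assumes inv: "\<And>s. s \<in> J \<Longrightarrow> invertible (\<Psi> s)"
  shows "S_transport \<A> J \<gamma> (frame_transport \<Psi>)"
proof -
  have tin: "frame_transport \<Psi> s t A \<in> tensors p q t" if "A \<in> tensors p q s" for s t p q A
    unfolding frame_transport_def using that by (intro from_frame_in has_type_comps)
  have ft: "comps \<Psi> t (frame_transport \<Psi> s t A) = comps \<Psi> s A" if "t \<in> J" for s t A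
    unfolding frame_transport_def using inv that by (simp add: comps_from_frame)
  have eqI: "frame_transport \<Psi> s t A = B" if "t \<in> J" "A \<in> tensors p q s" "B \<in> tensors p q t"
    "comps \<Psi> t B = comps \<Psi> s A" for s t A B p q
    using that ft by (intro comps_inject[OF inv tin]) auto
  show ?thesis
    unfolding S_transport_def
  proof (intro conjI ballI allI impI)
    fix s t p q show "frame_transport \<Psi> s t ` tensors p q s \<subseteq> tensors p q t"
      using tin by blast
  next
    fix s t p q a b A B
    assume "s \<in> J" "t \<in> J" and AB: "A \<in> tensors p q s" "B \<in> tensors p q s"
    then show "frame_transport \<Psi> s t (tensor_lin a A b B) = tensor_lin a (frame_transport \<Psi> s t A) b (frame_transport \<Psi> s t B)"
      by (intro eqI[OF _ tensor_lin_in[OF AB] tensor_lin_in[OF tin[OF AB(1)] tin[OF AB(2)]]])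
         (simp_all add: comps_lin ft)
  next
    fix s t p q p' q' A B
    assume "s \<in> J" "t \<in> J" and AB: "A \<in> tensors p q s" "B \<in> tensors p' q' s"
    then show "frame_transport \<Psi> s t (tensor_prod p q A B) = tensor_prod p q (frame_transport \<Psi> s t A) (frame_transport \<Psi> s t B)"
      by (intro eqI[OF _ tensor_prod_in[OF AB] tensor_prod_in[OF tin[OF AB(1)] tin[OF AB(2)]]])
         (simp_all add: comps_prod ft)
  next
    fix s t p q k l A
    assume "s \<in> J" "t \<in> J" and kl: "k \<le> p" "l \<le> q" and A: "A \<in> tensors (Suc p) (Suc q) s"
    then show "frame_transport \<Psi> s t (contraction k l A) = contraction k l (frame_transport \<Psi> s t A)"
      by (intro eqI[OF _ contraction_in[OF A kl] contraction_in[OF tin[OF A] kl]])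
         (simp_all add: comps_contraction ft inv)
  next
    fix r s t p q A
    assume "r \<in> J" "s \<in> J" "t \<in> J" and A: "A \<in> tensors p q s"
    then show "frame_transport \<Psi> t r (frame_transport \<Psi> s t A) = frame_transport \<Psi> s r A"
      by (intro eqI[OF _ tin[OF A] tin[OF A]]) (simp_all add: ft)
  next
    fix s p q A
    assume "s \<in> J" and A: "A \<in> tensors p q s"
    then show "frame_transport \<Psi> s s A = A" by (intro eqI[OF _ A A]) auto
  qed
qed

lemma from_frame_sum:
  "from_frame \<Psi> s (\<lambda>us ls. \<Sum>i\<in>I. a i * B i us ls) = (\<lambda>c us ls. \<Sum>i\<in>I. a i * from_frame \<Psi> s (B i) c us ls)"
proof (intro ext)
  fix c us ls
  show "from_frame \<Psi> s (\<lambda>us ls. \<Sum>i\<in>I. a i * B i us ls) c us ls = (\<Sum>i\<in>I. a i * from_frame \<Psi> s (B i) c us ls)"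
    by (cases "c \<in> \<A> \<and> \<gamma> s \<in> fst c") (auto simp: from_frame_def tensor_of_def act_sum)
qed

text \<open>
  With respect to the frame dual to the coframe, the matrix of the transport is the unit matrix.
\<close>

lemma C1_transport_frame_transport:
  assumes \<Psi>: "C1_coframe \<Psi>"
  shows "C1_transport \<A> J \<gamma> (frame_transport \<Psi>)"
proof -
  have inv: "\<And>s. s \<in> J \<Longrightarrow> invertible (\<Psi> s)" and C1: "\<And>c. c \<in> \<A> \<Longrightarrow> C1_on (params c) (chart_coframe \<Psi> c)"
    using \<Psi> by (auto simp: C1_coframe_def)
  define E where "E s i = from_frame \<Psi> s (vec_arr (axis i 1))" for s i
  have comb: "(\<lambda>c us ls. \<Sum>i\<in>UNIV. a $ i * E s i c us ls) = from_frame \<Psi> s (vec_arr a)" for a s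
    by (subst vec_arr_sum_axis) (simp add: from_frame_sum E_def)
  have "C1_basis_along \<A> J \<gamma> E"
    unfolding C1_basis_along_def
  proof (intro conjI ballI allI)
    fix s i assume "s \<in> J"
    show "E s i \<in> tensors 1 0 s"
      unfolding E_def by (intro from_frame_in has_type_vec_arr)
  next
    fix s A assume s: "s \<in> J" and A: "A \<in> tensors 1 0 s"
    show "\<exists>!a. A = (\<lambda>c us ls. \<Sum>i\<in>UNIV. a $ i * E s i c us ls)"
      unfolding comb
    proof
      show "A = from_frame \<Psi> s (vec_arr (arr_vec (comps \<Psi> s A)))"
        using A s inv by (simp add: vec_arr_arr_vec[OF has_type_comps] from_frame_comps)
      show "a = arr_vec (comps \<Psi> s A)" if "A = from_frame \<Psi> s (vec_arr a)" for a
        using that s inv by (simp add: comps_from_frame)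
    qed
  next
    fix c i us ls assume c: "c \<in> \<A>"
    have "C1_on (params c) (\<lambda>s. act (matrix_inv (chart_coframe \<Psi> c s)) (chart_coframe \<Psi> c s) (vec_arr (axis i 1)) us ls)"
      by (intro C1_on_act C1_on_matrix_inv C1 c C1_on_const) (use inv c invertible_chart_coframe in auto)
    then show "C1_on (params c) (\<lambda>s. E s i c us ls)"
      by (subst C1_on_cong) (use inv c in \<open>auto simp: E_def from_frame_in_chart\<close>)
  qed
  moreover have "is_transport_matrix J E (frame_transport \<Psi>) (\<lambda>t s. mat 1)"
    unfolding is_transport_matrix_def
    by (auto simp: frame_transport_def E_def comps_from_frame inv mat_def if_distrib[of "\<lambda>x. x * _"] cong: if_cong)
  ultimately show ?thesis
    unfolding C1_transport_def by (intro exI[of _ E] exI[of _ "\<lambda>t s. mat 1"]) auto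
qed

section \<open>The covariant derivative of a coframe\<close>

abbreviation comps_deriv ::
    "(real \<Rightarrow> real^'n^'n) \<Rightarrow> ('a \<Rightarrow> ('a, 'n) tensor) \<Rightarrow> 'n list \<Rightarrow> 'n list \<Rightarrow> real \<Rightarrow> real" where
  "comps_deriv \<Psi> T us ls s \<equiv> vector_derivative (\<lambda>t. comps \<Psi> t (T (\<gamma> t)) us ls) (at s within J)"

text \<open>
  The derivative of a field that treats the frame dual to \<open>\<Psi>\<close> as constant.  It depends on the
  parameter, not only on the point: the path may pass through a point in several directions.
\<close>

definition nabla :: "(real \<Rightarrow> real^'n^'n) \<Rightarrow> ('a \<Rightarrow> ('a, 'n) tensor) \<Rightarrow> real \<Rightarrow> ('a, 'n) tensor" where
  "nabla \<Psi> T s = from_frame \<Psi> s (\<lambda>us ls. comps_deriv \<Psi> T us ls s)"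

lemma comps_C1:
  assumes \<Psi>: "C1_coframe \<Psi>" and T: "T \<in> fields p q"
  shows "C1_on J (\<lambda>s. comps \<Psi> s (T (\<gamma> s)) us ls)"
proof (rule C1_on_local)
  have inv: "\<And>s. s \<in> J \<Longrightarrow> invertible (\<Psi> s)" and C1: "\<And>c. c \<in> \<A> \<Longrightarrow> C1_on (params c) (chart_coframe \<Psi> c)"
    using \<Psi> by (auto simp: C1_coframe_def)
  fix s assume s: "s \<in> J"
  then show "s islimpt J" by (rule J_islimpt)
  let ?c = "\<kappa> s"
  obtain N where N: "open N" "params ?c = J \<inter> N"
    by (rule open_pullback[OF chart_homeomorphism(1)[OF chart_at(1)]])
  have "C1_on (params ?c) (\<lambda>s. act (chart_coframe \<Psi> ?c s) (matrix_inv (chart_coframe \<Psi> ?c s)) (T (\<gamma> s) ?c) us ls)"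
    by (intro C1_on_act C1_on_matrix_inv C1 chart_at fieldD(3)[OF T]) (use inv chart_at invertible_chart_coframe in auto)
  moreover have "comps \<Psi> t (T (\<gamma> t)) = act (chart_coframe \<Psi> ?c t) (matrix_inv (chart_coframe \<Psi> ?c t)) (T (\<gamma> t) ?c)" if "t \<in> params ?c" for t
    using that by (intro comps_in_chart[OF inv chart_at(1) _ fieldD(1)[OF T]]) auto
  ultimately have "C1_on (params ?c) (\<lambda>s. comps \<Psi> s (T (\<gamma> s)) us ls)"
    by (subst C1_on_cong) auto
  moreover have "s \<in> N" using s chart_at N by blast
  ultimately show "\<exists>N. open N \<and> s \<in> N \<and> C1_on (J \<inter> N) (\<lambda>s. comps \<Psi> s (T (\<gamma> s)) us ls)"
    using N by metis
qed

lemma comps_vector_derivative: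
  assumes \<Psi>: "C1_coframe \<Psi>" and T: "T \<in> fields p q"
  shows "s \<in> J \<Longrightarrow> ((\<lambda>t. comps \<Psi> t (T (\<gamma> t)) us ls) has_vector_derivative
      comps_deriv \<Psi> T us ls s) (at s within J)"
    and "continuous_on J (\<lambda>s. comps_deriv \<Psi> T us ls s)"
proof -
  let ?f = "\<lambda>t. comps \<Psi> t (T (\<gamma> t)) us ls"
  obtain g where g: "\<And>s. s \<in> J \<Longrightarrow> (?f has_vector_derivative g s) (at s within J)" "continuous_on J g"
    using comps_C1[OF assms, of us ls] unfolding C1_on_def by blast
  have eq: "vector_derivative ?f (at s within J) = g s" if "s \<in> J" for s
    using vector_derivative_within[OF at_J_nontrivial[OF that] g(1)[OF that]] .
  show "s \<in> J \<Longrightarrow> (?f has_vector_derivative vector_derivative ?f (at s within J)) (at s within J)"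
    using g eq by simp
  show "continuous_on J (\<lambda>s. vector_derivative ?f (at s within J))"
    using g(2) by (rule continuous_on_eq) (simp add: eq)
qed

lemma nabla_in:
  assumes \<Psi>: "C1_coframe \<Psi>" and T: "T \<in> fields p q" and s: "s \<in> J"
  shows "nabla \<Psi> T s \<in> tensors p q s"
  unfolding nabla_def
proof (rule from_frame_in)
  have "comps_deriv \<Psi> T us ls s = 0"
    if "\<not> (length us = p \<and> length ls = q)" for us ls
  proof (rule vector_derivative_within[OF at_J_nontrivial[OF s]])
    have "comps \<Psi> t (T (\<gamma> t)) us ls = 0" if "t \<in> J" for t
      using has_type_comps[OF fieldD(1)[OF T that], of \<Psi>] \<open>\<not> (length us = p \<and> length ls = q)\<close> unfolding has_type_def by blast
    then show "((\<lambda>t. comps \<Psi> t (T (\<gamma> t)) us ls) has_vector_derivative 0) (at s within J)"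
      by (intro has_vector_derivative_transform[OF s _ has_vector_derivative_const[of 0]]) auto
  qed
  then show "has_type p q (\<lambda>us ls. comps_deriv \<Psi> T us ls s)"
    unfolding has_type_def by blast
qed

lemma comps_nabla:
  assumes \<Psi>: "C1_coframe \<Psi>" and T: "T \<in> fields p q" and s: "s \<in> J"
  shows "((\<lambda>t. comps \<Psi> t (T (\<gamma> t)) us ls) has_vector_derivative comps \<Psi> s (nabla \<Psi> T s) us ls) (at s within J)"
  using comps_vector_derivative(1)[OF assms] \<Psi> s unfolding nabla_def C1_coframe_def by (simp add: comps_from_frame)

text \<open>
  This rule reduces the algebraic laws for \<open>nabla\<close> to those for derivatives of real functions.
\<close>

lemma nabla_eqI:
  assumes "C1_coframe \<Psi>" and s: "s \<in> J" and X: "X \<in> tensors p q s"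
    and d: "\<And>us ls. ((\<lambda>t. comps \<Psi> t (T (\<gamma> t)) us ls) has_vector_derivative comps \<Psi> s X us ls) (at s within J)"
  shows "nabla \<Psi> T s = X"
proof -
  have "comps_deriv \<Psi> T us ls s = comps \<Psi> s X us ls" for us ls
    by (rule vector_derivative_within[OF at_J_nontrivial[OF s] d])
  then show ?thesis
    using assms(1) s from_frame_comps[OF _ X] by (simp add: nabla_def C1_coframe_def)
qed

lemma nabla_lin:
  assumes \<Psi>: "C1_coframe \<Psi>" and A: "A \<in> fields p q" and B: "B \<in> fields p q" and s: "s \<in> J"
  shows "nabla \<Psi> (\<lambda>x. tensor_lin a (A x) b (B x)) s = tensor_lin a (nabla \<Psi> A s) b (nabla \<Psi> B s)"
proof (rule nabla_eqI[OF \<Psi> s])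
  show "tensor_lin a (nabla \<Psi> A s) b (nabla \<Psi> B s) \<in> tensors p q s"
    by (intro tensor_lin_in nabla_in assms)
  fix us ls
  show "((\<lambda>t. comps \<Psi> t (tensor_lin a (A (\<gamma> t)) b (B (\<gamma> t))) us ls) has_vector_derivative
      comps \<Psi> s (tensor_lin a (nabla \<Psi> A s) b (nabla \<Psi> B s)) us ls) (at s within J)"
    unfolding comps_lin
    by (intro has_vector_derivative_add has_vector_derivative_mult_right comps_nabla[OF \<Psi> A s] comps_nabla[OF \<Psi> B s])
qed

lemma nabla_prod:
  assumes \<Psi>: "C1_coframe \<Psi>" and A: "A \<in> fields p q" and B: "B \<in> fields p' q'" and s: "s \<in> J"
  shows "nabla \<Psi> (\<lambda>x. tensor_prod p q (A x) (B x)) s =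
    tensor_lin 1 (tensor_prod p q (nabla \<Psi> A s) (B (\<gamma> s))) 1 (tensor_prod p q (A (\<gamma> s)) (nabla \<Psi> B s))"
    (is "_ = ?X")
proof (rule nabla_eqI[OF \<Psi> s])
  show "?X \<in> tensors (p + p') (q + q') s"
    by (intro tensor_lin_in tensor_prod_in nabla_in fieldD[OF A] fieldD[OF B] assms)
  fix us ls
  show "((\<lambda>t. comps \<Psi> t (tensor_prod p q (A (\<gamma> t)) (B (\<gamma> t))) us ls) has_vector_derivative comps \<Psi> s ?X us ls) (at s within J)"
    unfolding comps_lin comps_prod arr_prod_def
    by (rule has_vector_derivative_eq_rhs, rule has_vector_derivative_mult[OF comps_nabla[OF \<Psi> A s] comps_nabla[OF \<Psi> B s]]) simp
qed

lemma nabla_contraction: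
  assumes \<Psi>: "C1_coframe \<Psi>" and A: "A \<in> fields (Suc p) (Suc q)" and kl: "k \<le> p" "l \<le> q" and s: "s \<in> J"
  shows "nabla \<Psi> (\<lambda>x. contraction k l (A x)) s = contraction k l (nabla \<Psi> A s)"
proof (rule nabla_eqI[OF \<Psi> s])
  show "contraction k l (nabla \<Psi> A s) \<in> tensors p q s"
    by (intro contraction_in nabla_in assms)
  fix us ls
  have inv: "\<And>s. s \<in> J \<Longrightarrow> invertible (\<Psi> s)" using \<Psi> by (auto simp: C1_coframe_def)
  have "((\<lambda>t. arr_contr k l (comps \<Psi> t (A (\<gamma> t))) us ls) has_vector_derivative
      arr_contr k l (comps \<Psi> s (nabla \<Psi> A s)) us ls) (at s within J)"
    unfolding arr_contr_def by (intro has_vector_derivative_sum comps_nabla[OF \<Psi> A s])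
  then have "((\<lambda>t. arr_contr k l (comps \<Psi> t (A (\<gamma> t))) us ls) has_vector_derivative
      comps \<Psi> s (contraction k l (nabla \<Psi> A s)) us ls) (at s within J)"
    using inv s by (simp add: comps_contraction)
  then show "((\<lambda>t. comps \<Psi> t (contraction k l (A (\<gamma> t))) us ls) has_vector_derivative
      comps \<Psi> s (contraction k l (nabla \<Psi> A s)) us ls) (at s within J)"
    by (rule has_vector_derivative_transform[OF s, rotated]) (simp add: comps_contraction inv)
qed

lemma nabla_continuous:
  assumes \<Psi>: "C1_coframe \<Psi>" and T: "T \<in> fields p q" and c: "c \<in> \<A>"
  shows "continuous_on (params c) (\<lambda>s. nabla \<Psi> T s c us ls)"
proof -
  have inv: "\<And>s. s \<in> J \<Longrightarrow> invertible (\<Psi> s)" and C1: "C1_on (params c) (chart_coframe \<Psi> c)"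
    using \<Psi> c by (auto simp: C1_coframe_def)
  have "C1_on (params c) (\<lambda>s. matrix_inv (chart_coframe \<Psi> c s))"
    by (intro C1_on_matrix_inv C1) (use inv c invertible_chart_coframe in auto)
  then have "continuous_on (params c) (\<lambda>s. act (matrix_inv (chart_coframe \<Psi> c s)) (chart_coframe \<Psi> c s)
      (\<lambda>us ls. comps_deriv \<Psi> T us ls s) us ls)"
    by (intro continuous_on_act C1_on_imp_continuous C1 continuous_on_subset[OF comps_vector_derivative(2)[OF \<Psi> T]]) auto
  then show ?thesis
    by (rule continuous_on_eq) (use inv c in \<open>auto simp: nabla_def from_frame_in_chart\<close>)
qed

lemma scalar_tensor_eq: "c \<in> \<A> \<Longrightarrow> x \<in> fst c \<Longrightarrow> scalar_tensor \<A> x r c = scalar_arr r"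
  by (simp add: scalar_tensor_def scalar_arr_def)

lemma scalar_tensor_in: "scalar_tensor \<A> x r \<in> tensor_space \<A> 0 0 x"
proof -
  have "scalar_tensor \<A> x r = tensor_of (chart_at x) x (scalar_arr r)"
    by (intro ext) (simp add: tensor_of_def act_scalar[OF has_type_scalar_arr], simp add: scalar_arr_def scalar_tensor_def)
  then show ?thesis using tensor_of_in_tensor_space[OF chart_at has_type_scalar_arr] by simp
qed

lemma comps_scalar_tensor: "comps \<Psi> s (scalar_tensor \<A> (\<gamma> s) r) = scalar_arr r"
  by (simp add: comps_def scalar_tensor_eq chart_at act_scalar has_type_scalar_arr)

lemma scalar_field_in_fields:
  assumes "C1_on J (f \<circ> \<gamma>)"
  shows "scalar_field \<A> (\<gamma> ` J) f \<in> fields 0 0"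
proof (rule fieldI)
  fix c and us ls :: "'n list" assume c: "c \<in> \<A>"
  have "C1_on (params c) (\<lambda>s. if us = [] \<and> ls = [] then f (\<gamma> s) else 0)"
    using C1_on_subset[OF assms, of "params c"] by (cases "us = [] \<and> ls = []") (auto simp: o_def)
  then show "C1_on (params c) (\<lambda>s. scalar_field \<A> (\<gamma> ` J) f (\<gamma> s) c us ls)"
    by (subst C1_on_cong) (use c in \<open>auto simp: scalar_field_def scalar_tensor_def\<close>)
qed (auto simp: scalar_field_def scalar_tensor_in)

text \<open>
  This brings fields of type \<open>(0,0)\<close> into the form in which the value of a derivation is prescribed.
\<close>

lemma scalar_field_cases:
  assumes T: "T \<in> fields 0 0"
  obtains f where "C1_on J (f \<circ> \<gamma>)" "T = scalar_field \<A> (\<gamma> ` J) f"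
proof -
  define f where "f x = T x (chart_at x) [] []" for x
  have eq: "T x = scalar_tensor \<A> x (f x)" if "x \<in> \<gamma> ` J" for x
  proof (rule tensor_eqI[OF _ scalar_tensor_in chart_at])
    show "T x \<in> tensor_space \<A> 0 0 x" using fieldD(1)[OF T] that by blast
    then show "T x (chart_at x) = scalar_tensor \<A> x (f x) (chart_at x)"
      using scalar_arr_eq[OF tensor_has_type] by (simp add: scalar_tensor_eq chart_at f_def)
  qed
  have "C1_on J (f \<circ> \<gamma>)"
  proof (rule C1_on_local)
    fix s assume s: "s \<in> J"
    then show "s islimpt J" by (rule J_islimpt)
    obtain N where N: "open N" "params (\<kappa> s) = J \<inter> N"
      by (rule open_pullback[OF chart_homeomorphism(1)[OF chart_at(1)]])
    have "C1_on (params (\<kappa> s)) (f \<circ> \<gamma>)"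
      by (subst C1_on_cong[where g = "\<lambda>t. T (\<gamma> t) (\<kappa> s) [] []"])
         (auto simp: eq scalar_tensor_eq chart_at(1) scalar_arr_def intro: fieldD(3)[OF T])
    moreover have "s \<in> N" using s chart_at N by blast
    ultimately show "\<exists>N. open N \<and> s \<in> N \<and> C1_on (J \<inter> N) (f \<circ> \<gamma>)" using N by metis
  qed
  moreover have "T = scalar_field \<A> (\<gamma> ` J) f"
    by (rule ext) (auto simp: scalar_field_def eq fieldD(2)[OF T])
  ultimately show ?thesis using that by blast
qed

lemma nabla_scalar:
  assumes \<Psi>: "C1_coframe \<Psi>" and s: "s \<in> J" and r: "((f \<circ> \<gamma>) has_real_derivative r) (at s within J)"
  shows "nabla \<Psi> (scalar_field \<A> (\<gamma> ` J) f) s = scalar_tensor \<A> (\<gamma> s) r"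
proof (rule nabla_eqI[OF \<Psi> s scalar_tensor_in])
  fix us ls :: "'n list"
  have "((\<lambda>t. scalar_arr ((f \<circ> \<gamma>) t) us ls) has_vector_derivative scalar_arr r us ls) (at s within J)"
    using r by (cases "us = [] \<and> ls = []")
      (auto simp: scalar_arr_def has_real_derivative_iff_has_vector_derivative o_def)
  then show "((\<lambda>t. comps \<Psi> t (scalar_field \<A> (\<gamma> ` J) f (\<gamma> t)) us ls) has_vector_derivative
      comps \<Psi> s (scalar_tensor \<A> (\<gamma> s) r) us ls) (at s within J)"
    unfolding comps_scalar_tensor
    by (rule has_vector_derivative_transform[OF s, rotated]) (simp add: scalar_field_def comps_scalar_tensor)
qed

subsection \<open>The covariant derivative is the generated map\<close>

text \<open>
  This makes the generating limit unique.
\<close>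

lemma shift_nontrivial:
  assumes "s \<in> J"
  shows "at 0 within {\<epsilon>. s + \<epsilon> \<in> J} \<noteq> bot"
proof -
  have "(0::real) islimpt {\<epsilon>. s + \<epsilon> \<in> J}"
    unfolding islimpt_approachable
  proof (intro allI impI)
    fix e :: real assume "e > 0"
    then obtain t where "t \<in> J" "t \<noteq> s" "dist t s < e"
      using J_islimpt[OF assms] unfolding islimpt_approachable by blast
    then show "\<exists>x'\<in>{\<epsilon>. s + \<epsilon> \<in> J}. x' \<noteq> 0 \<and> dist x' 0 < e"
      by (intro bexI[of _ "t - s"]) (auto simp: dist_norm)
  qed
  then show ?thesis by (simp add: trivial_limit_within)
qed

abbreviation quotient ::
    "(real \<Rightarrow> real \<Rightarrow> ('a, 'n) tensor \<Rightarrow> ('a, 'n) tensor) \<Rightarrow> ('a \<Rightarrow> ('a, 'n) tensor) \<Rightarrow> real \<Rightarrow>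
      ('a, 'n) chart \<Rightarrow> 'n list \<Rightarrow> 'n list \<Rightarrow> real \<Rightarrow> real" where
  "quotient S T s c us ls \<equiv> (\<lambda>\<epsilon>. 1 / \<epsilon> * (S (s + \<epsilon>) s (T (\<gamma> (s + \<epsilon>))) c us ls - T (\<gamma> s) c us ls))"

lemma has_vector_derivative_shift:
  fixes f :: "real \<Rightarrow> real"
  assumes "(f has_vector_derivative d) (at s within J)"
  shows "((\<lambda>\<epsilon>. 1 / \<epsilon> * (f (s + \<epsilon>) - f s)) \<longlongrightarrow> d) (at 0 within {\<epsilon>. s + \<epsilon> \<in> J})"
proof -
  have "((\<lambda>y. (f y - f s) / (y - s)) \<longlongrightarrow> d) (at s within J)"
    using assms by (simp add: has_field_derivative_iff flip: has_real_derivative_iff_has_vector_derivative)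
  moreover have "filterlim (\<lambda>\<epsilon>. s + \<epsilon>) (at s within J) (at 0 within {\<epsilon>. s + \<epsilon> \<in> J})"
    unfolding filterlim_at
    by (auto simp: eventually_at_filter intro!: tendsto_eq_intros)
  ultimately have "((\<lambda>\<epsilon>. (f (s + \<epsilon>) - f s) / (s + \<epsilon> - s)) \<longlongrightarrow> d) (at 0 within {\<epsilon>. s + \<epsilon> \<in> J})"
    by (rule filterlim_compose)
  then show ?thesis by simp
qed

text \<open>
  The transported tensor at \<open>\<gamma> s\<close> has the frame components of \<open>T\<close> at \<open>s + \<epsilon>\<close>.  The difference quotient
  is thus a fixed linear map, the return from frame components at \<open>s\<close>, applied to a difference
  quotient of real functions.
\<close>

lemma frame_transport_limit:
  assumes \<Psi>: "C1_coframe \<Psi>" and T: "T \<in> fields p q" and s: "s \<in> J" and c: "c \<in> \<A>" "\<gamma> s \<in> fst c"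
  shows "(quotient (frame_transport \<Psi>) T s c us ls \<longlongrightarrow> nabla \<Psi> T s c us ls) (at 0 within {\<epsilon>. s + \<epsilon> \<in> J})"
proof -
  have inv: "invertible (\<Psi> s)" using \<Psi> s by (auto simp: C1_coframe_def)
  have "((\<lambda>t. from_frame \<Psi> s (comps \<Psi> t (T (\<gamma> t))) c us ls) has_vector_derivative nabla \<Psi> T s c us ls) (at s within J)"
    unfolding nabla_def from_frame_in_chart[of \<Psi> s, OF inv c]
    by (intro has_vector_derivative_act comps_vector_derivative(1)[OF \<Psi> T s])
  from has_vector_derivative_shift[OF this] show ?thesis
    unfolding frame_transport_def from_frame_comps[of \<Psi> s, OF inv fieldD(1)[OF T s]] .
qed

lemma generates_iff:
  assumes \<Psi>: "C1_coframe \<Psi>"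
    and S: "\<And>s t p q A. s \<in> J \<Longrightarrow> t \<in> J \<Longrightarrow> A \<in> tensors p q s \<Longrightarrow> S s t A = frame_transport \<Psi> s t A"
  shows "generates \<A> J \<gamma> S D \<longleftrightarrow>
    (\<forall>p q. \<forall>T\<in>fields p q. \<forall>s\<in>J. \<forall>c\<in>\<A>. \<gamma> s \<in> fst c \<longrightarrow> D T (\<gamma> s) c = nabla \<Psi> T s c)"
proof -
  have lim: "(quotient S T s c us ls \<longlongrightarrow> nabla \<Psi> T s c us ls) (at 0 within {\<epsilon>. s + \<epsilon> \<in> J})"
    if "T \<in> fields p q" "s \<in> J" "c \<in> \<A>" "\<gamma> s \<in> fst c" for p q T s c us ls
  proof (rule Lim_transform_eventually[OF frame_transport_limit[OF \<Psi> that]])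
    show "\<forall>\<^sub>F \<epsilon> in at 0 within {\<epsilon>. s + \<epsilon> \<in> J}.
        quotient (frame_transport \<Psi>) T s c us ls \<epsilon> = quotient S T s c us ls \<epsilon>"
      unfolding eventually_at_filter
      using S[OF _ \<open>s \<in> J\<close> fieldD(1)[OF that(1)]] by (intro always_eventually) auto
  qed
  have "(quotient S T s c us ls \<longlongrightarrow> x) (at 0 within {\<epsilon>. s + \<epsilon> \<in> J}) \<longleftrightarrow> x = nabla \<Psi> T s c us ls"
    if "T \<in> fields p q" "s \<in> J" "c \<in> \<A>" "\<gamma> s \<in> fst c" for p q T s c us ls x
    using lim[OF that] tendsto_unique[OF shift_nontrivial[OF that(2)]] by blast
  then show ?thesis
    unfolding generates_def fun_eq_iff by (intro all_cong1 ball_cong imp_cong refl) blast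
qed

section \<open>Every S-transport of class C1 comes from a coframe\<close>

text \<open>
  An S-transport acts on vectors by matrices \<open>N s t\<close> with \<open>N t r ** N s t = N s r\<close>.  Compatibility with
  products and contractions forces it to act on all other tensors by the corresponding change of basis.
  The coframe is \<open>\<Psi> s = N s s0\<close>, the transport to a fixed parameter, since
  \<open>N s t = N s0 t ** N s s0 = (\<Psi> t)\<^sup>-\<^sup>1 ** \<Psi> s\<close>.
\<close>

lemma S_transport_coframe:
  assumes S: "S_transport \<A> J \<gamma> S" and C1: "C1_transport \<A> J \<gamma> S"
  obtains \<Psi> where "C1_coframe \<Psi>"
    "\<And>s t p q A. s \<in> J \<Longrightarrow> t \<in> J \<Longrightarrow> A \<in> tensors p q s \<Longrightarrow> S s t A = frame_transport \<Psi> s t A"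
proof -
  have S_in: "S s t A \<in> tensors p q t"
    if "s \<in> J" "t \<in> J" "A \<in> tensors p q s" for s t p q A
    using S[unfolded S_transport_def, THEN conjunct1] that by blast
  have S_lin: "S s t (tensor_lin a A b B) = tensor_lin a (S s t A) b (S s t B)"
    if "s \<in> J" "t \<in> J" "A \<in> tensors p q s" "B \<in> tensors p q s" for s t p q A B a b
    by (rule S[unfolded S_transport_def, THEN conjunct2, THEN conjunct1, rule_format, OF that])
  have S_prod: "S s t (tensor_prod p q A B) = tensor_prod p q (S s t A) (S s t B)"
    if "s \<in> J" "t \<in> J" "A \<in> tensors p q s" "B \<in> tensors p' q' s" for s t p q p' q' A B
    by (rule S[unfolded S_transport_def, THEN conjunct2, THEN conjunct2, THEN conjunct1, rule_format, OF that])
  have S_contr: "S s t (contraction k l A) = contraction k l (S s t A)"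
    if "s \<in> J" "t \<in> J" "k \<le> p" "l \<le> q" "A \<in> tensors (Suc p) (Suc q) s" for s t p q k l A
    by (rule S[unfolded S_transport_def, THEN conjunct2, THEN conjunct2, THEN conjunct2, THEN conjunct1, rule_format, OF that])
  have S_comp: "S t r (S s t A) = S s r A"
    if "s \<in> J" "t \<in> J" "r \<in> J" "A \<in> tensors p q s" for r s t p q A
    by (rule S[unfolded S_transport_def, THEN conjunct2, THEN conjunct2, THEN conjunct2, THEN conjunct2, THEN conjunct1, rule_format, OF that(3,1,2,4)])
  have S_id: "S s s A = A" if "s \<in> J" "A \<in> tensors p q s" for s p q A
    by (rule S[unfolded S_transport_def, THEN conjunct2, THEN conjunct2, THEN conjunct2, THEN conjunct2, THEN conjunct2, rule_format, OF that])
  define vt where "vt s v = tensor_of (\<kappa> s) (\<gamma> s) (vec_arr v)" for s v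
  have vt_in: "vt s v \<in> tensors 1 0 s" for s v
    unfolding vt_def by (intro tensor_of_in_tensor_space chart_at has_type_vec_arr)
  have vt_\<kappa>: "vt s v (\<kappa> s) = vec_arr v" for s v by (simp add: vt_def chart_at)
  have vt_vec: "vt s (arr_vec (A (\<kappa> s))) = A" if "A \<in> tensors 1 0 s" for s A
    unfolding vt_def using that by (simp add: vec_arr_arr_vec[OF tensor_has_type] tensor_of_components chart_at)
  have vt_lin: "vt s (a *\<^sub>R v + b *\<^sub>R w) = tensor_lin a (vt s v) b (vt s w)" for s a v b w
    by (rule tensor_eqI[OF vt_in tensor_lin_in[OF vt_in vt_in] chart_at])
       (unfold vt_\<kappa> tensor_lin_def vec_arr_def, intro ext, simp)
  define m where "m s t v = arr_vec (S s t (vt s v) (\<kappa> t))" for s t v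
  have S_vt: "S s t (vt s v) = vt t (m s t v)" if "s \<in> J" "t \<in> J" for s t v
    using vt_vec[OF S_in[OF that vt_in]] by (simp add: m_def)
  have "linear (m s t)" if "s \<in> J" "t \<in> J" for s t
  proof -
    have "m s t (a *\<^sub>R v + b *\<^sub>R w) = a *\<^sub>R m s t v + b *\<^sub>R m s t w" for a v b w
      unfolding m_def vt_lin S_lin[OF that vt_in vt_in] by (simp add: vec_eq_iff arr_vec_def tensor_lin_def)
    from this[of 1 _ 1] this[of _ _ 0] show ?thesis by (intro linearI) auto
  qed
  define N where "N s t = matrix (m s t)" for s t
  have N: "m s t v = N s t *v v" if "s \<in> J" "t \<in> J" for s t v
    unfolding N_def using \<open>\<And>s t. s \<in> J \<Longrightarrow> t \<in> J \<Longrightarrow> linear (m s t)\<close>[OF that] by (simp add: matrix_works)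
  have vt_inj: "v = w" if "vt s v = vt s w" for s v w
    using that by (metis arr_vec_vec_arr vt_\<kappa>)
  have N_comp: "N t r ** N s t = N s r" if "s \<in> J" "t \<in> J" "r \<in> J" for r s t
  proof (rule matrix_eq_columns)
    fix j
    have "vt r (m t r (m s t (axis j 1))) = vt r (m s r (axis j 1))"
      using S_comp[OF that vt_in] that by (simp add: S_vt)
    then show "(N t r ** N s t) *v axis j 1 = N s r *v axis j 1"
      using vt_inj that by (simp add: N flip: matrix_vector_mul_assoc)
  qed
  have N_id: "N s s = mat 1" if "s \<in> J" for s
  proof (rule matrix_eq_columns)
    fix j
    have "vt s (m s s (axis j 1)) = vt s (axis j 1)"
      using S_id[OF that vt_in] that by (simp flip: S_vt)
    then show "N s s *v axis j 1 = mat 1 *v axis j 1"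
      using vt_inj that by (simp add: N)
  qed
  have N_inv: "N t s ** N s t = mat 1" if "s \<in> J" "t \<in> J" for s t
    using N_comp N_id that by simp
  have agree: "S s t A (\<kappa> t) = act (N s t) (N t s) (A (\<kappa> s))"
    if st: "s \<in> J" "t \<in> J" and "A \<in> tensors p q s" for s t p q A
  proof -
    let ?act = "act (N s t) (N t s)"
    \<comment> \<open>The statement for a single type.  It is proved for scalars and vectors first, then for type \<open>(0, q)\<close>
      by induction on \<open>q\<close>, and finally, using covectors, for type \<open>(p, q)\<close> by induction on \<open>p\<close>.\<close>
    define ok where "ok p q \<longleftrightarrow> (\<forall>A \<in> tensors p q s. S s t A (\<kappa> t) = ?act (A (\<kappa> s)))" for p q
    have vec: "ok 1 0"
      unfolding ok_def
    proof
      fix A assume A: "A \<in> tensors 1 0 s"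
      let ?v = "arr_vec (A (\<kappa> s))"
      have "S s t A = vt t (N s t *v ?v)" using S_vt[OF st, of ?v] vt_vec[OF A] N[OF st] by simp
      then have "S s t A (\<kappa> t) = ?act (vec_arr ?v)" by (simp add: vt_\<kappa> act_vec_arr)
      then show "S s t A (\<kappa> t) = ?act (A (\<kappa> s))" by (simp add: vec_arr_arr_vec[OF tensor_has_type[OF A]])
    qed
    have preimage: "\<exists>B \<in> tensors p q s. ?act (B (\<kappa> s)) = X" if "has_type p q X" for p q X
    proof (intro bexI)
      show "tensor_of (\<kappa> s) (\<gamma> s) (act (N t s) (N s t) X) \<in> tensors p q s"
        by (intro tensor_of_in_tensor_space chart_at has_type_act that)
      show "?act (tensor_of (\<kappa> s) (\<gamma> s) (act (N t s) (N s t) X) (\<kappa> s)) = X"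
        using st by (simp add: chart_at act_act N_inv)
    qed
    \<comment> \<open>If \<open>A \<otimes> B\<close> contracts to a type that is already settled and \<open>B\<close> is settled too, then the transport
      of \<open>A\<close> is correct after contraction with the image of \<open>B\<close>; these images are arbitrary by
      \<open>preimage\<close>.\<close>
    have contr: "arr_contr p q (arr_prod p' q' (S s t A (\<kappa> t)) (?act (B (\<kappa> s)))) = arr_contr p q (arr_prod p' q' (?act (A (\<kappa> s))) (?act (B (\<kappa> s))))"
      if A: "A \<in> tensors p' q' s" and B: "B \<in> tensors i j s" and okB: "ok i j" and okpq: "ok p q"
        and t: "p' + i = Suc p" "q' + j = Suc q" for p q p' q' i j A B
    proof -
      let ?P = "tensor_prod p' q' A B"
      have P: "?P \<in> tensors (Suc p) (Suc q) s" using tensor_prod_in[OF A B] t by simp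
      have "contraction p q (tensor_prod p' q' (S s t A) (S s t B)) = S s t (contraction p q ?P)"
        by (simp add: S_prod[OF st A B] S_contr[OF st order.refl order.refl P])
      then have "arr_contr p q (arr_prod p' q' (S s t A (\<kappa> t)) (S s t B (\<kappa> t))) = S s t (contraction p q ?P) (\<kappa> t)"
        by (metis contraction_eq tensor_prod_eq)
      also have "\<dots> = ?act (contraction p q ?P (\<kappa> s))"
        using okpq contraction_in[OF P order.refl order.refl] unfolding ok_def by blast
      also have "\<dots> = arr_contr p q (arr_prod p' q' (?act (A (\<kappa> s))) (?act (B (\<kappa> s))))"
        by (simp add: contraction_eq tensor_prod_eq act_arr_contr act_arr_prod N_inv st)
      finally show ?thesis using okB B unfolding ok_def by simp
    qed
    have supp1: "has_type p q (S s t A (\<kappa> t))" "has_type p q (?act (A (\<kappa> s)))"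
      if "A \<in> tensors p q s" for A p q
      using that by (auto intro: tensor_has_type has_type_act S_in st)
    have lower: "ok p (Suc q)" if "ok p q" for p q
      unfolding ok_def
    proof
      fix A assume A: "A \<in> tensors p (Suc q) s"
      show "S s t A (\<kappa> t) = ?act (A (\<kappa> s))"
      proof (rule arr_eq_by_vectors[OF supp1[OF A]])
        fix j
        obtain B where B: "B \<in> tensors 1 0 s" "?act (B (\<kappa> s)) = vec_arr (axis j 1)"
          using preimage[OF has_type_vec_arr] by blast
        show "arr_contr p q (arr_prod p (Suc q) (S s t A (\<kappa> t)) (vec_arr (axis j 1))) =
            arr_contr p q (arr_prod p (Suc q) (?act (A (\<kappa> s))) (vec_arr (axis j 1)))"
          using contr[OF A B(1) vec that] B(2) by simp
      qed
    qed
    have upper: "ok (Suc p) q" if "ok p q" "ok 0 1" for p q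
      unfolding ok_def
    proof
      fix A assume A: "A \<in> tensors (Suc p) q s"
      show "S s t A (\<kappa> t) = ?act (A (\<kappa> s))"
      proof (rule arr_eq_by_covectors[OF supp1[OF A]])
        fix j
        obtain B where B: "B \<in> tensors 0 1 s" "?act (B (\<kappa> s)) = covec_arr (axis j 1)"
          using preimage[OF has_type_covec_arr] by blast
        show "arr_contr p q (arr_prod (Suc p) q (S s t A (\<kappa> t)) (covec_arr (axis j 1))) =
            arr_contr p q (arr_prod (Suc p) q (?act (A (\<kappa> s))) (covec_arr (axis j 1)))"
          using contr[OF A B(1) that(2,1)] B(2) by simp
      qed
    qed
    have "ok 0 0"
    proof -
      let ?u = "scalar_tensor \<A> (\<gamma> s) 1" and ?v = "vt s (axis undefined 1)"
      \<comment> \<open>The scalar \<open>1\<close> is transported to some scalar \<open>r\<close>.  Transporting \<open>1 \<otimes> v = v\<close> for a nonzero vector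
        \<open>v\<close> yields \<open>r = 1\<close>, as the transport of vectors is injective.\<close>
      define r where "r = S s t ?u (\<kappa> t) [] []"
      have u: "S s t ?u (\<kappa> t) = scalar_arr r"
        unfolding r_def by (rule scalar_arr_eq[symmetric, OF tensor_has_type[OF S_in[OF st scalar_tensor_in]]])
      have unit: "arr_prod 0 0 (scalar_arr a) B = (\<lambda>us ls. a * B us ls)" for a and B :: "'n arr"
        by (simp add: arr_prod_def scalar_arr_def)
      have "tensor_prod 0 0 ?u ?v = ?v"
      proof (rule tensor_eqI[OF _ vt_in chart_at])
        show "tensor_prod 0 0 ?u ?v \<in> tensors (0 + 1) (0 + 0) s"
          by (rule tensor_prod_in[OF scalar_tensor_in vt_in])
      qed (simp add: tensor_prod_eq scalar_tensor_eq chart_at unit)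
      then have "S s t ?v (\<kappa> t) = arr_prod 0 0 (scalar_arr r) (S s t ?v (\<kappa> t))"
        using S_prod[OF st scalar_tensor_in vt_in] u by (metis tensor_prod_eq)
      then have "arr_vec (S s t ?v (\<kappa> t)) = r *\<^sub>R arr_vec (S s t ?v (\<kappa> t))"
        unfolding unit by (auto simp: arr_vec_def vec_eq_iff fun_eq_iff)
      then have "(1 - r) *\<^sub>R (N s t *v axis undefined 1) = 0"
        using S_vt[OF st] N[OF st] by (simp add: vt_\<kappa> algebra_simps)
      moreover have "N s t *v axis undefined 1 \<noteq> 0"
      proof
        assume "N s t *v axis undefined 1 = 0"
        then have "N t s *v (N s t *v axis undefined 1) = 0" by simp
        then show False using N_inv[OF st] by (simp add: matrix_vector_mul_assoc axis_eq_0_iff)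
      qed
      ultimately have r: "r = 1" by simp
      show ?thesis
        unfolding ok_def
      proof
        fix A assume A: "A \<in> tensors 0 0 s"
        define a where "a = A (\<kappa> s) [] []"
        have a: "A (\<kappa> s) = scalar_arr a" unfolding a_def by (rule scalar_arr_eq[symmetric, OF tensor_has_type[OF A]])
        have "A = tensor_lin a ?u 0 ?u"
          by (rule tensor_eqI[OF A tensor_lin_in[OF scalar_tensor_in scalar_tensor_in] chart_at])
             (simp add: a tensor_lin_def scalar_tensor_eq chart_at, simp add: scalar_arr_def fun_eq_iff)
        then have "S s t A = tensor_lin a (S s t ?u) 0 (S s t ?u)"
          using S_lin[OF st scalar_tensor_in scalar_tensor_in] by metis
        then show "S s t A (\<kappa> t) = ?act (A (\<kappa> s))"
          using r by (simp add: a act_scalar has_type_scalar_arr tensor_lin_def u, simp add: scalar_arr_def fun_eq_iff)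
      qed
    qed
    then have covariant: "ok 0 q" for q by (induction q) (auto intro: lower)
    then have "ok p q" for p q
      by (induction p) (auto intro: upper simp del: One_nat_def)
    then show ?thesis using that(3) unfolding ok_def by blast
  qed
  obtain s0 where s0: "s0 \<in> J" using nondegenerate by blast
  define \<Psi> where "\<Psi> s = N s s0" for s
  have \<Psi>: "invertible (\<Psi> s)" "matrix_inv (\<Psi> s) = N s0 s" if "s \<in> J" for s
    using matrix_inv_unique[OF N_inv[OF s0 that]] by (auto simp: \<Psi>_def)
  have "C1_coframe \<Psi>"
  proof -
    obtain E H where E: "C1_basis_along \<A> J \<gamma> E" and H: "is_transport_matrix J E S H" and H1: "\<And>s. s \<in> J \<Longrightarrow> C1_on J (\<lambda>t. H t s)"
      using C1 unfolding C1_transport_def by blast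
    have E_in: "E s i \<in> tensors 1 0 s" if "s \<in> J" for s i
      using E that unfolding C1_basis_along_def by blast
    have E_C1: "C1_on (params c) (\<lambda>s. E s i c us ls)" if "c \<in> \<A>" for c i us ls
      using E that unfolding C1_basis_along_def by blast
    \<comment> \<open>\<open>M c s\<close> has the given C1 basis as its columns, in the chart \<open>c\<close>.  There, the inverse of the coframe is a
      C1 matrix \<open>M c s ** H s s0\<close> times a constant one, and inversion preserves C1.\<close>
    define M where "M c s = (\<chi> k i. E s i c [k] [])" for c s
    have M_col: "M c s *v axis i 1 = arr_vec (E s i c)" for c s i
      by (simp add: M_def vec_eq_iff matrix_vector_mult_def arr_vec_def sum_axis)
    have M_chart: "M c s = chart_jac (\<kappa> s) c (\<gamma> s) ** M (\<kappa> s) s" if "s \<in> params c" "c \<in> \<A>" for c s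
    proof (rule matrix_eq_columns)
      fix i
      have "E s i c = act (chart_jac (\<kappa> s) c (\<gamma> s)) (chart_jac c (\<kappa> s) (\<gamma> s)) (E s i (\<kappa> s))"
        using that by (intro tensor_change[OF E_in] chart_at) auto
      then have "arr_vec (E s i c) = chart_jac (\<kappa> s) c (\<gamma> s) *v arr_vec (E s i (\<kappa> s))"
        by (simp add: arr_vec_act)
      then show "M c s *v axis i 1 = (chart_jac (\<kappa> s) c (\<gamma> s) ** M (\<kappa> s) s) *v axis i 1"
        by (simp add: M_col flip: matrix_vector_mul_assoc)
    qed
    have "N s0 s ** M (\<kappa> s0) s0 = M (\<kappa> s) s ** H s s0" if "s \<in> J" for s
    proof (rule matrix_eq_columns)
      fix j
      have "arr_vec (S s0 s (E s0 j) (\<kappa> s)) = N s0 s *v arr_vec (E s0 j (\<kappa> s0))"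
        using agree[OF s0 that E_in[OF s0]] by (simp add: arr_vec_act)
      moreover have "S s0 s (E s0 j) = (\<lambda>c us ls. \<Sum>i\<in>UNIV. H s s0 $ i $ j * E s i c us ls)"
        using H s0 that unfolding is_transport_matrix_def by blast
      moreover have col: "H s s0 *v axis j 1 = (\<chi> i. H s s0 $ i $ j)"
        by (simp add: vec_eq_iff matrix_vector_mult_def sum_axis)
      ultimately have "N s0 s *v arr_vec (E s0 j (\<kappa> s0)) = M (\<kappa> s) s *v (H s s0 *v axis j 1)"
        unfolding col by (simp add: vec_eq_iff arr_vec_def M_def matrix_vector_mult_def mult.commute)
      then show "(N s0 s ** M (\<kappa> s0) s0) *v axis j 1 = (M (\<kappa> s) s ** H s s0) *v axis j 1"
        by (simp add: M_col flip: matrix_vector_mul_assoc)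
    qed note NM = this
    have "\<exists>X. M (\<kappa> s0) s0 ** X = mat 1"
    proof -
      have "\<exists>a. M (\<kappa> s0) s0 *v a = axis k 1" for k
      proof -
        obtain a :: "real^'n" where "vt s0 (axis k 1) = (\<lambda>c us ls. \<Sum>i\<in>UNIV. a $ i * E s0 i c us ls)"
          using E s0 vt_in unfolding C1_basis_along_def by meson
        then have "arr_vec (vt s0 (axis k 1) (\<kappa> s0)) = M (\<kappa> s0) s0 *v a"
          by (simp add: vec_eq_iff arr_vec_def M_def matrix_vector_mult_def mult.commute)
        then show ?thesis by (auto simp: vt_\<kappa>)
      qed
      then obtain a where a: "\<And>k. M (\<kappa> s0) s0 *v a k = axis k 1" by metis
      have "M (\<kappa> s0) s0 ** (\<chi> i k. a k $ i) = mat 1"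
      proof (rule matrix_eq_columns)
        fix k
        have "(\<chi> i k. a k $ i) *v axis k 1 = a k"
          by (simp add: vec_eq_iff matrix_vector_mult_def sum_axis)
        then show "(M (\<kappa> s0) s0 ** (\<chi> i k. a k $ i)) *v axis k 1 = mat 1 *v axis k 1"
          using a by (simp flip: matrix_vector_mul_assoc)
      qed
      then show ?thesis by blast
    qed
    then obtain X where X: "M (\<kappa> s0) s0 ** X = mat 1" by blast
    have N_eq: "N s0 s = M (\<kappa> s) s ** H s s0 ** X" if "s \<in> J" for s
      using NM[OF that] X by (metis matrix_mul_assoc matrix_mul_rid)
    show ?thesis
      unfolding C1_coframe_def
    proof (intro conjI ballI)
      fix c assume c: "c \<in> \<A>"
      let ?\<Phi> = "\<lambda>s. M c s ** H s s0 ** X"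
      have \<Phi>: "invertible (chart_coframe \<Psi> c s)" "?\<Phi> s = matrix_inv (chart_coframe \<Psi> c s)" if s: "s \<in> params c" for s
      proof -
        have "s \<in> J" "\<gamma> s \<in> fst c" using s by auto
        note inv = invertible_chart_coframe[of \<Psi> s c, OF \<Psi>(1)[OF this(1)] c this(2)]
        show "invertible (chart_coframe \<Psi> c s)" by (rule inv(1))
        have "?\<Phi> s = chart_jac (\<kappa> s) c (\<gamma> s) ** N s0 s"
          unfolding M_chart[OF s c] N_eq[OF \<open>s \<in> J\<close>] by (simp only: matrix_mul_assoc)
        then show "?\<Phi> s = matrix_inv (chart_coframe \<Psi> c s)"
          unfolding inv(2) \<Psi>(2)[OF \<open>s \<in> J\<close>] .
      qed
      have "C1_on (params c) (M c)"
        by (intro C1_on_vecI) (simp add: M_def E_C1[OF c])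
      then have "C1_on (params c) ?\<Phi>"
        by (intro C1_on_matrix_mult C1_on_const C1_on_subset[OF H1[OF s0]]) auto
      then have "C1_on (params c) (\<lambda>s. matrix_inv (?\<Phi> s))"
        by (rule C1_on_matrix_inv) (simp only: \<Phi> invertible_matrix_inv)
      moreover have "chart_coframe \<Psi> c s = matrix_inv (?\<Phi> s)" if "s \<in> params c" for s
        unfolding \<Phi>(2)[OF that]
        by (rule matrix_inv_unique(2)[symmetric, OF matrix_inv_works(2)[OF \<Phi>(1)[OF that]]])
      ultimately show "C1_on (params c) (chart_coframe \<Psi> c)"
        using C1_on_cong[of "params c" "chart_coframe \<Psi> c" "\<lambda>s. matrix_inv (?\<Phi> s)"] by blast
    qed (rule \<Psi>)
  qed
  moreover have "S s t A = frame_transport \<Psi> s t A" if "s \<in> J" "t \<in> J" "A \<in> tensors p q s" for s t p q A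
  proof (rule tensor_eqI[OF S_in[OF that] _ chart_at])
    show "frame_transport \<Psi> s t A \<in> tensors p q t"
      unfolding frame_transport_def by (intro from_frame_in has_type_comps that)
    have "N s0 t ** N s s0 = N s t" "N s0 s ** N t s0 = N t s" using N_comp s0 that by auto
    then show "S s t A (\<kappa> t) = frame_transport \<Psi> s t A (\<kappa> t)"
      using agree[OF that] that by (simp add: frame_transport_def from_frame_\<kappa> comps_def act_act \<Psi>, simp add: \<Psi>_def)
  qed
  ultimately show ?thesis using that by blast
qed


section \<open>Generated maps are derivations\<close>

text \<open>
  The generating limit fixes \<open>D T\<close> only in the charts around the points of the path.  Everywhere else
  the components of \<open>D T\<close> vanish because \<open>D T\<close> is a tensor field of some type; this type may
  differ from that of \<open>T\<close> only if \<open>D T\<close> is zero.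
\<close>

lemma derivation_if_generated:
  assumes S: "S_transport \<A> J \<gamma> S" "C1_transport \<A> J \<gamma> S" and gen: "generates \<A> J \<gamma> S D"
    and type: "\<And>p q T. T \<in> fields p q \<Longrightarrow> \<exists>p' q'. D T \<in> tensor_fields \<A> (\<gamma> ` J) p' q'"
  shows "derivation_along \<A> J \<gamma> D" "differentiates_functions_along \<A> J \<gamma> D" "maps_C1_to_C0_along \<A> J \<gamma> D"
proof -
  obtain \<Psi> where \<Psi>: "C1_coframe \<Psi>"
    and S_eq: "\<And>s t p q A. s \<in> J \<Longrightarrow> t \<in> J \<Longrightarrow> A \<in> tensors p q s \<Longrightarrow> S s t A = frame_transport \<Psi> s t A"
    by (rule S_transport_coframe[OF S], rule that)
  have D: "D T (\<gamma> s) = nabla \<Psi> T s" if T: "T \<in> fields p q" and s: "s \<in> J" for T p q s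
  proof -
    obtain p' q' where "D T \<in> tensor_fields \<A> (\<gamma> ` J) p' q'" using type[OF T] by blast
    then have "D T (\<gamma> s) \<in> tensors p' q' s" using s by (simp add: tensor_fields_def)
    moreover have "D T (\<gamma> s) (\<kappa> s) = nabla \<Psi> T s (\<kappa> s)"
      by (rule generates_iff[OF \<Psi>, THEN iffD1, OF _ gen, rule_format, OF _ T s chart_at]) (rule S_eq)
    ultimately show ?thesis using tensor_eqI[OF _ nabla_in[OF \<Psi> T s] chart_at] by blast
  qed
  have D0: "D T x = (\<lambda>c us ls. 0)" if T: "T \<in> fields p q" and x: "x \<notin> \<gamma> ` J" for T p q x
    using type[OF T] x by (auto simp: tensor_fields_def)
  have eqI: "D T = (\<lambda>x. X x)" if T: "T \<in> fields p q" and 1: "\<And>s. s \<in> J \<Longrightarrow> nabla \<Psi> T s = X (\<gamma> s)"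
    and 0: "\<And>x. x \<notin> \<gamma> ` J \<Longrightarrow> X x = (\<lambda>c us ls. 0)" for T p q X
  proof
    fix x show "D T x = X x"
      using D[OF T] 1 0 D0[OF T] by (cases "x \<in> \<gamma> ` J") auto
  qed
  have D_in: "D T \<in> tensor_fields \<A> (\<gamma> ` J) p q" if T: "T \<in> fields p q" for T p q
    using D0[OF T] D[OF T] nabla_in[OF \<Psi> T] by (auto simp: tensor_fields_def)
  show "derivation_along \<A> J \<gamma> D"
    unfolding derivation_along_def
  proof (intro conjI allI ballI impI)
    fix p q T assume "T \<in> fields p q"
    then show "D T \<in> tensor_fields \<A> (\<gamma> ` J) p q" by (rule D_in)
  next
    fix p q a b A B assume AB: "A \<in> fields p q" "B \<in> fields p q"
    show "D (\<lambda>x. tensor_lin a (A x) b (B x)) = (\<lambda>x. tensor_lin a (D A x) b (D B x))"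
    proof (rule eqI[OF field_lin[OF AB]])
      fix s assume s: "s \<in> J"
      show "nabla \<Psi> (\<lambda>x. tensor_lin a (A x) b (B x)) s = tensor_lin a (D A (\<gamma> s)) b (D B (\<gamma> s))"
        by (simp only: nabla_lin[OF \<Psi> AB s] D[OF AB(1) s] D[OF AB(2) s])
    qed (simp add: tensor_lin_def D0[OF AB(1)] D0[OF AB(2)])
  next
    fix p q k l A assume kl: "k \<le> p" "l \<le> q" and A: "A \<in> fields (Suc p) (Suc q)"
    show "D (\<lambda>x. contraction k l (A x)) = (\<lambda>x. contraction k l (D A x))"
    proof (rule eqI[OF field_contraction[OF A kl]])
      fix s assume s: "s \<in> J"
      show "nabla \<Psi> (\<lambda>x. contraction k l (A x)) s = contraction k l (D A (\<gamma> s))"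
        by (simp only: nabla_contraction[OF \<Psi> A kl s] D[OF A s])
    qed (simp add: contraction_def D0[OF A])
  next
    fix p q p' q' A B assume AB: "A \<in> fields p q" "B \<in> fields p' q'"
    show "D (\<lambda>x. tensor_prod p q (A x) (B x)) =
          (\<lambda>x. tensor_lin 1 (tensor_prod p q (D A x) (B x)) 1 (tensor_prod p q (A x) (D B x)))"
    proof (rule eqI[OF field_prod[OF AB]])
      fix s assume s: "s \<in> J"
      show "nabla \<Psi> (\<lambda>x. tensor_prod p q (A x) (B x)) s =
          tensor_lin 1 (tensor_prod p q (D A (\<gamma> s)) (B (\<gamma> s))) 1 (tensor_prod p q (A (\<gamma> s)) (D B (\<gamma> s)))"
        by (simp only: nabla_prod[OF \<Psi> AB s] D[OF AB(1) s] D[OF AB(2) s])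
    qed (simp add: tensor_prod_def tensor_lin_def D0[OF AB(1)] D0[OF AB(2)])
  qed
  show "differentiates_functions_along \<A> J \<gamma> D"
    unfolding differentiates_functions_along_def
    using D[OF scalar_field_in_fields] nabla_scalar[OF \<Psi>] by simp
  show "maps_C1_to_C0_along \<A> J \<gamma> D"
    unfolding maps_C1_to_C0_along_def C0_tensor_fields_def
  proof (intro allI ballI CollectI conjI)
    fix p q T c us ls assume T: "T \<in> fields p q" and c: "c \<in> \<A>"
    show "continuous_on (params c) (\<lambda>s. D T (\<gamma> s) c us ls)"
      by (rule continuous_on_eq[OF nabla_continuous[OF \<Psi> T c]]) (simp add: D[OF T])
  qed (rule D_in)
qed

end

section \<open>The transport of a derivation\<close>

locale derivation_curve = curve \<A> J \<gamma>
  for \<A> :: "('a::t2_space, 'n::finite) chart set" and J :: "real set" and \<gamma> :: "real \<Rightarrow> 'a" +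
  fixes D :: "('a \<Rightarrow> ('a, 'n) tensor) \<Rightarrow> ('a \<Rightarrow> ('a, 'n) tensor)"
  assumes derivation: "derivation_along \<A> J \<gamma> D"
    and on_functions: "differentiates_functions_along \<A> J \<gamma> D"
    and continuity: "maps_C1_to_C0_along \<A> J \<gamma> D"
begin

lemma D_in: "T \<in> fields p q \<Longrightarrow> s \<in> J \<Longrightarrow> D T (\<gamma> s) \<in> tensors p q s"
  using derivation[unfolded derivation_along_def, THEN conjunct1, rule_format, of T p q]
  by (simp add: tensor_fields_def)

lemma D_contraction:
  "k \<le> p \<Longrightarrow> l \<le> q \<Longrightarrow> A \<in> fields (Suc p) (Suc q) \<Longrightarrow>
    D (\<lambda>x. contraction k l (A x)) x = contraction k l (D A x)"
  using derivation[unfolded derivation_along_def, THEN conjunct2, THEN conjunct2, THEN conjunct1, rule_format, of k p l q A]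
  by simp

lemma D_prod:
  "A \<in> fields p q \<Longrightarrow> B \<in> fields p' q' \<Longrightarrow>
    D (\<lambda>x. tensor_prod p q (A x) (B x)) x =
      tensor_lin 1 (tensor_prod p q (D A x) (B x)) 1 (tensor_prod p q (A x) (D B x))"
  using derivation[unfolded derivation_along_def, THEN conjunct2, THEN conjunct2, THEN conjunct2, rule_format, of A p q B p' q']
  by simp

lemma D_continuous:
  "T \<in> fields p q \<Longrightarrow> c \<in> \<A> \<Longrightarrow> continuous_on (params c) (\<lambda>s. D T (\<gamma> s) c us ls)"
  using continuity unfolding maps_C1_to_C0_along_def C0_tensor_fields_def by blast

lemma has_vector_derivative_local:
  assumes "(f has_vector_derivative d) (at s within J)" and W: "open W" "s \<in> J" "\<gamma> s \<in> W"
    and "\<And>t. t \<in> J \<Longrightarrow> \<gamma> t \<in> W \<Longrightarrow> g t = f t"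
  shows "(g has_vector_derivative d) (at s within J)"
proof -
  have "(f has_vector_derivative d) (at s within {s \<in> J. \<gamma> s \<in> W})"
    using assms(1) by (simp add: at_within_pullback[OF W])
  then have "(g has_vector_derivative d) (at s within {s \<in> J. \<gamma> s \<in> W})"
    by (rule has_vector_derivative_transform[rotated 2]) (use assms in auto)
  then show ?thesis by (simp add: at_within_pullback[OF W])
qed

lemma D_function:
  assumes T: "T \<in> fields 0 0" and s: "s \<in> J" and c: "c \<in> \<A>" "\<gamma> s \<in> fst c"
  shows "((\<lambda>t. T (\<gamma> t) c [] []) has_vector_derivative D T (\<gamma> s) c [] []) (at s within J)"
proof -
  obtain f where f: "C1_on J (f \<circ> \<gamma>)" "T = scalar_field \<A> (\<gamma> ` J) f"
    using scalar_field_cases[OF T] by blast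
  obtain r where r: "((f \<circ> \<gamma>) has_vector_derivative r) (at s within J)"
    using f(1) s unfolding C1_on_def by blast
  then have "D T (\<gamma> s) = scalar_tensor \<A> (\<gamma> s) r"
    using on_functions f s unfolding differentiates_functions_along_def
    by (simp add: has_real_derivative_iff_has_vector_derivative)
  then have "D T (\<gamma> s) c [] [] = r" using c by (simp add: scalar_tensor_def)
  then show ?thesis
    using has_vector_derivative_local[OF r chart_homeomorphism(1)[OF c(1)] s c(2)] c(1)
    by (simp add: f(2) scalar_field_def scalar_tensor_def)
qed

text \<open>
  The pairing of a vector field with a covector field is a function, on which \<open>D\<close> is known.  Hence the
  values of \<open>D\<close> on vector fields and on covector fields determine each other.
\<close>

lemma D_pairing:
  assumes V: "V \<in> fields 1 0" and \<theta>: "\<theta> \<in> fields 0 1" and s: "s \<in> J" and c: "c \<in> \<A>" "\<gamma> s \<in> fst c"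
  shows "((\<lambda>t. pairing (V (\<gamma> t) c) (\<theta> (\<gamma> t) c)) has_vector_derivative
     pairing (D V (\<gamma> s) c) (\<theta> (\<gamma> s) c) + pairing (V (\<gamma> s) c) (D \<theta> (\<gamma> s) c)) (at s within J)"
proof -
  let ?P = "\<lambda>x. tensor_prod 1 0 (V x) (\<theta> x)"
  have P: "?P \<in> fields (Suc 0) (Suc 0)" using field_prod[OF V \<theta>] by simp
  have "D (\<lambda>x. contraction 0 0 (?P x)) (\<gamma> s) =
      contraction 0 0 (tensor_lin 1 (tensor_prod 1 0 (D V (\<gamma> s)) (\<theta> (\<gamma> s))) 1 (tensor_prod 1 0 (V (\<gamma> s)) (D \<theta> (\<gamma> s))))"
    by (simp only: D_contraction[OF order.refl order.refl P] D_prod[OF V \<theta>])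
  then show ?thesis
    using D_function[OF field_contraction[OF P order.refl order.refl] s c]
    by (simp add: contraction_def tensor_lin_def tensor_prod_def pairing_def sum.distrib)
qed

subsection \<open>Connection coefficients\<close>

text \<open>
  \<open>W\<close> is a region in which the fields \<open>E i\<close> are the coordinate vector fields of the chart \<open>c\<close>; the
  matrices \<open>\<Gamma> s\<close>, with columns \<open>D (E i)\<close>, are the connection coefficients of \<open>D\<close>.
\<close>

definition connection_on ::
    "('a, 'n) chart \<Rightarrow> 'a set \<Rightarrow> ('n \<Rightarrow> 'a \<Rightarrow> ('a, 'n) tensor) \<Rightarrow> (real \<Rightarrow> real^'n^'n) \<Rightarrow> bool" where
  "connection_on c W E \<Gamma> \<longleftrightarrow> open W \<and> W \<subseteq> fst c \<and>
     (\<forall>i. E i \<in> fields 1 0) \<and> (\<forall>i. \<forall>s\<in>J. \<gamma> s \<in> W \<longrightarrow> E i (\<gamma> s) c = vec_arr (axis i 1)) \<and>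
     continuous_on {s \<in> J. \<gamma> s \<in> W} \<Gamma> \<and>
     (\<forall>i. \<forall>s\<in>J. \<gamma> s \<in> W \<longrightarrow> arr_vec (D (E i) (\<gamma> s) c) = \<Gamma> s *v axis i 1) \<and>
     (\<forall>V\<in>fields 1 0. \<forall>s\<in>J. \<gamma> s \<in> W \<longrightarrow>
        ((\<lambda>t. arr_vec (V (\<gamma> t) c)) has_vector_derivative
           arr_vec (D V (\<gamma> s) c) - \<Gamma> s *v arr_vec (V (\<gamma> s) c)) (at s within J))"

text \<open>
  The formula \<open>D V = V' + \<Gamma> V\<close> comes from pairing with the coordinate covector fields \<open>\<theta> j\<close>.  The pairings
  of \<open>E i\<close> with \<open>\<theta> j\<close> are constant in \<open>W\<close>, so that \<open>D (\<theta> j)\<close> has the components \<open>- \<Gamma>\<^sub>j\<^sub>i\<close>; and pairing \<open>V\<close>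
  with \<open>\<theta> j\<close> singles out the component \<open>V\<^sub>j\<close>.
\<close>

lemma connection_exists:
  assumes c: "c \<in> \<A>" and x: "x \<in> fst c"
  obtains W E \<Gamma> where "x \<in> W" "connection_on c W E \<Gamma>"
proof -
  obtain W where W: "open W" "x \<in> W" "W \<subseteq> fst c"
    and loc: "\<And>p q B. has_type p q B \<Longrightarrow> \<exists>T \<in> fields p q. \<forall>s\<in>J. \<gamma> s \<in> W \<longrightarrow> T (\<gamma> s) c = B"
    by (rule local_fields[OF c x], rule that)
  have "\<forall>i. \<exists>T \<in> fields 1 0. \<forall>s\<in>J. \<gamma> s \<in> W \<longrightarrow> T (\<gamma> s) c = vec_arr (axis i 1)"
    using loc has_type_vec_arr by blast
  then obtain E where E: "\<And>i. E i \<in> fields 1 0" "\<And>i s. s \<in> J \<Longrightarrow> \<gamma> s \<in> W \<Longrightarrow> E i (\<gamma> s) c = vec_arr (axis i 1)"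
    by metis
  have "\<forall>i. \<exists>T \<in> fields 0 1. \<forall>s\<in>J. \<gamma> s \<in> W \<longrightarrow> T (\<gamma> s) c = covec_arr (axis i 1)"
    using loc has_type_covec_arr by blast
  then obtain \<theta> where \<theta>: "\<And>i. \<theta> i \<in> fields 0 1" "\<And>i s. s \<in> J \<Longrightarrow> \<gamma> s \<in> W \<Longrightarrow> \<theta> i (\<gamma> s) c = covec_arr (axis i 1)"
    by metis
  define \<Gamma> where "\<Gamma> s = (\<chi> j i. D (E i) (\<gamma> s) c [j] [])" for s
  have D\<theta>: "D (\<theta> j) (\<gamma> s) c [] [i] = - \<Gamma> s $ j $ i" if s: "s \<in> J" "\<gamma> s \<in> W" for s i j
  proof -
    have "\<gamma> s \<in> fst c" using W(3) s(2) by blast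
    from D_pairing[OF E(1) \<theta>(1) s(1) c this]
    have 1: "((\<lambda>t. pairing (E i (\<gamma> t) c) (\<theta> j (\<gamma> t) c)) has_vector_derivative
        \<Gamma> s $ j $ i + D (\<theta> j) (\<gamma> s) c [] [i]) (at s within J)"
      by (simp add: E(2) \<theta>(2) s pairing_axis \<Gamma>_def)
    have 2: "((\<lambda>t. pairing (E i (\<gamma> t) c) (\<theta> j (\<gamma> t) c)) has_vector_derivative 0) (at s within J)"
      by (rule has_vector_derivative_local[OF has_vector_derivative_const W(1) s])
         (simp only: E(2) \<theta>(2))
    have "\<Gamma> s $ j $ i + D (\<theta> j) (\<gamma> s) c [] [i] = 0"
      by (rule vector_derivative_unique_within[OF at_J_nontrivial[OF s(1)] 1 2])
    then show ?thesis by simp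
  qed
  have "connection_on c W E \<Gamma>"
    unfolding connection_on_def
  proof (intro conjI allI ballI impI W E)
    have "continuous_on {s \<in> J. \<gamma> s \<in> W} (\<lambda>s. D (E i) (\<gamma> s) c [j] [])" for i j
      by (rule continuous_on_subset[OF D_continuous[OF E(1) c]]) (use W(3) in auto)
    then show "continuous_on {s \<in> J. \<gamma> s \<in> W} \<Gamma>"
      unfolding \<Gamma>_def by (intro continuous_on_vec_lambda)
  next
    fix i s show "arr_vec (D (E i) (\<gamma> s) c) = \<Gamma> s *v axis i 1"
      by (simp add: vec_eq_iff arr_vec_def \<Gamma>_def matrix_vector_mult_def sum_axis)
  next
    fix V s assume V: "V \<in> fields 1 0" and s: "s \<in> J" "\<gamma> s \<in> W"
    show "((\<lambda>t. arr_vec (V (\<gamma> t) c)) has_vector_derivative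
           arr_vec (D V (\<gamma> s) c) - \<Gamma> s *v arr_vec (V (\<gamma> s) c)) (at s within J)"
    proof (rule has_vector_derivative_vecI)
      fix j
      have "\<gamma> s \<in> fst c" using W(3) s(2) by blast
      note D_pairing[OF V \<theta>(1) s(1) c this, of j]
      also have "pairing (D V (\<gamma> s) c) (\<theta> j (\<gamma> s) c) + pairing (V (\<gamma> s) c) (D (\<theta> j) (\<gamma> s) c) =
          (arr_vec (D V (\<gamma> s) c) - \<Gamma> s *v arr_vec (V (\<gamma> s) c)) $ j"
        by (simp add: \<theta>(2) s pairing_axis)
           (simp add: pairing_def D\<theta> s arr_vec_def matrix_vector_mult_def sum_negf mult.commute)
      finally show "((\<lambda>t. arr_vec (V (\<gamma> t) c) $ j) has_vector_derivative
          (arr_vec (D V (\<gamma> s) c) - \<Gamma> s *v arr_vec (V (\<gamma> s) c)) $ j) (at s within J)"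
        by (rule has_vector_derivative_local[OF _ W(1) s]) (simp add: \<theta>(2) pairing_axis arr_vec_def)
    qed
  qed
  then show ?thesis using that W(2) by blast
qed

subsection \<open>Parallel coframes\<close>

text \<open>
  The equation \<open>(\<Psi> V)' = \<Psi> (D V)\<close> for all vector fields \<open>V\<close>.  Tested on vector fields, the condition is
  independent of charts, so that solutions found in different charts can be glued.
\<close>

definition parallel :: "real set \<Rightarrow> (real \<Rightarrow> real^'n^'n) \<Rightarrow> bool" where
  "parallel I \<Psi> \<longleftrightarrow> (\<forall>s\<in>I. invertible (\<Psi> s)) \<and>
     (\<forall>V\<in>fields 1 0. \<forall>s\<in>I. ((\<lambda>t. \<Psi> t *v vec_at V t) has_vector_derivative
        \<Psi> s *v vec_at (D V) s) (at s within I))"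

lemma parallel_subset: "parallel I \<Psi> \<Longrightarrow> K \<subseteq> I \<Longrightarrow> parallel K \<Psi>"
  unfolding parallel_def by (meson has_vector_derivative_within_subset subsetD)

lemma parallel_left_mult:
  assumes "parallel I \<Psi>" "invertible Q"
  shows "parallel I (\<lambda>s. Q ** \<Psi> s)"
  unfolding parallel_def
proof (intro conjI ballI)
  fix V s assume "V \<in> fields 1 0" "s \<in> I"
  then have "((\<lambda>t. \<Psi> t *v vec_at V t) has_vector_derivative
        \<Psi> s *v vec_at (D V) s) (at s within I)"
    using assms(1) unfolding parallel_def by blast
  from bounded_linear.has_vector_derivative[OF matrix_vector_mul_bounded_linear[of Q] this]
  show "((\<lambda>t. (Q ** \<Psi> t) *v vec_at V t) has_vector_derivative
        (Q ** \<Psi> s) *v vec_at (D V) s) (at s within I)"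
    by (simp add: matrix_vector_mul_assoc)
qed (use assms in \<open>auto simp: parallel_def invertible_mult\<close>)

lemma chart_coframe_vec:
  assumes "c \<in> \<A>" "\<gamma> s \<in> fst c" "A \<in> tensors p q s"
  shows "\<Psi> s *v arr_vec (A (\<kappa> s)) = chart_coframe \<Psi> c s *v arr_vec (A c)"
proof -
  have "A (\<kappa> s) = act (chart_jac c (\<kappa> s) (\<gamma> s)) (chart_jac (\<kappa> s) c (\<gamma> s)) (A c)"
    by (rule tensor_change[OF assms(3,1) chart_at(1) assms(2) chart_at(2)])
  then show ?thesis by (simp add: arr_vec_act chart_coframe_def matrix_vector_mul_assoc)
qed

text \<open>
  For the coordinate fields \<open>E i\<close> the condition of being parallel is the differential equation
  \<open>\<Psi>' = \<Psi> \<Gamma>\<close>, column by column.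
\<close>

lemma parallel_ode:
  assumes par: "parallel I \<Psi>" and "I \<subseteq> J" and s: "s \<in> I" "\<gamma> s \<in> W" and c: "c \<in> \<A>"
    and con: "connection_on c W E \<Gamma>"
  shows "(chart_coframe \<Psi> c has_vector_derivative chart_coframe \<Psi> c s ** \<Gamma> s) (at s within I)"
proof (rule has_vector_derivative_columnsI)
  fix i
  have W: "open W" "W \<subseteq> fst c" and E: "E i \<in> fields 1 0" "\<And>s. s \<in> J \<Longrightarrow> \<gamma> s \<in> W \<Longrightarrow> E i (\<gamma> s) c = vec_arr (axis i 1)"
    "arr_vec (D (E i) (\<gamma> s) c) = \<Gamma> s *v axis i 1"
    using con s \<open>I \<subseteq> J\<close> unfolding connection_on_def by blast+
  obtain N where N: "open N" "{s \<in> J. \<gamma> s \<in> W} = J \<inter> N" by (rule open_pullback[OF W(1)])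
  have "s \<in> N" using N s \<open>I \<subseteq> J\<close> by blast
  have at: "at s within (I \<inter> N) = at s within I" by (rule at_within_Int_open[OF N(1) \<open>s \<in> N\<close>])
  have "((\<lambda>t. \<Psi> t *v vec_at (E i) t) has_vector_derivative
        \<Psi> s *v vec_at (D (E i)) s) (at s within I \<inter> N)"
    using par E(1) s unfolding parallel_def at by blast
  moreover have "\<Psi> s *v vec_at (D (E i)) s = (chart_coframe \<Psi> c s ** \<Gamma> s) *v axis i 1"
    using chart_coframe_vec[where s = s and \<Psi> = \<Psi>, OF c _ D_in[OF E(1)]] s \<open>I \<subseteq> J\<close> W(2) E(3)
    by (auto simp flip: matrix_vector_mul_assoc)
  moreover have "chart_coframe \<Psi> c t *v axis i 1 = \<Psi> t *v vec_at (E i) t" if "t \<in> I \<inter> N" for t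
  proof -
    have t: "t \<in> J" "\<gamma> t \<in> W" using that N(2) \<open>I \<subseteq> J\<close> by blast+
    then show ?thesis using chart_coframe_vec[where s = t and \<Psi> = \<Psi>, OF c _ fieldD(1)[OF E(1)]] W(2) E(2) by auto
  qed
  ultimately have "((\<lambda>t. chart_coframe \<Psi> c t *v axis i 1) has_vector_derivative (chart_coframe \<Psi> c s ** \<Gamma> s) *v axis i 1) (at s within I \<inter> N)"
    using s \<open>s \<in> N\<close> by (intro has_vector_derivative_transform[of s "I \<inter> N" "\<lambda>t. chart_coframe \<Psi> c t *v axis i 1" "\<lambda>t. \<Psi> t *v vec_at (E i) t"]) auto
  then show "((\<lambda>t. chart_coframe \<Psi> c t *v axis i 1) has_vector_derivative (chart_coframe \<Psi> c s ** \<Gamma> s) *v axis i 1) (at s within I)"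
    by (simp add: at)
qed

text \<open>
  If \<open>A' = A \<Gamma>\<close> and \<open>B' = B \<Gamma>\<close>, then \<open>(A B\<^sup>-\<^sup>1)' = A \<Gamma> B\<^sup>-\<^sup>1 - A B\<^sup>-\<^sup>1 (B \<Gamma>) B\<^sup>-\<^sup>1 = 0\<close>.  The quotient of two
  coframes does not depend on the chart, so it is constant on the whole interval.
\<close>

lemma parallel_unique:
  assumes par: "parallel I \<Psi>" "parallel I \<Psi>'" and I: "I \<subseteq> J" "convex I"
  obtains Q where "\<And>s. s \<in> I \<Longrightarrow> \<Psi> s ** matrix_inv (\<Psi>' s) = Q"
proof (rule has_vector_derivative_zero_constant[OF I(2)])
  fix s assume s: "s \<in> I"
  let ?c = "\<kappa> s"
  have inv: "invertible (\<Psi> t)" "invertible (\<Psi>' t)" if "t \<in> I" for t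
    using par that by (auto simp: parallel_def)
  obtain W E \<Gamma> where W: "\<gamma> s \<in> W" and con: "connection_on ?c W E \<Gamma>"
    by (rule connection_exists[OF chart_at])
  have Wo: "open W" "W \<subseteq> fst ?c" using con by (auto simp: connection_on_def)
  obtain N where N: "open N" "{s \<in> J. \<gamma> s \<in> W} = J \<inter> N" by (rule open_pullback[OF Wo(1)])
  have sN: "s \<in> I \<inter> N" using N s I W by blast
  have at: "at s within (I \<inter> N) = at s within I" using at_within_Int_open[OF N(1)] sN by blast
  have in_c: "\<gamma> t \<in> fst ?c" if "t \<in> I \<inter> N" for t using that N(2) I(1) Wo(2) by blast
  let ?A = "chart_coframe \<Psi> ?c" and ?B = "chart_coframe \<Psi>' ?c"
  have B: "invertible (?B t)" if "t \<in> I \<inter> N" for t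
    using invertible_chart_coframe(1)[of \<Psi>' t ?c] inv that in_c chart_at(1) by blast
  have dA: "(?A has_vector_derivative ?A s ** \<Gamma> s) (at s within I \<inter> N)"
    unfolding at by (rule parallel_ode[OF par(1) I(1) s W chart_at(1) con])
  have dB: "(?B has_vector_derivative ?B s ** \<Gamma> s) (at s within I \<inter> N)"
    unfolding at by (rule parallel_ode[OF par(2) I(1) s W chart_at(1) con])
  have "((\<lambda>t. ?A t ** matrix_inv (?B t)) has_vector_derivative
      ?A s ** (- (matrix_inv (?B s) ** (?B s ** \<Gamma> s) ** matrix_inv (?B s))) + (?A s ** \<Gamma> s) ** matrix_inv (?B s)) (at s within I \<inter> N)"
    by (rule bounded_bilinear.has_vector_derivative[OF bounded_bilinear_matrix_mult dA
         has_vector_derivative_matrix_inv[OF dB sN B]])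
  moreover have "?A s ** (- (matrix_inv (?B s) ** (?B s ** \<Gamma> s) ** matrix_inv (?B s))) + (?A s ** \<Gamma> s) ** matrix_inv (?B s) = 0"
    using matrix_inv_works(2)[OF B[OF sN]]
    by (simp add: bounded_bilinear.minus_right[OF bounded_bilinear_matrix_mult] matrix_mul_assoc)
  ultimately have d0: "((\<lambda>t. ?A t ** matrix_inv (?B t)) has_vector_derivative 0) (at s within I \<inter> N)" by simp
  have "\<Psi> t ** matrix_inv (\<Psi>' t) = ?A t ** matrix_inv (?B t)" if "t \<in> I \<inter> N" for t
  proof -
    have t: "t \<in> I" using that by blast
    note i = invertible_chart_coframe(2)[of \<Psi>' t, OF inv(2)[OF t] chart_at(1) in_c[OF that]]
    have "?A t ** matrix_inv (?B t) = ?A t ** (chart_jac (\<kappa> t) ?c (\<gamma> t) ** matrix_inv (\<Psi>' t))"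
      by (simp only: i)
    also have "\<dots> = \<Psi> t ** (chart_jac ?c (\<kappa> t) (\<gamma> t) ** chart_jac (\<kappa> t) ?c (\<gamma> t)) ** matrix_inv (\<Psi>' t)"
      by (simp only: chart_coframe_def matrix_mul_assoc)
    finally have "?A t ** matrix_inv (?B t) = \<Psi> t ** (chart_jac ?c (\<kappa> t) (\<gamma> t) ** chart_jac (\<kappa> t) ?c (\<gamma> t)) ** matrix_inv (\<Psi>' t)" .
    then show ?thesis
      using chart_jac_inverse[OF chart_at(1) chart_at(1) chart_at(2) in_c[OF that]] by simp
  qed
  then have "((\<lambda>t. \<Psi> t ** matrix_inv (\<Psi>' t)) has_vector_derivative 0) (at s within I \<inter> N)"
    by (rule has_vector_derivative_transform[OF sN _ d0])
  then show "((\<lambda>t. \<Psi> t ** matrix_inv (\<Psi>' t)) has_vector_derivative 0) (at s within I)" by (simp add: at)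
qed (rule that)

text \<open>
  A solution \<open>Y\<close> of the differential equation in the chart \<open>c\<close> becomes a coframe in the selected charts
  through the Jacobians.  It is parallel by the Leibniz rule:
  \<open>(Y V)' = Y (D V - \<Gamma> V) + Y \<Gamma> V = Y (D V)\<close>.
\<close>

lemma parallel_local:
  assumes ab: "{a..b} \<subseteq> J" and x: "x \<in> {a..b}"
  obtains \<delta> \<Psi> where "\<delta> > 0" "parallel {s \<in> {a..b}. \<bar>s - x\<bar> < \<delta>} \<Psi>"
proof -
  let ?c = "\<kappa> x"
  obtain W E \<Gamma> where W: "\<gamma> x \<in> W" and con: "connection_on ?c W E \<Gamma>"
    by (rule connection_exists[OF chart_at])
  have Wo: "open W" "W \<subseteq> fst ?c" and \<Gamma>: "continuous_on {s \<in> J. \<gamma> s \<in> W} \<Gamma>"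
    and dV: "\<And>V s. V \<in> fields 1 0 \<Longrightarrow> s \<in> J \<Longrightarrow> \<gamma> s \<in> W \<Longrightarrow>
        ((\<lambda>t. arr_vec (V (\<gamma> t) ?c)) has_vector_derivative
           arr_vec (D V (\<gamma> s) ?c) - \<Gamma> s *v arr_vec (V (\<gamma> s) ?c)) (at s within J)"
    using con unfolding connection_on_def by blast+
  obtain N where N: "open N" "{s \<in> J. \<gamma> s \<in> W} = J \<inter> N" by (rule open_pullback[OF Wo(1)])
  have "x \<in> N" using N x ab W by blast
  then obtain e where e: "e > 0" "cball x e \<subseteq> N" using N(1) open_contains_cball by blast
  define l u where "l = max a (x - e)" and "u = min b (x + e)"
  have lu: "{l..u} = {a..b} \<inter> cball x e" by (auto simp: l_def u_def cball_def dist_real_def)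
  have lu_sub: "{l..u} \<subseteq> {s \<in> J. \<gamma> s \<in> W}" using lu e(2) ab N(2) by blast
  have xlu: "x \<in> {l..u}" using x e(1) by (simp add: lu)
  obtain \<delta> and Y :: "real \<Rightarrow> real^'n^'n" where \<delta>: "\<delta> > 0"
    and Y: "\<And>t. t \<in> {l..u} \<Longrightarrow> \<bar>t - x\<bar> < \<delta> \<Longrightarrow> invertible (Y t)"
    "\<And>t. t \<in> {l..u} \<Longrightarrow> \<bar>t - x\<bar> < \<delta> \<Longrightarrow> (Y has_vector_derivative Y t ** \<Gamma> t) (at t within {l..u})"
    by (rule linear_ode_near[OF xlu continuous_on_subset[OF \<Gamma> lu_sub]], rule that)
  define \<Psi> where "\<Psi> s = Y s ** chart_jac (\<kappa> s) ?c (\<gamma> s)" for s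
  have in_c: "\<gamma> s \<in> fst ?c" "s \<in> J" "\<gamma> s \<in> W" if "s \<in> {l..u}" for s
    using that lu_sub Wo(2) by blast+
  have chart_coframe: "chart_coframe \<Psi> ?c s = Y s" if "s \<in> {l..u}" for s
    using chart_jac_inverse[OF chart_at(1) chart_at(1) in_c(1)[OF that] chart_at(2)]
    by (simp add: chart_coframe_def \<Psi>_def flip: matrix_mul_assoc)
  let ?I = "{s \<in> {a..b}. \<bar>s - x\<bar> < min \<delta> e}"
  have I: "?I \<subseteq> {l..u}" unfolding lu by (auto simp: dist_real_def abs_minus_commute)
  have "parallel ?I \<Psi>"
    unfolding parallel_def
  proof (intro conjI ballI)
    fix s assume "s \<in> ?I"
    then have "s \<in> {l..u}" "\<bar>s - x\<bar> < \<delta>" using I by auto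
    then show "invertible (\<Psi> s)"
      unfolding \<Psi>_def by (intro invertible_mult Y invertible_chart_jac chart_at in_c)
  next
    fix V s assume V: "V \<in> fields 1 0" and "s \<in> ?I"
    then have s: "s \<in> {l..u}" "\<bar>s - x\<bar> < \<delta>" using I by auto
    have dv: "((\<lambda>t. arr_vec (V (\<gamma> t) ?c)) has_vector_derivative
           arr_vec (D V (\<gamma> s) ?c) - \<Gamma> s *v arr_vec (V (\<gamma> s) ?c)) (at s within {l..u})"
      by (rule has_vector_derivative_within_subset[OF dV[OF V in_c(2,3)[OF s(1)]]]) (use in_c(2) in auto)
    have "((\<lambda>t. Y t *v arr_vec (V (\<gamma> t) ?c)) has_vector_derivative
        Y s *v (arr_vec (D V (\<gamma> s) ?c) - \<Gamma> s *v arr_vec (V (\<gamma> s) ?c)) + (Y s ** \<Gamma> s) *v arr_vec (V (\<gamma> s) ?c)) (at s within {l..u})"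
      by (rule bounded_bilinear.has_vector_derivative[OF bounded_bilinear_matrix_vector_mult Y(2)[OF s] dv])
    then have "((\<lambda>t. Y t *v arr_vec (V (\<gamma> t) ?c)) has_vector_derivative Y s *v arr_vec (D V (\<gamma> s) ?c)) (at s within {l..u})"
      by (simp add: matrix_vector_mult_diff_distrib matrix_vector_mul_assoc)
    moreover have "Y s *v arr_vec (D V (\<gamma> s) ?c) = \<Psi> s *v vec_at (D V) s"
      unfolding chart_coframe_vec[OF chart_at(1) in_c(1)[OF s(1)] D_in[OF V in_c(2)[OF s(1)]]] chart_coframe[OF s(1)] ..
    ultimately have "((\<lambda>t. Y t *v arr_vec (V (\<gamma> t) ?c)) has_vector_derivative \<Psi> s *v vec_at (D V) s) (at s within {l..u})"
      by simp
    then have "((\<lambda>t. \<Psi> t *v vec_at V t) has_vector_derivative \<Psi> s *v vec_at (D V) s) (at s within {l..u})"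
    proof (rule has_vector_derivative_transform[OF s(1), rotated])
      fix t assume t: "t \<in> {l..u}"
      show "\<Psi> t *v vec_at V t = Y t *v arr_vec (V (\<gamma> t) ?c)"
        unfolding chart_coframe_vec[OF chart_at(1) in_c(1)[OF t] fieldD(1)[OF V in_c(2)[OF t]]] chart_coframe[OF t] ..
    qed
    then show "((\<lambda>t. \<Psi> t *v vec_at V t) has_vector_derivative \<Psi> s *v vec_at (D V) s) (at s within ?I)"
      using I by (rule has_vector_derivative_within_subset)
  qed
  then show ?thesis using that[of "min \<delta> e" \<Psi>] \<delta> e(1) by simp
qed

text \<open>
  A constant matrix on the left makes the second coframe agree with the first at the common end point
  \<open>b\<close>; then the one-sided derivatives at \<open>b\<close> agree as well.
\<close>

lemma parallel_join:
  assumes par: "parallel {a..b} \<Psi>" "parallel {b..c} \<Psi>'" and le: "a \<le> b" "b \<le> c"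
  obtains \<Phi> where "parallel {a..c} \<Phi>"
proof -
  have inv: "invertible (\<Psi> b)" "invertible (\<Psi>' b)" using par le by (auto simp: parallel_def)
  define Q where "Q = \<Psi> b ** matrix_inv (\<Psi>' b)"
  have Qb: "Q ** \<Psi>' b = \<Psi> b"
    using inv by (simp add: Q_def matrix_inv_works flip: matrix_mul_assoc)
  have "invertible Q" unfolding Q_def by (intro invertible_mult invertible_matrix_inv inv)
  then have par': "parallel {b..c} (\<lambda>s. Q ** \<Psi>' s)" by (rule parallel_left_mult[OF par(2)])
  define \<Phi> where "\<Phi> s = (if s \<in> {a..b} then \<Psi> s else Q ** \<Psi>' s)" for s
  have "parallel {a..c} \<Phi>"
    unfolding parallel_def
  proof (intro conjI ballI)
    fix s assume "s \<in> {a..c}"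
    then show "invertible (\<Phi> s)" using par(1) par' by (auto simp: \<Phi>_def parallel_def)
  next
    fix V s assume V: "V \<in> fields 1 0" and s: "s \<in> {a..c}"
    let ?v = "\<lambda>t. vec_at V t" and ?w = "\<lambda>t. vec_at (D V) t"
    have U: "{a..c} = {a..b} \<union> {b..c}" "{a..b} \<union> {a..b} \<inter> {b..c} = {a..b}" "{b..c} \<union> {a..b} \<inter> {b..c} = {b..c}"
      using le by auto
    have "((\<lambda>t. if t \<in> {a..b} then \<Psi> t *v ?v t else (Q ** \<Psi>' t) *v ?v t) has_vector_derivative
        (if s \<in> {a..b} then \<Psi> s *v ?w s else (Q ** \<Psi>' s) *v ?w s)) (at s within {a..c})"
    proof (rule has_vector_derivative_If_within_closures[where T = "{b..c}" and f' = "\<lambda>s. \<Psi> s *v ?w s" and g' = "\<lambda>s. (Q ** \<Psi>' s) *v ?w s"])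
      show "s \<in> {a..b} \<union> {b..c}" "{a..c} = {a..b} \<union> {b..c}" using s U by auto
      show "((\<lambda>t. \<Psi> t *v ?v t) has_vector_derivative \<Psi> s *v ?w s) (at s within {a..b} \<union> closure {a..b} \<inter> closure {b..c})"
        if "s \<in> {a..b} \<union> closure {a..b} \<inter> closure {b..c}"
        using that par(1) V unfolding closure_closed[OF closed_atLeastAtMost] U(2) parallel_def by blast
      show "((\<lambda>t. (Q ** \<Psi>' t) *v ?v t) has_vector_derivative (Q ** \<Psi>' s) *v ?w s) (at s within {b..c} \<union> closure {a..b} \<inter> closure {b..c})"
        if "s \<in> {b..c} \<union> closure {a..b} \<inter> closure {b..c}"
        using that par' V unfolding closure_closed[OF closed_atLeastAtMost] U(3) parallel_def by blast
      assume "s \<in> closure {a..b}" "s \<in> closure {b..c}"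
      then have "s = b" by simp
      then show "\<Psi> s *v ?v s = (Q ** \<Psi>' s) *v ?v s" "\<Psi> s *v ?w s = (Q ** \<Psi>' s) *v ?w s"
        by (simp_all add: Qb)
    qed
    moreover have "(if t \<in> {a..b} then \<Psi> t *v x else (Q ** \<Psi>' t) *v x) = \<Phi> t *v x" for t x
      by (simp add: \<Phi>_def)
    ultimately show "((\<lambda>t. \<Phi> t *v ?v t) has_vector_derivative \<Phi> s *v ?w s) (at s within {a..c})"
      by (simp only:)
  qed
  then show ?thesis by (rule that)
qed

lemma parallel_compact:
  assumes "a \<le> b" and ab: "{a..b} \<subseteq> J"
  shows "\<exists>\<Psi>. parallel {a..b} \<Psi>"
proof -
  have "a \<le> a \<longrightarrow> b \<le> b \<longrightarrow> (\<exists>\<Psi>. parallel {a..b} \<Psi>)"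
  proof (rule Bolzano[OF assms(1), where P = "\<lambda>c d. a \<le> c \<longrightarrow> d \<le> b \<longrightarrow> (\<exists>\<Psi>. parallel {c..d} \<Psi>)"])
    fix x y z
    assume 1: "a \<le> x \<longrightarrow> y \<le> b \<longrightarrow> (\<exists>\<Psi>. parallel {x..y} \<Psi>)" and 2: "a \<le> y \<longrightarrow> z \<le> b \<longrightarrow> (\<exists>\<Psi>. parallel {y..z} \<Psi>)"
      and le: "x \<le> y" "y \<le> z"
    show "a \<le> x \<longrightarrow> z \<le> b \<longrightarrow> (\<exists>\<Psi>. parallel {x..z} \<Psi>)"
    proof (intro impI)
      assume "a \<le> x" "z \<le> b"
      then have "y \<le> b" "a \<le> y" using le by auto
      then obtain \<Psi> \<Psi>' where "parallel {x..y} \<Psi>" "parallel {y..z} \<Psi>'"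
        using 1 2 \<open>a \<le> x\<close> \<open>z \<le> b\<close> by blast
      then show "\<exists>\<Psi>. parallel {x..z} \<Psi>" using parallel_join[OF _ _ le] by blast
    qed
  next
    fix x assume "a \<le> x" "x \<le> b"
    then have "x \<in> {a..b}" by simp
    then obtain \<delta> \<Psi> where \<delta>: "\<delta> > 0" and par: "parallel {s \<in> {a..b}. \<bar>s - x\<bar> < \<delta>} \<Psi>"
      by (rule parallel_local[OF ab])
    show "\<exists>d>0. \<forall>c e. c \<le> x \<and> x \<le> e \<and> e - c < d \<longrightarrow> a \<le> c \<longrightarrow> e \<le> b \<longrightarrow> (\<exists>\<Psi>. parallel {c..e} \<Psi>)"
    proof (intro exI[of _ \<delta>] conjI allI impI \<delta>)
      fix c e assume h: "c \<le> x \<and> x \<le> e \<and> e - c < \<delta>" "a \<le> c" "e \<le> b"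
      have "{c..e} \<subseteq> {s \<in> {a..b}. \<bar>s - x\<bar> < \<delta>}" using h by (auto simp: abs_less_iff)
      then show "\<exists>\<Psi>. parallel {c..e} \<Psi>" by (intro exI[of _ \<Psi>] parallel_subset[OF par])
    qed
  qed
  then show ?thesis by simp
qed

text \<open>
  \<open>J\<close> need not be compact.  The coframes on the compact intervals around \<open>s0\<close> are normalized to be the
  unit matrix at \<open>s0\<close>; by uniqueness they then extend each other.
\<close>

lemma parallel_exists: "\<exists>\<Psi>. parallel J \<Psi>"
proof -
  obtain s0 where s0: "s0 \<in> J" using nondegenerate by blast
  define R where "R a b \<Phi> \<longleftrightarrow> parallel {a..b} \<Phi> \<and> \<Phi> s0 = mat 1" for a b \<Phi>
  have sub: "{a..b} \<subseteq> J" if "a \<in> J" "b \<in> J" for a b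
    using mem_is_interval_1_I[OF interval that] by auto
  have R_ex: "\<exists>\<Phi>. R a b \<Phi>" if ab: "a \<in> J" "b \<in> J" "a \<le> s0" "s0 \<le> b" for a b
  proof -
    obtain \<Psi> where par: "parallel {a..b} \<Psi>"
      using parallel_compact[OF order.trans[OF ab(3,4)] sub[OF ab(1,2)]] by blast
    have i: "invertible (\<Psi> s0)" using par ab by (simp add: parallel_def)
    have "R a b (\<lambda>s. matrix_inv (\<Psi> s0) ** \<Psi> s)"
      unfolding R_def using i by (simp add: parallel_left_mult[OF par invertible_matrix_inv] matrix_inv_works)
    then show ?thesis by blast
  qed
  have R_unique: "\<Phi> s = \<Phi>' s" if R: "R a b \<Phi>" "R a b \<Phi>'" and ab: "a \<in> J" "b \<in> J" "a \<le> s0" "s0 \<le> b" and s: "s \<in> {a..b}" for a b \<Phi> \<Phi>' s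
  proof -
    have par: "parallel {a..b} \<Phi>" "parallel {a..b} \<Phi>'" and 1: "\<Phi> s0 = mat 1" "\<Phi>' s0 = mat 1" using R by (auto simp: R_def)
    obtain Q where Q: "\<And>s. s \<in> {a..b} \<Longrightarrow> \<Phi> s ** matrix_inv (\<Phi>' s) = Q"
      by (rule parallel_unique[OF par sub[OF ab(1,2)]]) auto
    have "matrix_inv (mat 1 :: real^'n^'n) = mat 1" by (rule matrix_inv_unique) simp
    then have "Q = mat 1" using Q[of s0] ab 1 by simp
    moreover have "invertible (\<Phi>' s)" using par(2) s by (simp add: parallel_def)
    ultimately show ?thesis
      using Q[OF s] matrix_inv_works(2)[of "\<Phi>' s"] by (metis matrix_mul_assoc matrix_mul_lid matrix_mul_rid)
  qed
  define F where "F a b = (SOME \<Phi>. R a b \<Phi>)" for a b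
  have F: "R a b (F a b)" if "a \<in> J" "b \<in> J" "a \<le> s0" "s0 \<le> b" for a b
    unfolding F_def using someI_ex[OF R_ex[OF that]] .
  define \<Psi> where "\<Psi> s = F (min s s0) (max s s0) s" for s
  have \<Psi>F: "\<Psi> s = F a b s" if "a \<in> J" "b \<in> J" "a \<le> s0" "s0 \<le> b" "s \<in> {a..b}" for a b s
  proof -
    have "s \<in> J" using sub that by blast
    then have m: "min s s0 \<in> J" "max s s0 \<in> J" using s0 by (auto simp: min_def max_def)
    have "R (min s s0) (max s s0) (F a b)"
      using F[OF that(1-4)] parallel_subset[of "{a..b}" _ "{min s s0..max s s0}"] that by (auto simp: R_def)
    from R_unique[OF F[OF m] this m] show ?thesis unfolding \<Psi>_def by simp
  qed
  have "parallel J \<Psi>"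
    unfolding parallel_def
  proof (intro conjI ballI)
    fix s assume "s \<in> J"
    then have m: "min s s0 \<in> J" "max s s0 \<in> J" using s0 by (auto simp: min_def max_def)
    show "invertible (\<Psi> s)"
      using F[OF m] unfolding R_def parallel_def \<Psi>_def by simp
  next
    fix V s assume V: "V \<in> fields 1 0" and s: "s \<in> J"
    \<comment> \<open>\<open>{a..b}\<close> is a compact interval that contains \<open>s\<close> and \<open>s0\<close> and all elements of \<open>J\<close> between \<open>l\<close> and
      \<open>r\<close>; so it is a neighbourhood of \<open>s\<close> in \<open>J\<close>, also if \<open>s\<close> is an end point of \<open>J\<close>.\<close>
    obtain a l where a: "a \<in> J" "a \<le> min s s0" "l < s" "\<And>t. t \<in> J \<Longrightarrow> l < t \<Longrightarrow> a \<le> t"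
    proof (cases "\<exists>a\<in>J. a < min s s0")
      case True
      then obtain a where "a \<in> J" "a < min s s0" by blast
      then show ?thesis using that[of a a] by simp
    next
      case False
      then show ?thesis using that[of "min s s0" "s - 1"] s s0 by (auto simp: not_less min_def split: if_splits)
    qed
    obtain b r where b: "b \<in> J" "max s s0 \<le> b" "s < r" "\<And>t. t \<in> J \<Longrightarrow> t < r \<Longrightarrow> t \<le> b"
    proof (cases "\<exists>b\<in>J. max s s0 < b")
      case True
      then obtain b where "b \<in> J" "max s s0 < b" by blast
      then show ?thesis using that[of b b] by simp
    next
      case False
      then show ?thesis using that[of "max s s0" "s + 1"] s s0 by (auto simp: not_less max_def split: if_splits)
    qed
    have at: "at s within {a..b} = at s within J"
      by (rule at_within_nhd[of _ "{l<..<r}"]) (use a b sub[OF a(1) b(1)] in auto)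
    have ab: "a \<le> s0" "s0 \<le> b" "s \<in> {a..b}" using a b by auto
    have "parallel {a..b} (F a b)" using F[OF a(1) b(1) ab(1,2)] by (simp add: R_def)
    then have d: "((\<lambda>t. F a b t *v vec_at V t) has_vector_derivative
        \<Psi> s *v vec_at (D V) s) (at s within {a..b})"
      using V ab(3) unfolding parallel_def \<Psi>F[OF a(1) b(1) ab] by blast
    have "((\<lambda>t. \<Psi> t *v vec_at V t) has_vector_derivative
        \<Psi> s *v vec_at (D V) s) (at s within {a..b})"
      by (rule has_vector_derivative_transform[OF ab(3) _ d]) (simp add: \<Psi>F[OF a(1) b(1) ab(1,2)])
    then show "((\<lambda>t. \<Psi> t *v vec_at V t) has_vector_derivative
        \<Psi> s *v vec_at (D V) s) (at s within J)"
      by (simp add: at)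
  qed
  then show ?thesis by blast
qed

text \<open>
  The derivative \<open>\<Psi> \<Gamma>\<close> is continuous because \<open>\<Gamma>\<close> is, that is, because \<open>D\<close> maps C1 fields to continuous
  fields.
\<close>

lemma parallel_C1_coframe:
  assumes par: "parallel J \<Psi>"
  shows "C1_coframe \<Psi>"
  unfolding C1_coframe_def
proof (intro conjI ballI)
  fix s assume "s \<in> J"
  then show "invertible (\<Psi> s)" using par by (simp add: parallel_def)
next
  fix c assume c: "c \<in> \<A>"
  show "C1_on (params c) (chart_coframe \<Psi> c)"
  proof (rule C1_on_local)
    fix s assume s: "s \<in> params c"
    then show "s islimpt params c" using islimpt_pullback chart_homeomorphism(1)[OF c] by blast
    have "\<gamma> s \<in> fst c" using s by simp
    then obtain W E \<Gamma> where W: "\<gamma> s \<in> W" and con: "connection_on c W E \<Gamma>"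
      by (rule connection_exists[OF c])
    have Wo: "open W" "W \<subseteq> fst c" and \<Gamma>: "continuous_on {s \<in> J. \<gamma> s \<in> W} \<Gamma>"
      using con unfolding connection_on_def by blast+
    obtain N where N: "open N" "{s \<in> J. \<gamma> s \<in> W} = J \<inter> N" by (rule open_pullback[OF Wo(1)])
    have dN: "params c \<inter> N = J \<inter> N" using N Wo(2) by blast
    have d: "(chart_coframe \<Psi> c has_vector_derivative chart_coframe \<Psi> c t ** \<Gamma> t) (at t within J \<inter> N)" if "t \<in> J \<inter> N" for t
    proof -
      have "t \<in> J" "\<gamma> t \<in> W" "t \<in> N" using that N(2) by blast+
      then show ?thesis
        unfolding at_within_Int_open[OF N(1) \<open>t \<in> N\<close>]
        by (intro parallel_ode[OF par order.refl _ _ c con])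
    qed
    have "C1_on (J \<inter> N) (chart_coframe \<Psi> c)"
    proof (rule C1_onI[OF d])
      have "continuous_on (J \<inter> N) (chart_coframe \<Psi> c)"
        using d by (metis continuous_on_eq_continuous_within has_vector_derivative_continuous)
      then show "continuous_on (J \<inter> N) (\<lambda>t. chart_coframe \<Psi> c t ** \<Gamma> t)"
        using \<Gamma> unfolding N(2) by (intro bounded_bilinear.continuous_on[OF bounded_bilinear_matrix_mult])
    qed
    moreover have "s \<in> N" using W s N(2) by blast
    ultimately show "\<exists>N. open N \<and> s \<in> N \<and> C1_on (params c \<inter> N) (chart_coframe \<Psi> c)"
      using N(1) dN by metis
  qed
qed

text \<open>
  Both sides are derivations at the parameter \<open>s\<close>, agree on functions, and agree on vector fields as
  \<open>\<Psi>\<close> is parallel.  The passage to other types contracts with local fields whose components at \<open>\<gamma> s\<close>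
  are standard vectors or covectors: in \<open>C (D A \<otimes> B) = D (C (A \<otimes> B)) - C (A \<otimes> D B)\<close> the right-hand side
  involves only types that are already settled.
\<close>

lemma derivation_eq_nabla:
  assumes par: "parallel J \<Psi>" and "T \<in> fields p q" and s: "s \<in> J"
  shows "D T (\<gamma> s) = nabla \<Psi> T s"
proof -
  have \<Psi>: "C1_coframe \<Psi>" by (rule parallel_C1_coframe[OF par])
  let ?c = "\<kappa> s"
  obtain W where W: "open W" "\<gamma> s \<in> W" "W \<subseteq> fst ?c"
    and loc: "\<And>p q B. has_type p q B \<Longrightarrow> \<exists>T \<in> fields p q. \<forall>s\<in>J. \<gamma> s \<in> W \<longrightarrow> T (\<gamma> s) ?c = B"
    by (rule local_fields[OF chart_at], rule that)
  have loc': "\<exists>T \<in> fields p q. T (\<gamma> s) ?c = B" if "has_type p q B" for p q B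
    using loc[OF that] s W(2) by blast
  define ok where "ok p q \<longleftrightarrow> (\<forall>T \<in> fields p q. D T (\<gamma> s) = nabla \<Psi> T s)" for p q
  have "ok 0 0"
    unfolding ok_def
  proof
    fix T assume "T \<in> fields 0 0"
    then obtain f where f: "C1_on J (f \<circ> \<gamma>)" "T = scalar_field \<A> (\<gamma> ` J) f" by (rule scalar_field_cases)
    obtain r where "((f \<circ> \<gamma>) has_real_derivative r) (at s within J)"
      using f(1) s unfolding C1_on_def has_real_derivative_iff_has_vector_derivative by blast
    then show "D T (\<gamma> s) = nabla \<Psi> T s"
      using on_functions f s nabla_scalar[OF \<Psi> s] unfolding differentiates_functions_along_def by simp
  qed
  have vec: "ok 1 0"
    unfolding ok_def
  proof
    fix V assume V: "V \<in> fields 1 0"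
    have "nabla \<Psi> V s = D V (\<gamma> s)"
    proof (rule nabla_eqI[OF \<Psi> s D_in[OF V s]])
      fix us ls :: "'n list"
      let ?v = "\<lambda>t. \<Psi> t *v vec_at V t" and ?w = "\<Psi> s *v vec_at (D V) s"
      have comps: "comps \<Psi> t A = vec_arr (\<Psi> t *v arr_vec (A (\<kappa> t)))" if "A \<in> tensors 1 0 t" for t A
        using vec_arr_arr_vec[OF has_type_comps[OF that, of \<Psi>]] by (simp add: comps_def arr_vec_act)
      have "(?v has_vector_derivative ?w) (at s within J)" using par V s unfolding parallel_def by blast
      then have "((\<lambda>t. ?v t $ i) has_vector_derivative ?w $ i) (at s within J)" for i
        by (rule bounded_linear.has_vector_derivative[OF bounded_linear_vec_nth])
      then have "((\<lambda>t. vec_arr (?v t) us ls) has_vector_derivative vec_arr ?w us ls) (at s within J)"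
        by (cases "length us = 1 \<and> ls = []") (auto simp: vec_arr_def)
      then show "((\<lambda>t. comps \<Psi> t (V (\<gamma> t)) us ls) has_vector_derivative comps \<Psi> s (D V (\<gamma> s)) us ls) (at s within J)"
        unfolding comps[OF D_in[OF V s]]
        by (rule has_vector_derivative_transform[OF s, rotated]) (simp only: comps[OF fieldD(1)[OF V]])
    qed
    then show "D V (\<gamma> s) = nabla \<Psi> V s" ..
  qed
  have contr: "arr_contr p q (arr_prod p' q' (D A (\<gamma> s) ?c) (B (\<gamma> s) ?c)) = arr_contr p q (arr_prod p' q' (nabla \<Psi> A s ?c) (B (\<gamma> s) ?c))"
    if A: "A \<in> fields p' q'" and B: "B \<in> fields i j" and okB: "ok i j" and okpq: "ok p q"
      and t: "p' + i = Suc p" "q' + j = Suc q" for p q p' q' i j A B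
  proof -
    let ?P = "\<lambda>x. tensor_prod p' q' (A x) (B x)"
    have P: "?P \<in> fields (Suc p) (Suc q)" using field_prod[OF A B] t by simp
    have "D (\<lambda>x. contraction p q (?P x)) (\<gamma> s) = nabla \<Psi> (\<lambda>x. contraction p q (?P x)) s"
      using okpq field_contraction[OF P order.refl order.refl] unfolding ok_def by blast
    then have "contraction p q (D ?P (\<gamma> s)) = contraction p q (nabla \<Psi> ?P s)"
      by (simp only: D_contraction[OF order.refl order.refl P] nabla_contraction[OF \<Psi> P order.refl order.refl s])
    moreover have "D B (\<gamma> s) = nabla \<Psi> B s" using okB B unfolding ok_def by blast
    ultimately have "contraction p q (tensor_lin 1 (tensor_prod p' q' (D A (\<gamma> s)) (B (\<gamma> s))) 1 (tensor_prod p' q' (A (\<gamma> s)) (nabla \<Psi> B s))) ?c =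
        contraction p q (tensor_lin 1 (tensor_prod p' q' (nabla \<Psi> A s) (B (\<gamma> s))) 1 (tensor_prod p' q' (A (\<gamma> s)) (nabla \<Psi> B s))) ?c"
      by (simp add: D_prod[OF A B] nabla_prod[OF \<Psi> A B s])
    then show ?thesis
      by (simp add: contraction_def tensor_lin_def tensor_prod_def arr_contr_def arr_prod_def fun_eq_iff sum.distrib)
  qed
  have supp1: "has_type p q (D A (\<gamma> s) ?c)" "has_type p q (nabla \<Psi> A s ?c)" if "A \<in> fields p q" for A p q
    using that by (auto intro: tensor_has_type D_in nabla_in[OF \<Psi>] s)
  have eqI: "D A (\<gamma> s) = nabla \<Psi> A s" if "A \<in> fields p q" "D A (\<gamma> s) ?c = nabla \<Psi> A s ?c" for A p q
    by (rule tensor_eqI[OF D_in[OF that(1) s] nabla_in[OF \<Psi> that(1) s] chart_at that(2)])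
  have lower: "ok p (Suc q)" if "ok p q" for p q
    unfolding ok_def
  proof
    fix A assume A: "A \<in> fields p (Suc q)"
    show "D A (\<gamma> s) = nabla \<Psi> A s"
    proof (rule eqI[OF A arr_eq_by_vectors[OF supp1[OF A]]])
      fix j
      obtain B where B: "B \<in> fields 1 0" "B (\<gamma> s) ?c = vec_arr (axis j 1)"
        using loc'[OF has_type_vec_arr] by blast
      show "arr_contr p q (arr_prod p (Suc q) (D A (\<gamma> s) ?c) (vec_arr (axis j 1))) =
          arr_contr p q (arr_prod p (Suc q) (nabla \<Psi> A s ?c) (vec_arr (axis j 1)))"
        using contr[OF A B(1) vec that] B(2) by simp
    qed
  qed
  have upper: "ok (Suc p) q" if "ok p q" "ok 0 1" for p q
    unfolding ok_def
  proof
    fix A assume A: "A \<in> fields (Suc p) q"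
    show "D A (\<gamma> s) = nabla \<Psi> A s"
    proof (rule eqI[OF A arr_eq_by_covectors[OF supp1[OF A]]])
      fix j
      obtain B where B: "B \<in> fields 0 1" "B (\<gamma> s) ?c = covec_arr (axis j 1)"
        using loc'[OF has_type_covec_arr] by blast
      show "arr_contr p q (arr_prod (Suc p) q (D A (\<gamma> s) ?c) (covec_arr (axis j 1))) =
          arr_contr p q (arr_prod (Suc p) q (nabla \<Psi> A s ?c) (covec_arr (axis j 1)))"
        using contr[OF A B(1) that(2,1)] B(2) by simp
    qed
  qed
  from \<open>ok 0 0\<close> have covariant: "ok 0 q" for q by (induction q) (auto intro: lower)
  then have "ok p q" for p q
    by (induction p) (auto intro: upper simp del: One_nat_def)
  then show ?thesis using assms(2) unfolding ok_def by blast
qed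

lemma transport_exists:
  obtains \<Psi> where "parallel J \<Psi>" "S_transport \<A> J \<gamma> (frame_transport \<Psi>)" "C1_transport \<A> J \<gamma> (frame_transport \<Psi>)"
    "generates \<A> J \<gamma> (frame_transport \<Psi>) D"
proof -
  obtain \<Psi> where par: "parallel J \<Psi>" using parallel_exists by blast
  have \<Psi>: "C1_coframe \<Psi>" by (rule parallel_C1_coframe[OF par])
  show ?thesis
  proof (rule that[OF par])
    show "S_transport \<A> J \<gamma> (frame_transport \<Psi>)"
      by (rule S_transport_frame_transport) (use \<Psi> in \<open>simp add: C1_coframe_def\<close>)
    show "C1_transport \<A> J \<gamma> (frame_transport \<Psi>)" by (rule C1_transport_frame_transport[OF \<Psi>])
    show "generates \<A> J \<gamma> (frame_transport \<Psi>) D"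
      unfolding generates_iff[OF \<Psi> refl] by (auto simp: derivation_eq_nabla[OF par])
  qed
qed

text \<open>
  The coframe of any C1 transport that generates \<open>D\<close> is parallel, hence equals \<open>\<Psi>\<close> up to a constant
  matrix \<open>Q\<close> on the left, which cancels in \<open>(\<Psi> t)\<^sup>-\<^sup>1 ** \<Psi> s\<close>.
\<close>

lemma transport_unique:
  assumes par: "parallel J \<Psi>" and S: "S_transport \<A> J \<gamma> S" "C1_transport \<A> J \<gamma> S" "generates \<A> J \<gamma> S D"
    and st: "s \<in> J" "t \<in> J" and A: "A \<in> tensors p q s"
  shows "S s t A = frame_transport \<Psi> s t A"
proof -
  obtain \<Psi>' where \<Psi>': "C1_coframe \<Psi>'"
    and S_eq: "\<And>s t p q A. s \<in> J \<Longrightarrow> t \<in> J \<Longrightarrow> A \<in> tensors p q s \<Longrightarrow> S s t A = frame_transport \<Psi>' s t A"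
    by (rule S_transport_coframe[OF S(1,2)], rule that)
  have inv': "invertible (\<Psi>' s)" if "s \<in> J" for s using \<Psi>' that by (simp add: C1_coframe_def)
  have inv: "invertible (\<Psi> s)" if "s \<in> J" for s using par that by (simp add: parallel_def)
  have "parallel J \<Psi>'"
    unfolding parallel_def
  proof (intro conjI ballI inv')
    fix V s assume V: "V \<in> fields 1 0" and s: "s \<in> J"
    have D: "D V (\<gamma> s) (\<kappa> s) = nabla \<Psi>' V s (\<kappa> s)"
      by (rule generates_iff[OF \<Psi>', THEN iffD1, OF _ S(3), rule_format, OF _ V s chart_at]) (rule S_eq)
    have comps: "comps \<Psi>' t A [i] [] = (\<Psi>' t *v arr_vec (A (\<kappa> t))) $ i" for t A i
      by (simp add: comps_def arr_vec_act[of _ "matrix_inv (\<Psi>' t)", symmetric]) (simp add: arr_vec_def)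
    show "((\<lambda>t. \<Psi>' t *v vec_at V t) has_vector_derivative \<Psi>' s *v vec_at (D V) s) (at s within J)"
      by (rule has_vector_derivative_vecI) (use comps_nabla[OF \<Psi>' V s] D in \<open>simp flip: comps\<close>)
  qed
  moreover have "convex J" using interval by (rule is_interval_convex)
  ultimately obtain Q where Q: "\<And>s. s \<in> J \<Longrightarrow> \<Psi> s ** matrix_inv (\<Psi>' s) = Q"
    using parallel_unique[OF par _ order.refl] by blast
  have \<Psi>_eq: "\<Psi> r = Q ** \<Psi>' r" if "r \<in> J" for r
    using Q[OF that] matrix_inv_works(2)[OF inv'[OF that]] by (metis matrix_mul_assoc matrix_mul_rid)
  have iQ: "invertible Q"
    using Q[OF st(1)] invertible_mult[OF inv[OF st(1)] invertible_matrix_inv[OF inv'[OF st(1)]]] by simp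
  have "matrix_inv (\<Psi> a) ** \<Psi> b = matrix_inv (\<Psi>' a) ** \<Psi>' b" if "a \<in> J" "b \<in> J" for a b
  proof -
    have "matrix_inv (\<Psi> a) ** \<Psi> b = matrix_inv (\<Psi>' a) ** (matrix_inv Q ** Q) ** \<Psi>' b"
      unfolding \<Psi>_eq[OF that(1)] \<Psi>_eq[OF that(2)] matrix_inv_mult[OF iQ inv'[OF that(1)]]
      by (simp only: matrix_mul_assoc)
    then show ?thesis by (simp add: matrix_inv_works(2)[OF iQ])
  qed
  then have "frame_transport \<Psi>' s t A = frame_transport \<Psi> s t A"
    using st by (simp add: frame_transport_def from_frame_def comps_def act_act)
  then show ?thesis using S_eq[OF st A] by simp
qed

end

section \<open>Derivations and S-transports\<close>

theorem proposition3p5: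
  fixes \<A> :: "('a::t2_space, 'n::finite) chart set"
    and J :: "real set"
    and \<gamma> :: "real \<Rightarrow> 'a"
    and D :: "('a \<Rightarrow> ('a, 'n) tensor) \<Rightarrow> ('a \<Rightarrow> ('a, 'n) tensor)"
  assumes "C1_atlas \<A>"
    and "is_interval J" and "\<exists>a\<in>J. \<exists>b\<in>J. a < b"
    and "C1_path \<A> J \<gamma>"
    and "C1_jacobians_along \<A> J \<gamma>"
    and "\<And>p q T. T \<in> C1_tensor_fields \<A> J \<gamma> p q \<Longrightarrow> \<exists>p' q'. D T \<in> tensor_fields \<A> (\<gamma> ` J) p' q'"
  shows "(derivation_along \<A> J \<gamma> D \<and>
            differentiates_functions_along \<A> J \<gamma> D \<and> maps_C1_to_C0_along \<A> J \<gamma> D) \<longleftrightarrow>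
         (\<exists>S. S_transport \<A> J \<gamma> S \<and> C1_transport \<A> J \<gamma> S \<and> generates \<A> J \<gamma> S D \<and>
            (\<forall>S'. S_transport \<A> J \<gamma> S' \<and> C1_transport \<A> J \<gamma> S' \<and> generates \<A> J \<gamma> S' D \<longrightarrow>
               (\<forall>s\<in>J. \<forall>t\<in>J. \<forall>p q. \<forall>A \<in> tensor_space \<A> p q (\<gamma> s). S' s t A = S s t A)))"
  (is "?derivation \<longleftrightarrow> ?transport")
proof -
  interpret curve \<A> J \<gamma> by unfold_locales (fact assms)+
  show ?thesis
  proof
    assume ?derivation
    then interpret derivation_curve \<A> J \<gamma> D by unfold_locales auto
    obtain \<Psi> where \<Psi>: "parallel J \<Psi>" "S_transport \<A> J \<gamma> (frame_transport \<Psi>)" "C1_transport \<A> J \<gamma> (frame_transport \<Psi>)"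
      "generates \<A> J \<gamma> (frame_transport \<Psi>) D" by (rule transport_exists)
    then show ?transport
      using transport_unique[OF \<Psi>(1)] by (intro exI[of _ "frame_transport \<Psi>"]) blast
  next
    assume ?transport
    then obtain S where S: "S_transport \<A> J \<gamma> S" "C1_transport \<A> J \<gamma> S" "generates \<A> J \<gamma> S D"
      by blast
    show ?derivation
      by (intro conjI derivation_if_generated[OF S]) (use assms(6) in blast)+
  qed
qed

end
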